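(* Let $K$ be a compact Hausdorff space and let $\mathcal{S}\subset\mathcal{L}(C(K))$ be a right amenable semigroup of Markov operators. The following assertions are equivalent. (a) $\mathcal{S}$ is mean ergodic. (b) The following two conditions are satisfied. (i) The mapping $\mathrm{ex}\,P_{\mathcal{S}}(K)\to\mathrm{Prim}(\mathcal{S})$, $\mu\mapsto I_\mu$, is a homeomorphism. (ii) For each $f\in\mathrm{fix}(\mathcal{S}_{\mathrm{rad}_{\mathcal{S}}(0)})$ there is $F\in\mathrm{fix}(\mathcal{S})$ with $f=F|_{M(\mathcal{S})}$. (c) The following three conditions are satisfied. (i) The primitive spectrum $\mathrm{Prim}(\mathcal{S})$ is a Hausdorff space. (ii) For each $\mu\in\mathrm{ex}\,P_{\mathcal{S}}(K)$ the support $\mathrm{supp}\,\mu$ is uniquely ergodic, i.e. $\mu$ is the only invariant (probability) measure having its support in $\mathrm{supp}\,\mu$. (iii) For each $f\in\mathrm{fix}(\mathcal{S}_{\mathrm{rad}_{\mathcal{S}}(0)})$ there is $F\in\mathrm{fix}(\mathcal{S})$ with $f=F|_{M(\mathcal{S})}$.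
   Context: $C(K)$ is the Banach lattice of continuous complex-valued functions on $K$; its dual $C(K)'$ is identified with the complex regular Borel measures on $K$, with $\langle f,\mu\rangle=\int_K f\,d\mu$. $\mathcal{L}(C(K))$ denotes the bounded linear operators on $C(K)$; $T\in\mathcal{L}(C(K))$ is Markov if it is positive and $T\mathbf{1}=\mathbf{1}$. A semigroup $\mathcal{S}\subset\mathcal{L}(C(K))$ (under composition, with the strong operator topology) is right amenable if there is a positive $m\in C_b(\mathcal{S})'$ with $m(\mathbf{1})=1$ and $m(R_Sf)=m(f)$ for all $f\in C_b(\mathcal{S})$, $S\in\mathcal{S}$, where $(R_Sf)(T)=f(TS)$. For a semigroup of operators, $\mathrm{fix}$ denotes its common fixed space. $\mathcal{S}$ is mean ergodic if there is $P\in\overline{\mathrm{co}}\,\mathcal{S}$ (closed convex hull in the strong operator topology) with $PS=SP=P$ for each $S\in\mathcal{S}$. $P_{\mathcal{S}}(K)$ is the set of probability measures $\mu\in C(K)'$ with $S'\mu=\mu$ for all $S\in\mathcal{S}$, with the weak* topology; $\mathrm{ex}\,P_{\mathcal{S}}(K)$ is its set of extreme points (with the subspace topology), which coincides with the set of ergodic measures, where $\mu\in P_{\mathcal{S}}(K)$ is ergodic if the common fixed space in $L^1(K,\mu)$ of the operators $S_\mu$ induced there (by continuous extension) by all $S\in\mathcal{S}$ is one-dimensional. The support of a probability measure $\mu\in C(K)'$ is the smallest closed $A\subset K$ with $\mu(A)=1$. Put $I_\mu=\{f\in C(K): \langle |f|,\mu\rangle=0\}$. $\mathrm{Prim}(\mathcal{S})=\{I_\mu: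 \mu\in P_{\mathcal{S}}(K)\text{ ergodic}\}$ is the primitive spectrum, equipped with the hull-kernel topology: the closure of $A\subset\mathrm{Prim}(\mathcal{S})$ is $\{q\in\mathrm{Prim}(\mathcal{S}):\bigcap_{p\in A}p\subset q\}$ (the empty intersection being $C(K)$). $\mathrm{rad}_{\mathcal{S}}(0)=\bigcap_{p\in\mathrm{Prim}(\mathcal{S})}p$, and $M(\mathcal{S})$ is its support, i.e. the closed set with $\mathrm{rad}_{\mathcal{S}}(0)=\{f\in C(K): f|_{M(\mathcal{S})}=0\}$; equivalently, the closure of the union of the supports of all ergodic measures. $\mathcal{S}_{\mathrm{rad}_{\mathcal{S}}(0)}$ is the semigroup of Markov operators on $C(M(\mathcal{S}))$ induced by $\mathcal{S}$: each $S\in\mathcal{S}$ induces $f\mapsto (SF)|_{M(\mathcal{S})}$, where $F\in C(K)$ is any extension of $f\in C(M(\mathcal{S}))$. *)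

theory Defs
  imports "HOL-Probability.Probability"
begin

section \<open>The space \<open>C(K)\<close> and Markov operators\<close>

text \<open>
  For a compact Hausdorff space \<open>K\<close>, given as a type \<^typ>\<open>'k::t2_space\<close>, every continuous function
  is bounded, so \<open>C(K)\<close> is the type of bounded continuous functions with the supremum norm.
\<close>

type_synonym 'k CK = "'k \<Rightarrow>\<^sub>C complex"
type_synonym 'k CK_op = "'k CK \<Rightarrow>\<^sub>L 'k CK"

text \<open>
  The library only equips \<open>C(K)\<close> with real scalar multiplication, and \<open>\<Rightarrow>\<^sub>L\<close> is the type of
  bounded real-linear maps; complex homogeneity has to be required separately.
\<close>

definition cscale :: "complex \<Rightarrow> 'k::topological_space CK \<Rightarrow> 'k CK" where
  "cscale c f = Bcontfun (\<lambda>x. c * f x)"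

lemma cscale_apply [simp]: "apply_bcontfun (cscale c f) x = c * apply_bcontfun f x"
proof -
  have "(\<lambda>x. c * apply_bcontfun f x) \<in> bcontfun"
    by (rule bcontfun_normI[where b = "cmod c * norm f"])
      (auto intro!: continuous_intros mult_left_mono norm_bounded simp: norm_mult)
  then show ?thesis
    by (simp add: cscale_def Bcontfun_inverse)
qed

definition complex_linear_op :: "'k::topological_space CK_op \<Rightarrow> bool" where
  "complex_linear_op T \<longleftrightarrow> (\<forall>c. \<forall>f :: 'k CK. T (cscale c f) = cscale c (T f))"

definition positive_op :: "'k::topological_space CK_op \<Rightarrow> bool" where
  "positive_op T \<longleftrightarrow>
     (\<forall>f :: 'k CK. (\<forall>x. apply_bcontfun f x \<in> \<real>\<^sub>\<ge>\<^sub>0) \<longrightarrow> (\<forall>x. apply_bcontfun (T f) x \<in> \<real>\<^sub>\<ge>\<^sub>0))"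

definition markov_op :: "'k::topological_space CK_op \<Rightarrow> bool" where
  "markov_op T \<longleftrightarrow>
     complex_linear_op T \<and> positive_op T \<and> T (const_bcontfun 1) = const_bcontfun 1"

definition op_semigroup :: "'k::topological_space CK_op set \<Rightarrow> bool" where
  "op_semigroup \<S> \<longleftrightarrow> (\<forall>S\<in>\<S>. \<forall>T\<in>\<S>. S o\<^sub>L T \<in> \<S>)"

definition fix_ops :: "'k::topological_space CK_op set \<Rightarrow> 'k CK set" where
  "fix_ops \<S> = {f. \<forall>S\<in>\<S>. S f = f}"


section \<open>Right amenability and mean ergodicity\<close>

text \<open>
  Elements of \<open>C_b(\<S>)\<close> are represented by functions on all operators of which only the values
  on \<open>\<S>\<close> matter.
\<close>

definition Cb :: "'k::topological_space CK_op set \<Rightarrow> ('k CK_op \<Rightarrow> complex) set" where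
  "Cb \<S> = {f. continuous_map (subtopology strong_operator_topology \<S>) euclidean f \<and> bounded (f ` \<S>)}"

text \<open>
  The boundedness condition is with respect to the supremum norm over \<open>\<S>\<close>. Together with
  additivity it forces \<open>m f\<close> to depend only on the restriction of \<open>f\<close> to \<open>\<S>\<close>, and it excludes
  \<open>\<S> = {}\<close>, where \<open>C_b(\<S>)\<close> is the zero space.
\<close>

definition right_invariant_mean ::
  "'k::topological_space CK_op set \<Rightarrow> (('k CK_op \<Rightarrow> complex) \<Rightarrow> complex) \<Rightarrow> bool" where
  "right_invariant_mean \<S> m \<longleftrightarrow>
     (\<forall>f\<in>Cb \<S>. \<forall>g\<in>Cb \<S>. m (\<lambda>T. f T + g T) = m f + m g) \<and>
     (\<forall>c. \<forall>f\<in>Cb \<S>. m (\<lambda>T. c * f T) = c * m f) \<and>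
     (\<exists>B. \<forall>f\<in>Cb \<S>. \<forall>b. (\<forall>T\<in>\<S>. cmod (f T) \<le> b) \<longrightarrow> cmod (m f) \<le> B * b) \<and>
     (\<forall>f\<in>Cb \<S>. (\<forall>T\<in>\<S>. f T \<in> \<real>\<^sub>\<ge>\<^sub>0) \<longrightarrow> m f \<in> \<real>\<^sub>\<ge>\<^sub>0) \<and>
     m (\<lambda>_. 1) = 1 \<and>
     (\<forall>S\<in>\<S>. \<forall>f\<in>Cb \<S>. m (\<lambda>T. f (T o\<^sub>L S)) = m f)"

definition right_amenable :: "'k::topological_space CK_op set \<Rightarrow> bool" where
  "right_amenable \<S> \<longleftrightarrow> (\<exists>m. right_invariant_mean \<S> m)"

definition mean_ergodic :: "'k::topological_space CK_op set \<Rightarrow> bool" where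
  "mean_ergodic \<S> \<longleftrightarrow>
     (\<exists>P \<in> strong_operator_topology closure_of (convex hull \<S>). \<forall>S\<in>\<S>. P o\<^sub>L S = P \<and> S o\<^sub>L P = P)"


section \<open>Invariant and ergodic measures\<close>

definition regular_prob :: "'k::t2_space measure \<Rightarrow> bool" where
  "regular_prob \<mu> \<longleftrightarrow>
     sets \<mu> = sets borel \<and> prob_space \<mu> \<and>
     (\<forall>B\<in>sets borel.
        emeasure \<mu> B = (SUP C\<in>{C. compact C \<and> C \<subseteq> B}. emeasure \<mu> C) \<and>
        emeasure \<mu> B = (INF U\<in>{U. open U \<and> B \<subseteq> U}. emeasure \<mu> U))"

text \<open>The element of \<open>C(K)'\<close> given by a measure.\<close>

definition functional :: "'k::topological_space measure \<Rightarrow> 'k CK \<Rightarrow>\<^sub>L complex" where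
  "functional \<mu> = Blinfun (\<lambda>f :: 'k CK. \<integral>x. f x \<partial>\<mu>)"

lemma functional_apply:
  fixes f :: "'k::t2_space CK"
  assumes "regular_prob \<mu>"
  shows "functional \<mu> f = (\<integral>x. f x \<partial>\<mu>)"
proof -
  interpret prob_space \<mu>
    using assms by (simp add: regular_prob_def)
  have sets: "sets \<mu> = sets borel"
    using assms by (simp add: regular_prob_def)
  have meas: "apply_bcontfun g \<in> borel_measurable \<mu>" for g :: "'k CK"
    using borel_measurable_continuous_onI[OF continuous_on_apply_bcontfun, of g]
    by (simp add: measurable_cong_sets[OF sets refl])
  have int: "integrable \<mu> (apply_bcontfun g)" for g :: "'k CK"
    by (rule integrable_const_bound[where B = "norm g"]) (auto intro: norm_bounded meas)
  have "bounded_linear (\<lambda>g :: 'k CK. \<integral>x. g x \<partial>\<mu>)"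
  proof (rule bounded_linear_intro[where K = 1])
    fix g :: "'k CK"
    have "cmod (\<integral>x. g x \<partial>\<mu>) \<le> (\<integral>x. cmod (g x) \<partial>\<mu>)"
      by (rule integral_norm_bound)
    also have "\<dots> \<le> (\<integral>x. norm g \<partial>\<mu>)"
      by (rule integral_mono) (auto intro: int norm_bounded)
    finally show "cmod (\<integral>x. g x \<partial>\<mu>) \<le> norm g * 1"
      by (simp add: prob_space)
  qed (auto simp: int)
  then show ?thesis
    by (simp add: functional_def bounded_linear_Blinfun_apply)
qed

definition inv_prob :: "'k::t2_space CK_op set \<Rightarrow> 'k measure set" where
  "inv_prob \<S> = {\<mu>. regular_prob \<mu> \<and> (\<forall>S\<in>\<S>. functional \<mu> o\<^sub>L S = functional \<mu>)}"

text \<open>For scalar-valued operators the strong operator topology is the weak* topology.\<close>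

definition inv_prob_topology :: "'k::t2_space CK_op set \<Rightarrow> 'k measure topology" where
  "inv_prob_topology \<S> = pullback_topology (inv_prob \<S>) functional strong_operator_topology"

definition ex_inv_prob :: "'k::t2_space CK_op set \<Rightarrow> 'k measure set" where
  "ex_inv_prob \<S> = {\<mu> \<in> inv_prob \<S>. functional \<mu> extreme_point_of (functional ` inv_prob \<S>)}"

definition ex_inv_prob_topology :: "'k::t2_space CK_op set \<Rightarrow> 'k measure topology" where
  "ex_inv_prob_topology \<S> = subtopology (inv_prob_topology \<S>) (ex_inv_prob \<S>)"

text \<open>
  The continuous extension \<open>S_\<mu>\<close> of \<open>S\<close> to \<open>L\<^sup>1(K,\<mu>)\<close>, as a relation between representatives:
  \<open>g = S_\<mu> h\<close> iff \<open>g = lim S f_n\<close> in \<open>L\<^sup>1\<close> for continuous \<open>f_n\<close> with \<open>lim f_n = h\<close> in \<open>L\<^sup>1\<close>.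
\<close>

definition L1_extension ::
  "'k::topological_space CK_op \<Rightarrow> 'k measure \<Rightarrow> ('k \<Rightarrow> complex) \<Rightarrow> ('k \<Rightarrow> complex) \<Rightarrow> bool" where
  "L1_extension S \<mu> h g \<longleftrightarrow>
     integrable \<mu> h \<and> integrable \<mu> g \<and>
     (\<exists>f :: nat \<Rightarrow> 'k CK.
        (\<lambda>n. \<integral>x. cmod (apply_bcontfun (f n) x - h x) \<partial>\<mu>) \<longlonglongrightarrow> 0 \<and>
        (\<lambda>n. \<integral>x. cmod (apply_bcontfun (S (f n)) x - g x) \<partial>\<mu>) \<longlonglongrightarrow> 0)"

definition L1_fix :: "'k::topological_space CK_op set \<Rightarrow> 'k measure \<Rightarrow> ('k \<Rightarrow> complex) set" where
  "L1_fix \<S> \<mu> = {h. integrable \<mu> h \<and> (\<forall>S\<in>\<S>. L1_extension S \<mu> h h)}"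

text \<open>The fixed space is one-dimensional over the complex numbers, modulo null functions.\<close>

definition ergodic :: "'k::t2_space CK_op set \<Rightarrow> 'k measure \<Rightarrow> bool" where
  "ergodic \<S> \<mu> \<longleftrightarrow>
     \<mu> \<in> inv_prob \<S> \<and>
     (\<exists>h\<in>L1_fix \<S> \<mu>. \<not> (AE x in \<mu>. h x = 0) \<and>
        (\<forall>g\<in>L1_fix \<S> \<mu>. \<exists>c. AE x in \<mu>. g x = c * h x))"

definition msupp :: "'k::topological_space measure \<Rightarrow> 'k set" where
  "msupp \<mu> = \<Inter>{A. closed A \<and> measure \<mu> A = 1}"


section \<open>The primitive spectrum and the radical\<close>

definition null_ideal :: "'k::topological_space measure \<Rightarrow> 'k CK set" where
  "null_ideal \<mu> = {f :: 'k CK. (\<integral>x. cmod (f x) \<partial>\<mu>) = 0}"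

definition Prim :: "'k::t2_space CK_op set \<Rightarrow> 'k CK set set" where
  "Prim \<S> = null_ideal ` {\<mu>. ergodic \<S> \<mu>}"

definition hk_closure :: "'k::t2_space CK_op set \<Rightarrow> 'k CK set set \<Rightarrow> 'k CK set set" where
  "hk_closure \<S> A = {q \<in> Prim \<S>. \<Inter>A \<subseteq> q}"

text \<open>
  The topology whose closed sets are the sets \<open>hk_closure \<S> A\<close>. These are closed under arbitrary
  intersections, and under finite unions because the ideals in \<^const>\<open>Prim\<close> come from ergodic
  measures; hence the generating family is already the family of all open sets.
\<close>

definition Prim_topology :: "'k::t2_space CK_op set \<Rightarrow> 'k CK set topology" where
  "Prim_topology \<S> = topology_generated_by {Prim \<S> - hk_closure \<S> A |A. A \<subseteq> Prim \<S>}"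

definition rad :: "'k::t2_space CK_op set \<Rightarrow> 'k CK set" where
  "rad \<S> = \<Inter>(Prim \<S>)"

definition rad_support :: "'k::t2_space CK_op set \<Rightarrow> 'k set" where
  "rad_support \<S> = (THE M. closed M \<and> rad \<S> = {f :: 'k CK. \<forall>x\<in>M. f x = 0})"

definition C_on :: "'k::topological_space set \<Rightarrow> ('k \<Rightarrow> complex) set" where
  "C_on M = {f \<in> extensional M. continuous_on M f}"

text \<open>
  The operator on \<open>C(M)\<close> induced by \<open>S\<close>; it does not depend on the chosen extension when the
  functions vanishing on \<open>M\<close> form an \<open>S\<close>-invariant ideal.
\<close>

definition induced_op ::
  "'k::topological_space set \<Rightarrow> 'k CK_op \<Rightarrow> ('k \<Rightarrow> complex) \<Rightarrow> ('k \<Rightarrow> complex)" where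
  "induced_op M S f = restrict (S (SOME F :: 'k CK. \<forall>x\<in>M. F x = f x)) M"

definition rad_fix :: "'k::t2_space CK_op set \<Rightarrow> ('k \<Rightarrow> complex) set" where
  "rad_fix \<S> =
     {f \<in> C_on (rad_support \<S>). \<forall>S\<in>\<S>. induced_op (rad_support \<S>) S f = f}"

definition uniquely_ergodic :: "'k::t2_space CK_op set \<Rightarrow> 'k measure \<Rightarrow> bool" where
  "uniquely_ergodic \<S> \<mu> \<longleftrightarrow> (\<forall>\<nu>\<in>inv_prob \<S>. msupp \<nu> \<subseteq> msupp \<mu> \<longrightarrow> \<nu> = \<mu>)"

end

theory Submission
  imports Defs
begin

text \<open>
  Let \<open>M\<close> be the support of the radical, and for a point \<open>x\<close> let \<open>\<phi>\<^sub>x f\<close> be the mean of \<open>T \<mapsto> (T f) x\<close>, an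
  invariant state. If \<open>P\<close> is a mean ergodic projection, then \<open>P f\<close> is a fixed function, hence constant on the
  support of each ergodic measure \<open>\<mu>\<close>, with value \<open>\<integral>f d\<mu>\<close>. This gives unique ergodicity of the supports and
  injectivity of \<open>\<mu> \<mapsto> I\<^sub>\<mu>\<close>, and the functions \<open>max (\<epsilon> - \<Sum>|P f\<^sub>i - c\<^sub>i|) 0\<close> separate an ergodic measure from a
  closed set of ergodic measures in the primitive spectrum, so that \<open>\<mu> \<mapsto> I\<^sub>\<mu>\<close> is closed.

  Conversely, (b) and (c) both imply that the primitive spectrum is a Hausdorff space and that \<open>\<mu> \<mapsto> I\<^sub>\<mu>\<close> is
  injective. Disjoint neighbourhoods of two ergodic measures have complements that correspond to two closed
  invariant sets covering \<open>M\<close>, each missing part of the support of one of the measures. Hence the closed orbit of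
  a point \<open>x\<close> of \<open>M\<close> cannot carry two ergodic measures, so \<open>\<phi>\<^sub>x\<close> is ergodic and the only invariant state on this
  orbit; the same separation shows that \<open>x \<mapsto> \<phi>\<^sub>x\<close> is continuous on \<open>M\<close>. Thus \<open>x \<mapsto> \<phi>\<^sub>x f\<close> is a fixed function on
  \<open>M\<close>; it extends to a fixed function on \<open>K\<close> having the same integral as \<open>f\<close> against every invariant measure, and a
  Hahn--Banach argument places the resulting projection in the closed convex hull of the semigroup.
\<close>


section \<open>The Mazur--Orlicz theorem\<close>

text \<open>The space need not be metrizable, so compactness arguments use states: normalised
  positive functionals kept as plain functions, whose weak* topology is a product topology. The
  invariant states vanishing on a set of nonnegative functions form a closed face, and Bauer's
  principle gives it extreme points; thus questions about invariant states on a closed invariant set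
  reduce to ergodic ones.

  \<open>Prim\<close> is defined by ergodic measures, the homeomorphism by extreme points, so the
  two notions have to be identified. Extreme measures are ergodic because a fixed vector of L^1
  becomes, after truncation, an invariant density; ergodic ones are extreme because an invariant
  state dominated by the measure has a fixed density.

  An ergodic measure gives every closed invariant set mass 0 or 1, so the ideals are prime and every
  open set of \<open>Prim_topology\<close> is the complement of a hull-kernel closed set. This is
  why disjoint neighbourhoods yield two covering closed invariant sets.

  In the Hahn--Banach step the functional obtained is not invariant; right invariance of the mean
  makes its average over the semigroup invariant, and the lower bound survives.\<close>

definition sublinear :: "('a::real_vector \<Rightarrow> real) \<Rightarrow> bool" where
  "sublinear p \<longleftrightarrow> (\<forall>x y. p (x + y) \<le> p x + p y) \<and> (\<forall>x. \<forall>c\<ge>0. p (c *\<^sub>R x) = c * p x)"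

text \<open>One inequality suffices for homogeneity: applied to the vector scaled by
  \<open>c\<close>, with the factor \<open>1/c\<close>, it gives the reverse one.\<close>

lemma sublinearI:
  assumes add: "\<And>x y. p (x + y) \<le> p x + p y" and zero: "p 0 = 0"
    and scale: "\<And>c x. c > 0 \<Longrightarrow> p (c *\<^sub>R x) \<le> c * p x"
  shows "sublinear p"
  unfolding sublinear_def
proof (intro conjI allI impI add)
  fix x and c :: real assume "0 \<le> c"
  show "p (c *\<^sub>R x) = c * p x"
  proof (cases "c = 0")
    case False
    with \<open>0 \<le> c\<close> have c: "c > 0" by simp
    have "p ((1/c) *\<^sub>R (c *\<^sub>R x)) \<le> (1/c) * p (c *\<^sub>R x)"
      using c by (intro scale) simp
    then have "c * p x \<le> p (c *\<^sub>R x)" using c by (simp add: field_simps)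
    with scale[OF c, of x] show ?thesis by simp
  qed (simp add: zero)
qed

lemma
  assumes "sublinear p"
  shows sublinear_add: "p (x + y) \<le> p x + p y"
    and sublinear_scale: "c \<ge> 0 \<Longrightarrow> p (c *\<^sub>R x) = c * p x"
    and sublinear_zero: "p 0 = 0"
    and sublinear_minus: "- p (- x) \<le> p x"
proof -
  show "p (x + y) \<le> p x + p y" for x y using assms by (simp add: sublinear_def)
  show "c \<ge> 0 \<Longrightarrow> p (c *\<^sub>R x) = c * p x" for c x using assms by (simp add: sublinear_def)
  from this[of 0 0] show 0: "p 0 = 0" by simp
  have "p (x + - x) \<le> p x + p (- x)" using assms unfolding sublinear_def by blast
  with 0 show "- p (- x) \<le> p x" by simp
qed

text \<open>The new functional is \<open>q x = inf (p (x + t c) - t e)\<close> over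
  \<open>t \<ge> 0\<close> and \<open>c\<close> in \<open>C\<close>; \<open>t = 0\<close> gives
  \<open>q \<le> p\<close>, and \<open>x = - c\<close>, \<open>t = 1\<close> gives the bound at
  \<open>- c\<close>. The infimum is finite because
  \<open>t e \<le> p (t c) \<le> p (x + t c) + p (- x)\<close>.\<close>

lemma sublinear_push_down:
  assumes p: "sublinear p" and C: "convex C" "C \<noteq> {}" and eps: "\<And>c. c \<in> C \<Longrightarrow> e \<le> p c"
  obtains q where "sublinear q" "\<And>x. q x \<le> p x" "\<And>c. c \<in> C \<Longrightarrow> q (- c) \<le> - e"
proof -
  define A where "A x = {p (x + t *\<^sub>R c) - t * e | t c. t \<ge> 0 \<and> c \<in> C}" for x
  define q where "q x = Inf (A x)" for x
  have A_mem: "p (x + t *\<^sub>R c) - t * e \<in> A x" if "t \<ge> 0" "c \<in> C" for x t c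
    using that unfolding A_def by blast
  have lower: "- p (- x) \<le> a" if "a \<in> A x" for a x
  proof -
    from that obtain t c where t: "t \<ge> 0" "c \<in> C" and a: "a = p (x + t *\<^sub>R c) - t * e"
      unfolding A_def by blast
    have "p (t *\<^sub>R c) \<le> p (x + t *\<^sub>R c) + p (- x)"
      using sublinear_add[OF p, of "x + t *\<^sub>R c" "- x"] by (simp add: algebra_simps)
    moreover have "t * e \<le> p (t *\<^sub>R c)"
      using t eps[of c] by (simp add: sublinear_scale[OF p] mult_left_mono)
    ultimately show ?thesis using a by simp
  qed
  have bdd: "bdd_below (A x)" for x using lower unfolding bdd_below_def by blast
  have ne: "A x \<noteq> {}" for x using C(2) A_mem[of 0] by blast
  have q_le: "q x \<le> p (x + t *\<^sub>R c) - t * e" if "t \<ge> 0" "c \<in> C" for x t c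
    unfolding q_def using A_mem[OF that] bdd by (rule cInf_lower)
  have q_ge: "r \<le> q x" if "\<And>t c. t \<ge> 0 \<Longrightarrow> c \<in> C \<Longrightarrow> r \<le> p (x + t *\<^sub>R c) - t * e" for r x
    unfolding q_def using that by (intro cInf_greatest ne) (auto simp: A_def)
  obtain c0 where c0: "c0 \<in> C" using C(2) by blast
  have qp: "q x \<le> p x" for x using q_le[of 0 c0 x] c0 by simp
  \<comment> \<open>Convexity of \<open>C\<close> enters here: \<open>t c + s d\<close> is
    \<open>t + s\<close> times a point of \<open>C\<close>, so two competitors for \<open>x\<close>
    and \<open>y\<close> together dominate one for \<open>x + y\<close>.\<close>
  have add1: "q (x + y) \<le> (p (x + t *\<^sub>R c) - t * e) + (p (y + s *\<^sub>R d) - s * e)"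
    if ts0: "t \<ge> 0" "c \<in> C" "s \<ge> 0" "d \<in> C" for x y t c s d
  proof -
    obtain b where b: "b \<in> C" "(t + s) *\<^sub>R b = t *\<^sub>R c + s *\<^sub>R d"
    proof (cases "t + s = 0")
      case True
      then have "t = 0" "s = 0" using ts0 by auto
      then show ?thesis using ts0(2) by (intro that[of c]) auto
    next
      case False
      then have ts: "t + s > 0" using \<open>t \<ge> 0\<close> \<open>s \<ge> 0\<close> by simp
      have "(t/(t+s)) *\<^sub>R c + (s/(t+s)) *\<^sub>R d \<in> C"
        using C(1) ts0 ts by (intro convexD) (auto simp: add_divide_distrib[symmetric])
      then show ?thesis using ts by (intro that) (auto simp: scaleR_add_right)
    qed
    have "q (x + y) \<le> p ((x + y) + (t + s) *\<^sub>R b) - (t + s) * e"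
      using that b by (intro q_le) auto
    also have "(x + y) + (t + s) *\<^sub>R b = (x + t *\<^sub>R c) + (y + s *\<^sub>R d)" using b by simp
    also have "p \<dots> \<le> p (x + t *\<^sub>R c) + p (y + s *\<^sub>R d)" by (rule sublinear_add[OF p])
    finally show ?thesis by (simp add: algebra_simps)
  qed
  have q: "sublinear q"
  proof (rule sublinearI)
    show "q (x + y) \<le> q x + q y" for x y
    proof -
      have "q (x + y) - (p (y + s *\<^sub>R d) - s * e) \<le> q x" if "s \<ge> 0" "d \<in> C" for s d
        using add1[of _ _ s d x y] that by (intro q_ge) (simp add: algebra_simps)
      then have "q (x + y) - q x \<le> q y" by (intro q_ge) (simp add: algebra_simps)
      then show ?thesis by simp
    qed
    show "q 0 = 0"
    proof (rule antisym)
      show "q 0 \<le> 0" using qp[of 0] sublinear_zero[OF p] by simp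
      show "0 \<le> q 0" using eps by (intro q_ge) (simp add: sublinear_scale[OF p] mult_left_mono)
    qed
    show "q (c *\<^sub>R x) \<le> c * q x" if "c > 0" for c x
    proof -
      have "q (c *\<^sub>R x) / c \<le> q x"
      proof (rule q_ge)
        fix t d assume t: "t \<ge> (0::real)" "d \<in> C"
        have "q (c *\<^sub>R x) \<le> p (c *\<^sub>R x + (c * t) *\<^sub>R d) - (c * t) * e"
          using t that by (intro q_le) auto
        also have "c *\<^sub>R x + (c * t) *\<^sub>R d = c *\<^sub>R (x + t *\<^sub>R d)" by (simp add: algebra_simps)
        also have "p \<dots> = c * p (x + t *\<^sub>R d)" using that by (simp add: sublinear_scale[OF p])
        finally show "q (c *\<^sub>R x) / c \<le> p (x + t *\<^sub>R d) - t * e" using that by (simp add: field_simps)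
      qed
      then show ?thesis using that by (simp add: field_simps)
    qed
  qed
  have "q (- c) \<le> - e" if "c \<in> C" for c
    using q_le[of 1 c "- c"] that sublinear_zero[OF p] by simp
  with q qp show thesis by (rule that)
qed

text \<open>Zorn's lemma for the reversed order. The pointwise infimum of a chain is finite because
  all members stay above \<open>- p (- x)\<close>, and subadditive because of any two members one
  lies below the other.\<close>

lemma sublinear_minimal:
  assumes p: "sublinear p"
  obtains q where "sublinear q" "\<And>x. q x \<le> p x"
    "\<And>r. sublinear r \<Longrightarrow> (\<And>x. r x \<le> q x) \<Longrightarrow> r = q"
proof -
  define Q where "Q = {q. sublinear q \<and> (\<forall>x. q x \<le> p x)}"
  let ?P = "\<lambda>a b :: 'a \<Rightarrow> real. b \<le> a"
  have "\<exists>m\<in>Q. \<forall>a\<in>Q. ?P m a \<longrightarrow> a = m"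
  proof (rule predicate_Zorn)
    show "partial_order_on Q (relation_of ?P Q)"
      unfolding partial_order_on_def preorder_on_def refl_on_def trans_def antisym_def relation_of_def
      by auto
  next
    fix C assume C: "C \<in> Chains (relation_of ?P Q)"
    then have CQ: "C \<subseteq> Q" by (auto simp: Chains_def relation_of_def)
    have lin: "a \<le> b \<or> b \<le> a" if "a \<in> C" "b \<in> C" for a b
      using C that by (auto simp: Chains_def relation_of_def)
    show "\<exists>u\<in>Q. \<forall>a\<in>C. ?P a u"
    proof (cases "C = {}")
      case True
      then show ?thesis using p by (auto simp: Q_def)
    next
      case ne: False
      define u where "u x = (INF q\<in>C. q x)" for x
      have lower: "- p (- x) \<le> q x" if "q \<in> C" for q x
        using that CQ sublinear_minus[of q x] unfolding Q_def
        by (smt (verit, best) mem_Collect_eq subsetD)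
      have bdd: "bdd_below ((\<lambda>q. q x) ` C)" for x
        using lower unfolding bdd_below_def by blast
      have u_le: "u x \<le> q x" if "q \<in> C" for q x
        unfolding u_def using bdd that by (rule cINF_lower)
      have u_ge: "r \<le> u x" if "\<And>q. q \<in> C \<Longrightarrow> r \<le> q x" for r x
        unfolding u_def using that by (intro cINF_greatest ne) auto
      obtain q0 where q0: "q0 \<in> C" using ne by blast
      have sub: "sublinear q" if "q \<in> C" for q using that CQ by (auto simp: Q_def)
      have add1: "u (x + y) \<le> q x + r y" if qr: "q \<in> C" "r \<in> C" for q r x y
      proof -
        obtain s where s: "s \<in> C" "s x \<le> q x" "s y \<le> r y"
          using lin[OF qr] qr by (auto simp: le_fun_def)
        have "u (x + y) \<le> s (x + y)" using s by (intro u_le)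
        also have "\<dots> \<le> s x + s y" using sub s by (intro sublinear_add) auto
        finally show ?thesis using s by simp
      qed
      have "sublinear u"
      proof (rule sublinearI)
        show "u (x + y) \<le> u x + u y" for x y
        proof -
          have "u (x + y) - r y \<le> u x" if "r \<in> C" for r
            using add1[of _ r x y] that by (intro u_ge) (simp add: algebra_simps)
          then have "u (x + y) - u x \<le> u y" by (intro u_ge) (simp add: algebra_simps)
          then show ?thesis by simp
        qed
        have "q 0 = 0" if "q \<in> C" for q using sub[OF that] by (rule sublinear_zero)
        then show "u 0 = 0" using u_le[OF q0, of 0] u_ge[of 0 0] q0 by fastforce
        show "u (c *\<^sub>R x) \<le> c * u x" if "c > 0" for c x
        proof -
          have "u (c *\<^sub>R x) / c \<le> u x"
          proof (rule u_ge)
            fix q assume "q \<in> C"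
            then show "u (c *\<^sub>R x) / c \<le> q x"
              using u_le[of q "c *\<^sub>R x"] sublinear_scale[OF sub, of q c x] that by (simp add: field_simps)
          qed
          then show ?thesis using that by (simp add: field_simps)
        qed
      qed
      moreover have "u x \<le> p x" for x
        using u_le[OF q0, of x] CQ q0 by (auto simp: Q_def intro: order_trans)
      ultimately show ?thesis using u_le by (intro bexI[of _ u]) (auto simp: Q_def le_fun_def)
    qed
  qed
  then obtain m where m: "m \<in> Q" "\<And>a. a \<in> Q \<Longrightarrow> a \<le> m \<Longrightarrow> a = m" by blast
  show thesis
  proof (rule that)
    show "sublinear m" "\<And>x. m x \<le> p x" using m(1) by (auto simp: Q_def)
    show "r = m" if "sublinear r" "\<And>x. r x \<le> m x" for r
      using that m(1) by (intro m(2)) (auto simp: Q_def le_fun_def intro: order_trans)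
  qed
qed

text \<open>Applied to a singleton, \<open>sublinear_push_down\<close> shows that a minimal sublinear functional is odd,
  hence linear.\<close>

theorem Mazur_Orlicz:
  fixes p :: "'a::real_vector \<Rightarrow> real"
  assumes p: "sublinear p" and C: "convex C" "C \<noteq> {}" and eps: "\<And>c. c \<in> C \<Longrightarrow> e \<le> p c"
  obtains \<nu> where "linear \<nu>" "\<And>x. \<nu> x \<le> p x" "\<And>c. c \<in> C \<Longrightarrow> e \<le> \<nu> c"
proof -
  obtain q where q: "sublinear q" "\<And>x. q x \<le> p x" "\<And>c. c \<in> C \<Longrightarrow> q (- c) \<le> - e"
    using sublinear_push_down[OF p C eps] by metis
  obtain \<nu> where \<nu>: "sublinear \<nu>" "\<And>x. \<nu> x \<le> q x"
    and min: "\<And>r. sublinear r \<Longrightarrow> (\<And>x. r x \<le> \<nu> x) \<Longrightarrow> r = \<nu>"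
    using sublinear_minimal[OF q(1)] by metis
  have minus: "\<nu> (- v) = - \<nu> v" for v
  proof -
    obtain r where "sublinear r" "\<And>x. r x \<le> \<nu> x" "r (- v) \<le> - \<nu> v"
      using sublinear_push_down[OF \<nu>(1), of "{v}" "\<nu> v"] by auto
    then show ?thesis using min[of r] sublinear_minus[OF \<nu>(1), of v] by force
  qed
  have "linear \<nu>"
  proof (rule linearI)
    show "\<nu> (x + y) = \<nu> x + \<nu> y" for x y
      using sublinear_add[OF \<nu>(1), of x y] sublinear_add[OF \<nu>(1), of "x + y" "- y"] minus[of y] by simp
    show "\<nu> (c *\<^sub>R x) = c *\<^sub>R \<nu> x" for c x
    proof (cases "c \<ge> 0")
      case True
      then show ?thesis using sublinear_scale[OF \<nu>(1)] by simp
    next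
      case False
      then show ?thesis using sublinear_scale[OF \<nu>(1), of "- c" x] minus[of "c *\<^sub>R x"] by simp
    qed
  qed
  moreover have "e \<le> \<nu> c" if "c \<in> C" for c
    using order_trans[OF \<nu>(2) q(3)[OF that]] minus[of c] by simp
  ultimately show thesis using \<nu>(2) q(2) by (intro that) (auto intro: order_trans)
qed


section \<open>Bauer's maximum principle\<close>

text \<open>The functionals form no vector space type here, so convex combinations are spelled out.\<close>

definition face_of_funs :: "('a \<Rightarrow> complex) set \<Rightarrow> ('a \<Rightarrow> complex) set \<Rightarrow> bool" where
  "face_of_funs F X \<longleftrightarrow> F \<subseteq> X \<and>
     (\<forall>a\<in>X. \<forall>b\<in>X. \<forall>t. 0 < t \<and> t < 1 \<and> (\<lambda>f. of_real t * a f + of_real (1 - t) * b f) \<in> F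
        \<longrightarrow> a \<in> F \<and> b \<in> F)"

lemma face_of_funsI:
  assumes "F \<subseteq> X"
    and "\<And>a b t. a \<in> X \<Longrightarrow> b \<in> X \<Longrightarrow> 0 < t \<Longrightarrow> t < 1 \<Longrightarrow>
      (\<lambda>f. of_real t * a f + of_real (1 - t) * b f) \<in> F \<Longrightarrow> a \<in> F \<and> b \<in> F"
  shows "face_of_funs F X"
  using assms unfolding face_of_funs_def by blast

lemma face_of_funsD:
  assumes "face_of_funs F X" "a \<in> X" "b \<in> X" "0 < t" "t < 1"
    "(\<lambda>f. of_real t * a f + of_real (1 - t) * b f) \<in> F"
  shows "a \<in> F" "b \<in> F"
  using assms unfolding face_of_funs_def by blast+

lemma face_of_funs_subset: "face_of_funs F X \<Longrightarrow> F \<subseteq> X"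
  unfolding face_of_funs_def by blast

lemma face_of_funs_refl: "face_of_funs X X"
  unfolding face_of_funs_def by blast

lemma face_of_funs_trans:
  assumes FG: "face_of_funs F G" and GX: "face_of_funs G X"
  shows "face_of_funs F X"
proof (rule face_of_funsI)
  show "F \<subseteq> X" using assms unfolding face_of_funs_def by blast
next
  fix a b t
  assume ab: "a \<in> X" "b \<in> X" "0 < t" "t < 1"
    and F: "(\<lambda>f. of_real t * a f + of_real (1 - t) * b f) \<in> F"
  then have "(\<lambda>f. of_real t * a f + of_real (1 - t) * b f) \<in> G"
    using face_of_funs_subset[OF FG] by blast
  then have "a \<in> G" "b \<in> G" using face_of_funsD[OF GX ab] by blast+
  then show "a \<in> F \<and> b \<in> F" using face_of_funsD[OF FG _ _ ab(3,4) F] by blast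
qed

lemma face_of_funs_Inter:
  assumes "\<F> \<noteq> {}" "\<And>F. F \<in> \<F> \<Longrightarrow> face_of_funs F X"
  shows "face_of_funs (\<Inter>\<F>) X"
  using assms unfolding face_of_funs_def by (safe; blast)

lemma continuous_on_eval_fun: "continuous_on X (\<lambda>\<phi> :: 'a \<Rightarrow> 'b::topological_space. \<phi> f)"
  by (rule continuous_on_subset[OF continuous_on_product_coordinates]) simp

text \<open>A proper convex combination attains a maximum only if both end points do. The factor
  \<open>c\<close> lets real parts detect complex values: \<open>c = 1\<close> sees the real part
  and \<open>c = \<i>\<close> the imaginary part.\<close>

lemma face_of_funs_argmax:
  assumes X: "compact X" and F: "face_of_funs F X" "closed F" "F \<noteq> {}"
  obtains G where "face_of_funs G X" "closed G" "G \<noteq> {}" "G \<subseteq> F"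
    "\<And>\<phi> \<psi>. \<phi> \<in> G \<Longrightarrow> \<psi> \<in> F \<Longrightarrow> Re (c * \<psi> g) \<le> Re (c * \<phi> g)"
proof -
  have "compact F" using compact_Int_closed[OF X F(2)] face_of_funs_subset[OF F(1)]
    by (simp add: Int_absorb1)
  have cont: "continuous_on F (\<lambda>\<phi>. Re (c * \<phi> g))"
    by (intro continuous_intros continuous_on_eval_fun)
  obtain \<phi>0 where \<phi>0: "\<phi>0 \<in> F" "\<And>\<psi>. \<psi> \<in> F \<Longrightarrow> Re (c * \<psi> g) \<le> Re (c * \<phi>0 g)"
    using continuous_attains_sup[OF \<open>compact F\<close> F(3) cont] by blast
  define G where "G = {\<phi> \<in> F. Re (c * \<phi> g) = Re (c * \<phi>0 g)}"
  have "face_of_funs G F"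
  proof (rule face_of_funsI)
    fix a b t assume ab: "a \<in> F" "b \<in> F" "0 < t" "t < (1::real)"
      and "(\<lambda>f. of_real t * a f + of_real (1 - t) * b f) \<in> G"
    then have "Re (c * (of_real t * a g + of_real (1 - t) * b g)) = Re (c * \<phi>0 g)"
      by (simp add: G_def)
    also have "Re (c * (of_real t * a g + of_real (1 - t) * b g))
        = t * Re (c * a g) + (1 - t) * Re (c * b g)"
      by (simp add: algebra_simps)
    finally have eq: "t * (Re (c * \<phi>0 g) - Re (c * a g)) + (1 - t) * (Re (c * \<phi>0 g) - Re (c * b g)) = 0"
      by (simp add: algebra_simps)
    have "0 \<le> t * (Re (c * \<phi>0 g) - Re (c * a g))" "0 \<le> (1 - t) * (Re (c * \<phi>0 g) - Re (c * b g))"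
      using \<phi>0(2) ab by (auto intro!: mult_nonneg_nonneg)
    with eq have "t * (Re (c * \<phi>0 g) - Re (c * a g)) = 0" "(1 - t) * (Re (c * \<phi>0 g) - Re (c * b g)) = 0"
      by linarith+
    then have "Re (c * a g) = Re (c * \<phi>0 g)" "Re (c * b g) = Re (c * \<phi>0 g)"
      using ab by (auto simp del: times_complex.simps)
    then show "a \<in> G \<and> b \<in> G" using ab by (simp add: G_def)
  qed (auto simp: G_def)
  moreover have "closed G"
  proof -
    have "closedin (top_of_set F) {\<phi> \<in> F. (\<lambda>\<phi>. Re (c * \<phi> g)) \<phi> = Re (c * \<phi>0 g)}"
      using cont by (rule continuous_closedin_preimage_constant)
    then show ?thesis unfolding G_def using F(2) closedin_closed_trans by blast
  qed
  ultimately show thesis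
    using F(1) \<phi>0 by (intro that[of G]) (auto simp: G_def intro: face_of_funs_trans)
qed

text \<open>Zorn's lemma under reversed inclusion; compactness of \<open>X\<close> keeps the
  intersection of a chain of nonempty closed faces nonempty.\<close>

lemma minimal_face_of_funs:
  fixes F :: "('a \<Rightarrow> complex) set"
  assumes X: "compact X" and F: "face_of_funs F X" "closed F" "F \<noteq> {}"
  obtains G where "face_of_funs G X" "closed G" "G \<noteq> {}" "G \<subseteq> F"
    "\<And>H. face_of_funs H X \<Longrightarrow> closed H \<Longrightarrow> H \<noteq> {} \<Longrightarrow> H \<subseteq> G \<Longrightarrow> H = G"
proof -
  define Q where "Q = {G. face_of_funs G X \<and> closed G \<and> G \<noteq> {} \<and> G \<subseteq> F}"
  let ?P = "\<lambda>A B :: ('a \<Rightarrow> complex) set. B \<subseteq> A"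
  have "\<exists>m\<in>Q. \<forall>a\<in>Q. ?P m a \<longrightarrow> a = m"
  proof (rule predicate_Zorn)
    show "partial_order_on Q (relation_of ?P Q)"
      by (auto simp: partial_order_on_def preorder_on_def relation_of_def
          intro!: refl_onI transI antisymI)
  next
    fix C assume C: "C \<in> Chains (relation_of ?P Q)"
    then have CQ: "C \<subseteq> Q" by (auto simp: Chains_def relation_of_def)
    have lin: "A \<subseteq> B \<or> B \<subseteq> A" if "A \<in> C" "B \<in> C" for A B
      using C that by (auto simp: Chains_def relation_of_def)
    show "\<exists>u\<in>Q. \<forall>A\<in>C. ?P A u"
    proof (cases "C = {}")
      case True
      then show ?thesis using F unfolding Q_def by blast
    next
      case ne: False
      have QD: "face_of_funs A X" "closed A" "A \<noteq> {}" "A \<subseteq> F" if "A \<in> C" for A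
        using subsetD[OF CQ that] unfolding Q_def by blast+
      obtain A where A: "A \<in> C" using ne by blast
      have "X \<inter> \<Inter>C \<noteq> {}"
      proof (rule compact_imp_fip[OF X QD(2)])
        fix D assume D: "finite D" "D \<subseteq> C"
        have "\<exists>B\<in>C. B \<subseteq> \<Inter>D"
          using D
        proof (induction D)
          case empty
          then show ?case using A by auto
        next
          case (insert E D)
          then obtain B where B: "B \<in> C" "B \<subseteq> \<Inter>D" by auto
          have "B \<subseteq> E \<or> E \<subseteq> B" using B insert.prems by (intro lin) auto
          then show ?case
          proof
            assume "B \<subseteq> E"
            then show ?thesis using B by (intro bexI[of _ B]) auto
          next
            assume "E \<subseteq> B"
            then show ?thesis using B insert.prems by (intro bexI[of _ E]) auto
          qed
        qed
        then obtain B where B: "B \<in> C" "B \<subseteq> \<Inter>D" ..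
        show "X \<inter> \<Inter>D \<noteq> {}"
          using B(2) QD(3)[OF B(1)] face_of_funs_subset[OF QD(1)[OF B(1)]] by fast
      qed
      then have "\<Inter>C \<noteq> {}" by fast
      moreover have "\<Inter>C \<subseteq> F" using A QD(4) by fast
      moreover have "closed (\<Inter>C)" using QD(2) by (intro closed_Inter ballI)
      moreover have "face_of_funs (\<Inter>C) X"
        using QD(1) ne by (intro face_of_funs_Inter)
      ultimately have "\<Inter>C \<in> Q" unfolding Q_def by blast
      then show ?thesis by (rule rev_bexI) (simp add: Inter_lower)
    qed
  qed
  then obtain m where m: "m \<in> Q" "\<forall>a\<in>Q. a \<subseteq> m \<longrightarrow> a = m" ..
  show thesis
  proof (rule that[of m])
    show "face_of_funs m X" "closed m" "m \<noteq> {}" "m \<subseteq> F"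
      using m(1) unfolding Q_def by blast+
    show "H = m" if H: "face_of_funs H X" "closed H" "H \<noteq> {}" "H \<subseteq> m" for H
    proof -
      have "H \<subseteq> F" using H(4) \<open>m \<subseteq> F\<close> by (rule subset_trans)
      then have "H \<in> Q" using H by (simp add: Q_def)
      from m(2)[THEN bspec, OF this] H(4) show ?thesis by (rule mp)
    qed
  qed
qed

text \<open>The maximisers contain a minimal closed face \<open>H\<close>. Every coordinate is
  constant on \<open>H\<close>, since its maximisers would otherwise form a smaller face; so
  \<open>H\<close> is a single point.\<close>

theorem Bauer_maximum:
  assumes X: "compact X" and F: "face_of_funs F X" "closed F" "F \<noteq> {}"
  obtains \<phi> where "\<phi> \<in> F" "face_of_funs {\<phi>} X" "\<And>\<psi>. \<psi> \<in> F \<Longrightarrow> Re (c * \<psi> g) \<le> Re (c * \<phi> g)"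
proof -
  obtain G where G: "face_of_funs G X" "closed G" "G \<noteq> {}" "G \<subseteq> F"
    "\<And>\<phi> \<psi>. \<phi> \<in> G \<Longrightarrow> \<psi> \<in> F \<Longrightarrow> Re (c * \<psi> g) \<le> Re (c * \<phi> g)"
    using face_of_funs_argmax[OF X F] by metis
  obtain H where H: "face_of_funs H X" "closed H" "H \<noteq> {}" "H \<subseteq> G"
    and min: "\<And>H'. face_of_funs H' X \<Longrightarrow> closed H' \<Longrightarrow> H' \<noteq> {} \<Longrightarrow> H' \<subseteq> H \<Longrightarrow> H' = H"
    using minimal_face_of_funs[OF X G(1-3)] by metis
  obtain \<phi> where \<phi>: "\<phi> \<in> H" using H(3) by blast
  have "\<psi> = \<phi>" if \<psi>: "\<psi> \<in> H" for \<psi>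
  proof (rule ext)
    fix f
    have *: "Re (d * \<psi> f) = Re (d * \<phi> f)" for d
    proof -
      obtain H' where H': "face_of_funs H' X" "closed H'" "H' \<noteq> {}" "H' \<subseteq> H"
        "\<And>\<phi> \<psi>. \<phi> \<in> H' \<Longrightarrow> \<psi> \<in> H \<Longrightarrow> Re (d * \<psi> f) \<le> Re (d * \<phi> f)"
        using face_of_funs_argmax[OF X H(1-3)] by metis
      then have "H' = H" using min by blast
      then show ?thesis using H'(5) \<phi> \<psi> by (meson antisym)
    qed
    show "\<psi> f = \<phi> f" using *[of 1] *[of \<i>] by (simp add: complex_eq_iff)
  qed
  then have "H = {\<phi>}" using \<phi> by blast
  with H G \<phi> show thesis by (intro that[of \<phi>]) auto
qed


section \<open>The Riesz representation theorem\<close>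

lemma normal_space_compact_UNIV:
  assumes "compact (UNIV :: 'a::t2_space set)"
  shows "normal_space (euclidean :: 'a topology)"
  using assms by (intro compact_Hausdorff_or_regular_imp_normal_space)
    (simp_all add: compact_space_def Hausdorff_space_def, metis disjnt_def hausdorff)

lemma Urysohn_compact:
  fixes A B :: "'a::t2_space set"
  assumes "compact (UNIV :: 'a set)" "closed A" "closed B" "A \<inter> B = {}"
  obtains f :: "'a \<Rightarrow> real" where "continuous_on UNIV f" "\<And>x. 0 \<le> f x" "\<And>x. f x \<le> 1"
    "\<And>x. x \<in> A \<Longrightarrow> f x = 0" "\<And>x. x \<in> B \<Longrightarrow> f x = 1"
proof -
  obtain f where f: "continuous_map euclidean (top_of_set {0..1::real}) f" "f ` A \<subseteq> {0}" "f ` B \<subseteq> {1}"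
    using Urysohn_lemma[OF normal_space_compact_UNIV[OF assms(1)], of A B 0 1] assms
    by (auto simp: disjnt_def)
  then have "continuous_on UNIV f" "\<And>x. f x \<in> {0..1}"
    by (auto simp: continuous_map_in_subtopology)
  with f(2,3) show thesis by (intro that[of f]) auto
qed

lemma Tietze_compact:
  fixes f :: "'a::t2_space \<Rightarrow> real"
  assumes "compact (UNIV :: 'a set)" "closed A" "continuous_on A f"
  obtains g where "continuous_on UNIV g" "\<And>x. x \<in> A \<Longrightarrow> g x = f x"
proof -
  obtain g where "continuous_map euclidean euclideanreal g" "\<And>x. x \<in> A \<Longrightarrow> g x = f x"
    using Tietze_extension_realinterval[OF normal_space_compact_UNIV[OF assms(1)], of A UNIV f] assms(2,3)
    by (auto simp: is_interval_univ)
  then show thesis by (intro that[of g]) auto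
qed

text \<open>Arguments are plain real functions and the axioms speak of continuous ones, so that
  truncations and products can be written down directly.\<close>

locale state_functional =
  fixes L :: "('a::t2_space \<Rightarrow> real) \<Rightarrow> real"
  assumes compact_space: "compact (UNIV :: 'a set)"
    and L_add: "\<And>f g. continuous_on UNIV f \<Longrightarrow> continuous_on UNIV g \<Longrightarrow> L (\<lambda>x. f x + g x) = L f + L g"
    and L_scale: "\<And>f c. continuous_on UNIV f \<Longrightarrow> L (\<lambda>x. c * f x) = c * L f"
    and L_nonneg: "\<And>f. continuous_on UNIV f \<Longrightarrow> (\<And>x. 0 \<le> f x) \<Longrightarrow> 0 \<le> L f"
    and L_one: "L (\<lambda>_. 1) = 1"
begin

lemma L_const: "L (\<lambda>_. c) = c"
  using L_scale[of "\<lambda>_. 1" c] L_one by simp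

lemma L_mono:
  assumes "continuous_on UNIV f" "continuous_on UNIV g" "\<And>x. f x \<le> g x"
  shows "L f \<le> L g"
proof -
  have "L (\<lambda>x. f x + (g x - f x)) = L f + L (\<lambda>x. g x - f x)"
    using assms by (intro L_add continuous_intros)
  moreover have "0 \<le> L (\<lambda>x. g x - f x)" using assms by (intro L_nonneg continuous_intros) auto
  ultimately show ?thesis by simp
qed

lemma L_sum:
  assumes "\<And>k. k < n \<Longrightarrow> continuous_on UNIV (f k)"
  shows "L (\<lambda>x. \<Sum>k<(n::nat). f k x) = (\<Sum>k<n. L (f k))"
  using assms
proof (induction n)
  case 0
  then show ?case using L_const[of 0] by simp
next
  case (Suc n)
  then have "L (\<lambda>x. (\<Sum>k<n. f k x) + f n x) = L (\<lambda>x. \<Sum>k<n. f k x) + L (f n)"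
    by (intro L_add continuous_on_sum) auto
  with Suc show ?case by simp
qed

text \<open>Competitors only have to vanish off \<open>U\<close>; a support compactly inside
  \<open>U\<close> is recovered by cutting at a small height, at a small cost in
  \<open>L\<close>.\<close>

definition below :: "'a set \<Rightarrow> ('a \<Rightarrow> real) set" where
  "below U = {f. continuous_on UNIV f \<and> (\<forall>x. 0 \<le> f x \<and> f x \<le> 1) \<and> (\<forall>x. x \<notin> U \<longrightarrow> f x = 0)}"

definition content_of :: "'a set \<Rightarrow> real" where "content_of U = (SUP f\<in>below U. L f)"

definition outer :: "'a set \<Rightarrow> real" where "outer A = (INF U\<in>{U. open U \<and> A \<subseteq> U}. content_of U)"

lemma belowI:
  "continuous_on UNIV f \<Longrightarrow> (\<And>x. 0 \<le> f x) \<Longrightarrow> (\<And>x. f x \<le> 1) \<Longrightarrow> (\<And>x. x \<notin> U \<Longrightarrow> f x = 0) \<Longrightarrow> f \<in> below U"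
  by (simp add: below_def)

lemma belowD:
  assumes "f \<in> below U"
  shows "continuous_on UNIV f" "0 \<le> f x" "f x \<le> 1" "x \<notin> U \<Longrightarrow> f x = 0"
  using assms by (simp_all add: below_def)

lemma zero_below: "(\<lambda>_. 0) \<in> below U" by (simp add: below_def)

lemma L_below: "f \<in> below U \<Longrightarrow> L f \<le> 1"
  using L_mono[of f "\<lambda>_. 1"] L_one by (simp add: below_def)

lemma bdd_above_below: "bdd_above (L ` below U)" using L_below by (auto simp: bdd_above_def)

lemma content_ge: "f \<in> below U \<Longrightarrow> L f \<le> content_of U"
  unfolding content_of_def by (intro cSUP_upper bdd_above_below)

lemma content_le: "(\<And>f. f \<in> below U \<Longrightarrow> L f \<le> r) \<Longrightarrow> content_of U \<le> r"
  unfolding content_of_def using zero_below by (intro cSUP_least) auto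

lemma content_nonneg: "0 \<le> content_of U"
  using content_ge[OF zero_below] L_const[of 0] by simp

lemma content_le_1: "content_of U \<le> 1" by (rule content_le) (rule L_below)

lemma content_mono: "U \<subseteq> V \<Longrightarrow> content_of U \<le> content_of V"
  by (intro content_le content_ge) (auto simp: below_def)

lemma outer_le: "open U \<Longrightarrow> A \<subseteq> U \<Longrightarrow> outer A \<le> content_of U"
  unfolding outer_def by (rule cINF_lower) (auto intro: content_nonneg)

lemma outer_ge: "(\<And>U. open U \<Longrightarrow> A \<subseteq> U \<Longrightarrow> r \<le> content_of U) \<Longrightarrow> r \<le> outer A"
  unfolding outer_def by (rule cINF_greatest) auto

lemma outer_nonneg: "0 \<le> outer A" by (rule outer_ge) (rule content_nonneg)

lemma outer_mono: "A \<subseteq> B \<Longrightarrow> outer A \<le> outer B" by (intro outer_ge outer_le) auto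

lemma outer_open: "open U \<Longrightarrow> outer U = content_of U"
  by (intro antisym outer_le outer_ge content_mono) auto

lemma outer_approx:
  assumes "e > 0"
  obtains U where "open U" "A \<subseteq> U" "content_of U < outer A + e"
proof -
  have "\<exists>U. open U \<and> A \<subseteq> U \<and> content_of U < outer A + e"
  proof (rule ccontr)
    assume "\<not> ?thesis"
    then have "outer A + e \<le> outer A" by (intro outer_ge) (auto simp: not_less)
    with assms show False by simp
  qed
  then show thesis using that by blast
qed

lemma outer_empty: "outer {} = 0"
proof -
  have "content_of {} \<le> 0"
  proof (rule content_le)
    fix f :: "'a \<Rightarrow> real" assume "f \<in> below {}"
    then have "f = (\<lambda>_. 0)" by (auto simp: below_def)
    then show "L f \<le> 0" by (simp add: L_const)
  qed
  then show ?thesis using outer_le[of "{}" "{}"] outer_nonneg[of "{}"] by simp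
qed

lemma outer_UNIV: "outer UNIV = 1"
proof -
  have "L (\<lambda>_. 1) \<le> content_of UNIV" by (intro content_ge belowI) auto
  then show ?thesis using L_one content_le_1[of UNIV] by (simp add: outer_open)
qed

text \<open>Cutting \<open>f\<close> at height \<open>e\<close> makes its support a compact subset of the open set.\<close>

definition cut :: "real \<Rightarrow> ('a \<Rightarrow> real) \<Rightarrow> 'a \<Rightarrow> real" where "cut e f x = max (f x - e) 0"

lemma cut_cont: "continuous_on UNIV f \<Longrightarrow> continuous_on UNIV (cut e f)"
  unfolding cut_def by (intro continuous_intros)

lemma L_cut: assumes "continuous_on UNIV f" shows "L f \<le> e + L (cut e f)"
proof -
  have "L f \<le> L (\<lambda>x. e + cut e f x)"
    using assms by (intro L_mono continuous_intros cut_cont) (auto simp: cut_def)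
  also have "\<dots> = e + L (cut e f)" using assms by (simp add: L_add L_const cut_cont)
  finally show ?thesis .
qed

lemma closed_level: "continuous_on UNIV f \<Longrightarrow> closed {x. (e::real) \<le> f x}"
  by (intro closed_Collect_le continuous_intros)

text \<open>A partition of unity: the parts of the level set \<open>e \<le> f\<close> outside
  \<open>U\<close> and outside \<open>V\<close> are disjoint and closed, and a Urysohn function
  between them splits \<open>cut e f\<close> into a competitor for \<open>U\<close> and one for
  \<open>V\<close>.\<close>

lemma content_Un:
  assumes "open U" "open V"
  shows "content_of (U \<union> V) \<le> content_of U + content_of V"
proof (rule content_le)
  fix f assume f: "f \<in> below (U \<union> V)"
  note f' = belowD[OF f]
  show "L f \<le> content_of U + content_of V"
  proof (rule field_le_epsilon)
    fix e :: real assume e: "0 < e"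
    let ?C = "{x. e \<le> f x}"
    have C: "closed ?C" by (rule closed_level) (rule f'(1))
    have "closed (?C - U)" "closed (?C - V)" using C assms by (auto intro: closed_Diff)
    moreover have "(?C - U) \<inter> (?C - V) = {}" using f'(4) e by fastforce
    ultimately obtain u where u: "continuous_on UNIV u" "\<And>x. (0::real) \<le> u x" "\<And>x. u x \<le> 1"
      "\<And>x. x \<in> ?C - U \<Longrightarrow> u x = 0" "\<And>x. x \<in> ?C - V \<Longrightarrow> u x = 1"
      using Urysohn_compact[OF compact_space, of "?C - U" "?C - V"] by metis
    have c: "0 \<le> cut e f x" "cut e f x \<le> 1" for x using f'(3)[of x] e by (auto simp: cut_def)
    have "(\<lambda>x. cut e f x * u x) \<in> below U"
    proof (intro belowI continuous_intros cut_cont f' u)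
      show "cut e f x * u x = 0" if "x \<notin> U" for x
        using that u(4)[of x] by (cases "e \<le> f x") (auto simp: cut_def)
      show "0 \<le> cut e f x * u x" "cut e f x * u x \<le> 1" for x
        using c[of x] u(2,3)[of x] by (auto intro: mult_le_one)
    qed
    then have 1: "L (\<lambda>x. cut e f x * u x) \<le> content_of U" by (rule content_ge)
    have "(\<lambda>x. cut e f x * (1 - u x)) \<in> below V"
    proof (intro belowI continuous_intros cut_cont f' u)
      show "cut e f x * (1 - u x) = 0" if "x \<notin> V" for x
        using that u(5)[of x] by (cases "e \<le> f x") (auto simp: cut_def)
      show "0 \<le> cut e f x * (1 - u x)" "cut e f x * (1 - u x) \<le> 1" for x
        using c[of x] u(2,3)[of x] by (auto intro: mult_le_one)
    qed
    then have 2: "L (\<lambda>x. cut e f x * (1 - u x)) \<le> content_of V" by (rule content_ge)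
    have "L (cut e f) = L (\<lambda>x. cut e f x * u x + cut e f x * (1 - u x))" by (simp add: algebra_simps)
    also have "\<dots> = L (\<lambda>x. cut e f x * u x) + L (\<lambda>x. cut e f x * (1 - u x))"
      by (intro L_add continuous_intros cut_cont f' u)
    finally show "L f \<le> content_of U + content_of V + e"
      using L_cut[OF f'(1), of e] 1 2 by simp
  qed
qed

lemma content_UN_finite:
  assumes "\<And>i. open (U i)"
  shows "content_of (\<Union>i<(n::nat). U i) \<le> (\<Sum>i<n. content_of (U i))"
proof (induction n)
  case 0
  then show ?case using outer_empty outer_open[of "{}"] by simp
next
  case (Suc n)
  have "content_of (\<Union>i<Suc n. U i) = content_of ((\<Union>i<n. U i) \<union> U n)"
    by (simp add: lessThan_Suc Un_commute)
  also have "\<dots> \<le> content_of (\<Union>i<n. U i) + content_of (U n)"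
    using assms by (intro content_Un) auto
  finally show ?case using Suc by simp
qed

text \<open>The level set \<open>e \<le> f\<close> is compact, so finitely many of the open sets
  already carry \<open>cut e f\<close>.\<close>

lemma content_UN:
  assumes U: "\<And>i::nat. open (U i)" and b: "\<And>n. (\<Sum>i<n. content_of (U i)) \<le> b"
  shows "content_of (\<Union>i. U i) \<le> b"
proof (rule content_le)
  fix f assume f: "f \<in> below (\<Union>i. U i)"
  note f' = belowD[OF f]
  show "L f \<le> b"
  proof (rule field_le_epsilon)
    fix e :: real assume e: "0 < e"
    let ?C = "{x. e \<le> f x}"
    have C: "compact ?C"
      using compact_Int_closed[OF compact_space closed_level[OF f'(1), of e]] by simp
    have "?C \<subseteq> (\<Union>i. U i)" using f'(4) e by fastforce
    then obtain I where I: "finite I" "?C \<subseteq> (\<Union>i\<in>I. U i)"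
      by (rule compactE_image[OF C U])
    obtain n where n: "I \<subseteq> {..<n}" using I(1) finite_nat_iff_bounded by auto
    have "cut e f \<in> below (\<Union>i<n. U i)"
    proof (intro belowI cut_cont f')
      show "cut e f x = 0" if "x \<notin> (\<Union>i<n. U i)" for x
        using that subset_trans[OF I(2) UN_mono[OF n subset_refl]] by (cases "e \<le> f x") (auto simp: cut_def)
      show "0 \<le> cut e f x" "cut e f x \<le> 1" for x using f'(3)[of x] e by (auto simp: cut_def)
    qed
    then have "L (cut e f) \<le> content_of (\<Union>i<n. U i)" by (rule content_ge)
    also have "\<dots> \<le> (\<Sum>i<n. content_of (U i))" by (rule content_UN_finite) (rule U)
    also have "\<dots> \<le> b" by (rule b)
    finally show "L f \<le> b + e" using L_cut[OF f'(1), of e] by simp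
  qed
qed

lemma outer_UN: "ennreal (outer (\<Union>i::nat. A i)) \<le> (\<Sum>i. ennreal (outer (A i)))"
proof (cases "(\<Sum>i. ennreal (outer (A i))) = \<top>")
  case False
  have "\<exists>U. open U \<and> A i \<subseteq> U \<and> content_of U < outer (A i) + e / 2 ^ Suc i" if "e > 0" for i e
    using outer_approx[of "e / 2 ^ Suc i" "A i"] that by (metis divide_pos_pos zero_less_numeral zero_less_power)
  note approx = this
  obtain s where s: "(\<Sum>i. ennreal (outer (A i))) = ennreal s" "0 \<le> s"
    using False by (cases "(\<Sum>i. ennreal (outer (A i)))") auto
  have part: "(\<Sum>i<n. outer (A i)) \<le> s" for n
  proof -
    have "ennreal (\<Sum>i<n. outer (A i)) = (\<Sum>i<n. ennreal (outer (A i)))"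
      by (simp add: outer_nonneg)
    also have "\<dots> \<le> (\<Sum>i. ennreal (outer (A i)))" by (intro sum_le_suminf) auto
    finally show ?thesis using s by simp
  qed
  have "outer (\<Union>i. A i) \<le> s"
  proof (rule field_le_epsilon)
    fix e :: real assume e: "0 < e"
    have "\<forall>i. \<exists>U. open U \<and> A i \<subseteq> U \<and> content_of U < outer (A i) + e / 2 ^ Suc i"
      using approx[OF e] by blast
    then obtain U where U: "\<And>i. open (U i)" "\<And>i. A i \<subseteq> U i"
      "\<And>i. content_of (U i) < outer (A i) + e / 2 ^ Suc i" by metis
    have "outer (\<Union>i. A i) \<le> content_of (\<Union>i. U i)" using U by (intro outer_le) blast+
    also have "\<dots> \<le> s + e"
    proof (rule content_UN)
      fix n :: nat
      have geo: "(\<Sum>i<n. e / 2 ^ Suc i) = e * (1 - 1 / 2 ^ n)"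
        by (induction n) (simp_all add: field_simps)
      have "(\<Sum>i<n. content_of (U i)) \<le> (\<Sum>i<n. outer (A i) + e / 2 ^ Suc i)"
        using U(3) by (intro sum_mono) (simp add: less_imp_le)
      also have "\<dots> = (\<Sum>i<n. outer (A i)) + e * (1 - 1 / 2 ^ n)"
        using geo by (simp add: sum.distrib)
      also have "\<dots> \<le> s + e" using part[of n] e by (intro add_mono) (auto simp: field_simps)
      finally show "(\<Sum>i<n. content_of (U i)) \<le> s + e" .
    qed (rule U)
    finally show "outer (\<Union>i. A i) \<le> s + e" .
  qed
  then show ?thesis using s by simp
qed simp

lemma outer_measure_space_outer: "outer_measure_space UNIV (\<lambda>A. ennreal (outer A))"
  unfolding outer_measure_space_def positive_def increasing_def countably_subadditive_def
  by (intro conjI ballI allI impI outer_UN) (simp_all add: outer_empty outer_nonneg outer_mono)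

lemma outer_Un: "outer (A \<union> B) \<le> outer A + outer B"
proof (rule field_le_epsilon)
  fix e :: real assume "0 < e"
  then have e2: "e/2 > 0" by simp
  obtain U where U: "open U" "A \<subseteq> U" "content_of U < outer A + e/2" using outer_approx[OF e2] by blast
  obtain V where V: "open V" "B \<subseteq> V" "content_of V < outer B + e/2" using outer_approx[OF e2] by blast
  have "outer (A \<union> B) \<le> content_of (U \<union> V)" using U V by (intro outer_le) auto
  also have "\<dots> \<le> content_of U + content_of V" using U V by (intro content_Un)
  finally show "outer (A \<union> B) \<le> outer A + outer B + e" using U V by simp
qed

text \<open>Caratheodory's criterion. For a competitor \<open>f\<close> of
  \<open>V \<inter> U\<close> and a competitor \<open>g\<close> of \<open>V\<close> minus the level
  set \<open>e \<le> f\<close>, the sum \<open>cut e f + g\<close> is a competitor of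
  \<open>V\<close>, because \<open>cut e f\<close> vanishes where \<open>f < e\<close> and
  \<open>g\<close> vanishes elsewhere. The removed level set lies in \<open>U\<close>, so
  \<open>A - U\<close> is still covered.\<close>

lemma outer_split_open:
  assumes U: "open U"
  shows "outer (A \<inter> U) + outer (A - U) = outer A"
proof (rule antisym)
  have "outer ((A \<inter> U) \<union> (A - U)) \<le> outer (A \<inter> U) + outer (A - U)" by (rule outer_Un)
  then show "outer A \<le> outer (A \<inter> U) + outer (A - U)" by (simp add: Int_Diff_Un)
next
  show "outer (A \<inter> U) + outer (A - U) \<le> outer A"
  proof (rule outer_ge)
    fix V assume V: "open V" "A \<subseteq> V"
    have UV: "outer (A \<inter> U) \<le> content_of (V \<inter> U)" using U V by (intro outer_le) auto
    have "content_of (V \<inter> U) \<le> content_of V - outer (A - U)"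
    proof (rule content_le)
      fix f assume f: "f \<in> below (V \<inter> U)"
      note f' = belowD[OF f]
      show "L f \<le> content_of V - outer (A - U)"
      proof (rule field_le_epsilon)
        fix e :: real assume e: "0 < e"
        let ?C = "{x. e \<le> f x}"
        have C: "closed ?C" by (rule closed_level) (rule f'(1))
        have W: "open (V - ?C)" using V C by (auto intro: open_Diff)
        have "?C \<subseteq> U" using f'(4) e by fastforce
        then have "outer (A - U) \<le> content_of (V - ?C)" using V W by (intro outer_le) auto
        also have "\<dots> \<le> content_of V - L (cut e f)"
        proof (rule content_le)
          fix g assume g: "g \<in> below (V - ?C)"
          note g' = belowD[OF g]
          have "(\<lambda>x. cut e f x + g x) \<in> below V"
          proof (intro belowI continuous_intros cut_cont f' g')
            show "cut e f x + g x = 0" if "x \<notin> V" for x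
              using that f'(4)[of x] g'(4)[of x] e by (auto simp: cut_def)
            show "0 \<le> cut e f x + g x" "cut e f x + g x \<le> 1" for x
              using f'(3)[of x] g'(2,3,4)[of x] e by (cases "e \<le> f x"; auto simp: cut_def)+
          qed
          then have "L (\<lambda>x. cut e f x + g x) \<le> content_of V" by (rule content_ge)
          then show "L g \<le> content_of V - L (cut e f)"
            by (simp add: L_add cut_cont f' g')
        qed
        finally show "L f \<le> content_of V - outer (A - U) + e" using L_cut[OF f'(1), of e] by simp
      qed
    qed
    with UV show "outer (A \<inter> U) + outer (A - U) \<le> content_of V" by simp
  qed
qed

section \<open>The Caratheodory measure and its integral\<close>

definition riesz_measure :: "'a measure" where
  "riesz_measure = measure_of UNIV (sets borel) (\<lambda>A. ennreal (outer A))"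

lemma sets_riesz_measure: "sets riesz_measure = sets borel"
  unfolding riesz_measure_def using sets.sets_measure_of_eq[of borel] by simp

text \<open>The Caratheodory measurable sets form a sigma-algebra that contains the open sets by
  \<open>outer_split_open\<close>, hence all Borel sets, and the outer measure is countably additive
  on it.\<close>

lemma emeasure_riesz_measure:
  assumes "B \<in> sets borel"
  shows "emeasure riesz_measure B = ennreal (outer B)"
proof -
  let ?\<mu> = "\<lambda>A. ennreal (outer A)"
  interpret P: sigma_algebra UNIV "UNIV :: 'a set set"
    using sigma_algebra_Pow[of UNIV] by simp
  let ?Lam = "lambda_system UNIV UNIV ?\<mu>"
  have ms: "measure_space UNIV ?Lam ?\<mu>"
    by (rule P.caratheodory_lemma) (rule outer_measure_space_outer)
  then interpret Q: sigma_algebra UNIV ?Lam by (simp add: measure_space_def)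
  have "U \<in> ?Lam" if "open U" for U
    using outer_split_open[OF that] unfolding P.lambda_system_eq
    by (auto simp: outer_nonneg simp flip: ennreal_plus)
  then have sub: "sets borel \<subseteq> ?Lam"
    unfolding borel_def by (subst sets_measure_of) (auto intro!: Q.sigma_sets_subset)
  then have "countably_additive (sets borel) ?\<mu>" "positive (sets borel) ?\<mu>"
    using ms unfolding measure_space_def countably_additive_def positive_def by blast+
  then show ?thesis
    unfolding riesz_measure_def
    by (intro emeasure_measure_of_sigma assms) (use sets.sigma_algebra_axioms[of borel] in simp)
qed

lemma prob_space_riesz: "prob_space riesz_measure"
proof
  have "space riesz_measure = UNIV" using sets_eq_imp_space_eq[OF sets_riesz_measure] by simp
  then show "emeasure riesz_measure (space riesz_measure) = 1"
    by (simp add: emeasure_riesz_measure outer_UNIV)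
qed

lemma measure_riesz: "B \<in> sets borel \<Longrightarrow> measure riesz_measure B = outer B"
  by (simp add: measure_def emeasure_riesz_measure outer_nonneg)

lemma riesz_outer_regular:
  assumes "B \<in> sets borel" "e > 0"
  obtains U where "open U" "B \<subseteq> U" "measure riesz_measure U < measure riesz_measure B + e"
proof -
  obtain U where "open U" "B \<subseteq> U" "content_of U < outer B + e" using outer_approx[OF assms(2)] by blast
  then show thesis using assms by (intro that[of U]) (simp_all add: measure_riesz outer_open)
qed

text \<open>\<open>f\<close> is sliced into \<open>n\<close> layers of height \<open>1/n\<close>.
  For layer \<open>k\<close> both \<open>L\<close> and the integral lie between the measures of the
  sets where \<open>n f\<close> exceeds \<open>k + 1\<close> and \<open>k\<close>; these gaps
  telescope to at most \<open>1\<close>, leaving the error \<open>1/n\<close>.\<close>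

lemma integral_riesz_unit:
  assumes f: "continuous_on UNIV f" "\<And>x. 0 \<le> f x" "\<And>x. f x \<le> 1"
  shows "L f = (\<integral>x. f x \<partial>riesz_measure)"
proof -
  interpret prob_space riesz_measure by (rule prob_space_riesz)
  let ?M = riesz_measure
  have meas: "g \<in> borel_measurable ?M" if "continuous_on UNIV g" for g :: "'a \<Rightarrow> real"
    using borel_measurable_continuous_onI[OF that] by (simp add: measurable_cong_sets[OF sets_riesz_measure refl])
  have sp: "space ?M = UNIV" using sets_eq_imp_space_eq[OF sets_riesz_measure] by simp
  have *: "\<bar>L f - (\<integral>x. f x \<partial>?M)\<bar> \<le> 1 / real n" if n: "n > 0" for n :: nat
  proof -
    define g where "g k x = min (max (real n * f x - real k) 0) 1" for k x
    define m where "m k = outer {x. real k < real n * f x}" for k :: nat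
    have op: "open {x. real k < real n * f x}" for k
      using f by (intro open_Collect_less continuous_intros)
    have gc: "continuous_on UNIV (g k)" for k unfolding g_def using f by (intro continuous_intros)
    have g01: "0 \<le> g k x" "g k x \<le> 1" for k x by (auto simp: g_def)
    have gint: "integrable ?M (g k)" for k
      using g01 by (intro integrable_const_bound[where B=1] meas gc) auto
    have gsum: "(\<Sum>k<N. g k x) = min (real n * f x) (real N)" for N x
    proof -
      have "(\<Sum>k<N. min (max (y - real k) 0) 1) = min y (real N)" if "0 \<le> y" for y :: real
        using that by (induction N) (auto simp: min_def max_def)
      then show ?thesis using f(2)[of x] by (simp add: g_def)
    qed
    have sum: "f x = (1/n) * (\<Sum>k<n. g k x)" for x
    proof -
      have "real n * f x \<le> real n" using f(3)[of x] by (simp add: mult_left_le)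
      then show ?thesis using n by (simp add: gsum min_def)
    qed
    have Lup: "L (g k) \<le> m k" for k
    proof -
      have "L (g k) \<le> content_of {x. real k < real n * f x}"
        using g01 by (intro content_ge belowI gc) (auto simp: g_def)
      then show ?thesis by (simp add: m_def outer_open[OF op])
    qed
    have Llow: "m (Suc k) \<le> L (g k)" for k
    proof -
      have "content_of {x. real (Suc k) < real n * f x} \<le> L (g k)"
      proof (rule content_le)
        fix h assume h: "h \<in> below {x. real (Suc k) < real n * f x}"
        have "h x \<le> g k x" for x
        proof (cases "real (Suc k) < real n * f x")
          case True
          then have "g k x = 1" by (auto simp: g_def)
          then show ?thesis using belowD(3)[OF h] by simp
        next
          case False
          then show ?thesis using belowD(4)[OF h, of x] g01 by simp
        qed
        then show "L h \<le> L (g k)" by (intro L_mono gc belowD[OF h])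
      qed
      then show ?thesis unfolding m_def outer_open[OF op] .
    qed
    have mm: "m k = (\<integral>x. indicator {x. real k < real n * f x} x \<partial>?M)" for k
      using op[of k] by (simp add: m_def measure_riesz sp)
    have ind: "integrable ?M (indicator {x. real k < real n * f x} :: _ \<Rightarrow> real)" for k
      using op[of k] by (intro integrable_real_indicator) (auto simp: sets_riesz_measure emeasure_eq_measure)
    have Iup: "(\<integral>x. g k x \<partial>?M) \<le> m k" for k
      unfolding mm by (rule integral_mono[OF gint ind]) (auto simp: g_def indicator_def)
    have Ilow: "m (Suc k) \<le> (\<integral>x. g k x \<partial>?M)" for k
      unfolding mm by (rule integral_mono[OF ind gint]) (auto simp: g_def indicator_def)
    have L: "L f = (1/n) * (\<Sum>k<n. L (g k))"
    proof -
      have "L f = L (\<lambda>x. (1/n) * (\<Sum>k<n. g k x))" using sum by (metis (no_types) ext)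
      also have "\<dots> = (1/n) * L (\<lambda>x. \<Sum>k<n. g k x)" by (intro L_scale continuous_intros gc)
      finally show ?thesis by (simp add: L_sum gc)
    qed
    have I: "(\<integral>x. f x \<partial>?M) = (1/n) * (\<Sum>k<n. (\<integral>x. g k x \<partial>?M))"
    proof -
      have "(\<integral>x. f x \<partial>?M) = (\<integral>x. (1/n) * (\<Sum>k<n. g k x) \<partial>?M)" using sum by simp
      then show ?thesis using gint by simp
    qed
    have m1: "0 \<le> m k" "m k \<le> 1" for k
      using outer_nonneg content_le_1 by (simp_all add: m_def outer_open[OF op] content_nonneg)
    have "\<bar>(\<Sum>k<n. L (g k)) - (\<Sum>k<n. (\<integral>x. g k x \<partial>?M))\<bar> \<le> (\<Sum>k<n. m k - m (Suc k))"
      unfolding sum_subtractf[symmetric]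
      by (rule order_trans[OF sum_abs sum_mono]) (smt (verit) Lup Llow Iup Ilow)
    also have "\<dots> = m 0 - m n" by (rule sum_lessThan_telescope')
    also have "\<dots> \<le> 1" using m1[of 0] m1[of n] by simp
    finally have "\<bar>(\<Sum>k<n. L (g k)) - (\<Sum>k<n. (\<integral>x. g k x \<partial>?M))\<bar> \<le> 1" .
    moreover have "\<bar>L f - (\<integral>x. f x \<partial>?M)\<bar> = (1/n) * \<bar>(\<Sum>k<n. L (g k)) - (\<Sum>k<n. (\<integral>x. g k x \<partial>?M))\<bar>"
      unfolding L I by (simp flip: diff_divide_distrib)
    ultimately show ?thesis using n by (simp add: divide_right_mono)
  qed
  have "\<bar>L f - (\<integral>x. f x \<partial>?M)\<bar> \<le> 0"
  proof (rule field_le_epsilon)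
    fix e :: real assume "0 < e"
    then obtain n :: nat where "n > 0" "1 / real n < e" using nat_approx_posE
      by (metis zero_less_Suc)
    then show "\<bar>L f - (\<integral>x. f x \<partial>?M)\<bar> \<le> 0 + e" using *[of n] by simp
  qed
  then show ?thesis by simp
qed

lemma integral_riesz:
  assumes f: "continuous_on UNIV f"
  shows "L f = (\<integral>x. f x \<partial>riesz_measure)"
proof -
  interpret prob_space riesz_measure by (rule prob_space_riesz)
  let ?M = riesz_measure
  have "compact (range f)" using f compact_space by (rule compact_continuous_image)
  then obtain b where b: "b > 0" "\<And>x. \<bar>f x\<bar> \<le> b"
    using compact_imp_bounded bounded_pos by (metis rangeI real_norm_def)
  define g where "g x = (f x + b) / (2 * b)" for x
  have gc: "continuous_on UNIV g" unfolding g_def using f b by (intro continuous_intros) auto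
  have g: "0 \<le> g x" "g x \<le> 1" for x using b(2)[of x] b(1) by (auto simp: g_def field_simps)
  have fg: "f x = 2 * b * g x + (- b)" for x using b(1) by (simp add: g_def)
  have int: "integrable ?M g"
    using g borel_measurable_continuous_onI[OF gc]
    by (intro integrable_const_bound[where B=1]) (auto simp: measurable_cong_sets[OF sets_riesz_measure refl])
  have "L f = 2 * b * L g + (- b)"
    unfolding fg using L_add[of "\<lambda>x. 2 * b * g x" "\<lambda>_. - b"] L_scale[of g "2 * b"] L_const[of "- b"] gc
    by (simp add: continuous_on_mult_left)
  also have "L g = (\<integral>x. g x \<partial>?M)" by (rule integral_riesz_unit[OF gc g])
  also have "2 * b * (\<integral>x. g x \<partial>?M) + (- b) = (\<integral>x. 2 * b * g x + (- b) \<partial>?M)"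
    using int by (simp add: prob_space)
  also have "\<dots> = (\<integral>x. f x \<partial>?M)" unfolding fg ..
  finally show ?thesis .
qed

end


section \<open>States and Markov operators\<close>

lemma complex_nonneg_iff: "z \<in> \<real>\<^sub>\<ge>\<^sub>0 \<longleftrightarrow> 0 \<le> Re z \<and> Im z = 0"
  by (simp add: complex_nonneg_Reals_iff)

definition real_valued :: "'k::topological_space CK \<Rightarrow> bool" where
  "real_valued f \<longleftrightarrow> (\<forall>x. Im (f x) = 0)"

definition nonneg_valued :: "'k::topological_space CK \<Rightarrow> bool" where
  "nonneg_valued f \<longleftrightarrow> (\<forall>x. 0 \<le> Re (f x) \<and> Im (f x) = 0)"

lemma nonneg_valued_real: "nonneg_valued f \<Longrightarrow> real_valued f"
  by (simp add: nonneg_valued_def real_valued_def)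

text \<open>Plain functions rather than elements of a dual space: their product topology is the
  weak* topology, and boundedness comes from positivity (\<open>state_norm\<close>).\<close>

definition states :: "('k::topological_space CK \<Rightarrow> complex) set" where
  "states = {\<psi>. (\<forall>f g. \<psi> (f + g) = \<psi> f + \<psi> g) \<and> (\<forall>c f. \<psi> (cscale c f) = c * \<psi> f) \<and>
     (\<forall>f. nonneg_valued f \<longrightarrow> 0 \<le> Re (\<psi> f) \<and> Im (\<psi> f) = 0) \<and> \<psi> (const_bcontfun 1) = 1}"

definition abs_CK :: "'k::topological_space CK \<Rightarrow> 'k CK" where
  "abs_CK f = Bcontfun (\<lambda>x. of_real (cmod (f x)))"

definition re_CK :: "'k::topological_space CK \<Rightarrow> 'k CK" where
  "re_CK f = Bcontfun (\<lambda>x. of_real (Re (f x)))"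

lemma abs_CK_apply [simp]: "apply_bcontfun (abs_CK f) x = of_real (cmod (f x))"
proof -
  have "(\<lambda>x. complex_of_real (cmod (f x))) \<in> bcontfun"
    by (rule bcontfun_normI[where b = "norm f"]) (auto intro!: continuous_intros norm_bounded)
  then show ?thesis by (simp add: abs_CK_def Bcontfun_inverse)
qed

lemma re_CK_apply [simp]: "apply_bcontfun (re_CK f) x = of_real (Re (f x))"
proof -
  have "(\<lambda>x. complex_of_real (Re (f x))) \<in> bcontfun"
    by (rule bcontfun_normI[where b = "norm f"])
      (auto intro!: continuous_intros intro: order_trans[OF abs_Re_le_cmod norm_bounded])
  then show ?thesis by (simp add: re_CK_def Bcontfun_inverse)
qed

lemma const_bcontfun_apply [simp]: "apply_bcontfun (const_bcontfun c) x = c"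
  by (simp add: const_bcontfun.rep_eq)

lemma nonneg_abs_CK [simp]: "nonneg_valued (abs_CK f)"
  by (simp add: nonneg_valued_def)

lemma real_re_CK [simp]: "real_valued (re_CK f)" by (simp add: real_valued_def)

lemma re_CK_decomp: "f = re_CK f + cscale \<i> (re_CK (cscale (- \<i>) f))"
  by (rule bcontfun_eqI) (simp add: complex_eq_iff)

lemma scaleR_CK: "r *\<^sub>R f = cscale (of_real r) f"
  by (rule bcontfun_eqI) (simp add: scaleR_conv_of_real)

lemma cscale_minus_one: "cscale (- 1) f = - f"
  by (rule bcontfun_eqI) simp

lemma cscale_one [simp]: "cscale 1 f = f"
  by (rule bcontfun_eqI) simp

lemma cscale_const: "cscale c (const_bcontfun d) = const_bcontfun (c * d)"
  by (rule bcontfun_eqI) simp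

lemma cscale_cscale: "cscale c (cscale d f) = cscale (c * d) f"
  by (rule bcontfun_eqI) simp

lemma cscale_add: "cscale c (f + g) = cscale c f + cscale c g"
  by (rule bcontfun_eqI) (simp add: algebra_simps)

lemma norm_CK_le: "(\<And>x. cmod (apply_bcontfun f x) \<le> b) \<Longrightarrow> norm f \<le> b"
  by (rule norm_bound)

lemma statesI:
  assumes "\<And>f g. \<psi> (f + g) = \<psi> f + \<psi> g" "\<And>c f. \<psi> (cscale c f) = c * \<psi> f"
    "\<And>f. nonneg_valued f \<Longrightarrow> 0 \<le> Re (\<psi> f) \<and> Im (\<psi> f) = 0" "\<psi> (const_bcontfun 1) = 1"
  shows "\<psi> \<in> states"
  using assms by (simp add: states_def)

lemma
  assumes "\<psi> \<in> states"
  shows state_add: "\<psi> (f + g) = \<psi> f + \<psi> g"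
    and state_cscale: "\<psi> (cscale c f) = c * \<psi> f"
    and state_nonneg: "nonneg_valued f \<Longrightarrow> 0 \<le> Re (\<psi> f)"
    and state_nonneg_Im: "nonneg_valued f \<Longrightarrow> Im (\<psi> f) = 0"
    and state_one: "\<psi> (const_bcontfun 1) = 1"
  using assms by (simp_all add: states_def)

lemma state_const: "\<psi> \<in> states \<Longrightarrow> \<psi> (const_bcontfun c) = c"
  using state_cscale[of \<psi> c "const_bcontfun 1"] by (simp add: cscale_const state_one)

lemma state_minus: "\<psi> \<in> states \<Longrightarrow> \<psi> (- f) = - \<psi> f"
  using state_cscale[of \<psi> "- 1" f] by (simp add: cscale_minus_one)

lemma state_diff: "\<psi> \<in> states \<Longrightarrow> \<psi> (f - g) = \<psi> f - \<psi> g"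
  using state_add[of \<psi> f "- g"] by (simp add: state_minus)

lemma state_zero: "\<psi> \<in> states \<Longrightarrow> \<psi> 0 = 0"
  using state_diff[of \<psi> 0 0] by simp

lemma state_scaleR: "\<psi> \<in> states \<Longrightarrow> \<psi> (r *\<^sub>R f) = of_real r * \<psi> f"
  by (simp add: scaleR_CK state_cscale)

text \<open>Adding the constant \<open>norm f\<close> makes \<open>f\<close> nonnegative and does
  not change the imaginary part of the value.\<close>

lemma state_real:
  assumes "\<psi> \<in> states" "real_valued f"
  shows "Im (\<psi> f) = 0"
proof -
  let ?n = "const_bcontfun (of_real (norm f))"
  have "nonneg_valued (f + ?n)"
    unfolding nonneg_valued_def
  proof (intro allI)
    fix x
    have "\<bar>Re (f x)\<bar> \<le> norm f" using abs_Re_le_cmod norm_bounded by (rule order_trans)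
    then show "0 \<le> Re ((f + ?n) x) \<and> Im ((f + ?n) x) = 0"
      using assms(2) by (auto simp: real_valued_def)
  qed
  then have "Im (\<psi> (f + ?n)) = 0" using assms by (intro state_nonneg_Im)
  then show ?thesis using assms by (simp add: state_add state_const)
qed

lemma state_mono:
  assumes "\<psi> \<in> states" "real_valued f" "real_valued g" "\<And>x. Re (f x) \<le> Re (g x)"
  shows "Re (\<psi> f) \<le> Re (\<psi> g)"
proof -
  have "nonneg_valued (g - f)" using assms by (simp add: nonneg_valued_def real_valued_def)
  then have "0 \<le> Re (\<psi> (g - f))" using assms by (intro state_nonneg)
  then show ?thesis using assms by (simp add: state_diff)
qed

lemma state_Re:
  assumes "\<psi> \<in> states"
  shows "Re (\<psi> f) = Re (\<psi> (re_CK f))"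
proof -
  have "\<psi> f = \<psi> (re_CK f) + \<i> * \<psi> (re_CK (cscale (- \<i>) f))"
    using assms by (subst re_CK_decomp) (simp add: state_add state_cscale)
  then show ?thesis using state_real[OF assms real_re_CK, of "cscale (- \<i>) f"] by simp
qed

lemma state_Re_mono:
  fixes f g :: "'k::topological_space CK"
  assumes "\<psi> \<in> states" "\<And>x. Re (f x) \<le> Re (g x)"
  shows "Re (\<psi> f) \<le> Re (\<psi> g)"
  using state_mono[OF assms(1) real_re_CK[of f] real_re_CK[of g]] assms
  by (simp add: state_Re[OF assms(1), of f] state_Re[OF assms(1), of g])

lemma state_Re_le:
  fixes f :: "'k::topological_space CK"
  assumes "\<psi> \<in> states" "\<And>x. Re (f x) \<le> r"
  shows "Re (\<psi> f) \<le> r"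
  using state_Re_mono[of \<psi> f "const_bcontfun (of_real r)"] assms by (simp add: state_const)

text \<open>Rotate by a unimodular \<open>c\<close> for which \<open>c * \<psi> f\<close> is the
  modulus of \<open>\<psi> f\<close>; then compare \<open>Re (c f)\<close> with \<open>|f|\<close>
  pointwise.\<close>

lemma state_abs:
  assumes "\<psi> \<in> states"
  shows "cmod (\<psi> f) \<le> Re (\<psi> (abs_CK f))"
proof -
  define c where "c = (if \<psi> f = 0 then 1 else cnj (\<psi> f) / of_real (cmod (\<psi> f)))"
  have c: "cmod c = 1" "c * \<psi> f = of_real (cmod (\<psi> f))"
    by (auto simp: c_def norm_divide complex_norm_square[symmetric] power2_eq_square mult.commute)
  have "cmod (\<psi> f) = Re (\<psi> (cscale c f))" using assms c by (simp add: state_cscale)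
  also have "\<dots> \<le> Re (\<psi> (abs_CK f))"
  proof (rule state_Re_mono[OF assms])
    show "Re (cscale c f x) \<le> Re (abs_CK f x)" for x
      using complex_Re_le_cmod[of "c * f x"] c by (simp add: norm_mult)
  qed
  finally show ?thesis .
qed

lemma state_norm:
  assumes "\<psi> \<in> states"
  shows "cmod (\<psi> f) \<le> norm f"
proof -
  have "Re (\<psi> (abs_CK f)) \<le> norm f" by (rule state_Re_le[OF assms]) (simp add: norm_bounded)
  then show ?thesis using state_abs[OF assms, of f] by simp
qed

lemma closed_states: "closed (states :: ('k::topological_space CK \<Rightarrow> complex) set)"
proof -
  have *: "states = (\<Inter>f g. {\<psi> :: 'k CK \<Rightarrow> complex. \<psi> (f + g) = \<psi> f + \<psi> g}) \<inter>
      (\<Inter>c f. {\<psi>. \<psi> (cscale c f) = c * \<psi> f}) \<inter>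
      (\<Inter>f\<in>{f. nonneg_valued f}. {\<psi>. 0 \<le> Re (\<psi> f)} \<inter> {\<psi>. Im (\<psi> f) = 0}) \<inter>
      {\<psi>. \<psi> (const_bcontfun 1) = 1}"
    by (auto simp: states_def)
  show ?thesis
    unfolding *
    by (intro closed_Int closed_INT ballI closed_Collect_eq closed_Collect_le continuous_intros
        continuous_on_eval_fun)
qed

text \<open>The Banach--Alaoglu argument: states lie in the product of the discs of radius
  \<open>norm f\<close>, which is compact by Tychonoff's theorem.\<close>

lemma compact_closed_states:
  assumes "closed X" "X \<subseteq> (states :: ('k::topological_space CK \<Rightarrow> complex) set)"
  shows "compact X"
proof -
  let ?B = "Pi\<^sub>E (UNIV :: 'k CK set) (\<lambda>f. cball (0::complex) (norm f))"
  have "compactin (product_topology (\<lambda>_. euclidean) UNIV) ?B"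
    by (simp add: compactin_PiE)
  then have "compact ?B" by (simp add: euclidean_product_topology)
  moreover have "X \<subseteq> ?B"
  proof
    fix \<psi> assume "\<psi> \<in> X"
    then have "\<psi> \<in> states" using assms by blast
    then show "\<psi> \<in> ?B" using state_norm by auto
  qed
  ultimately show ?thesis using compact_Int_closed[of ?B X] assms(1) by (simp add: Int_absorb1)
qed

lemma convex_comb_state:
  assumes "a \<in> states" "b \<in> states" "0 \<le> t" "t \<le> (1::real)"
  shows "(\<lambda>f. of_real t * a f + of_real (1 - t) * b f) \<in> states"
proof (rule statesI)
  show "0 \<le> Re (of_real t * a f + of_real (1 - t) * b f) \<and> Im (of_real t * a f + of_real (1 - t) * b f) = 0"
    if "nonneg_valued f" for f
    using assms that by (simp add: state_nonneg state_nonneg_Im)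
qed (use assms in \<open>simp_all add: state_add state_cscale state_one algebra_simps\<close>)

text \<open>Makes pointwise facts about Markov operators instances of facts about states.\<close>

lemma markov_state:
  assumes "markov_op T"
  shows "(\<lambda>f. apply_bcontfun (blinfun_apply T f) x) \<in> states"
proof (rule statesI)
  show "(T (cscale c f)) x = c * (T f) x" for c f
    using assms by (simp add: markov_op_def complex_linear_op_def)
  show "0 \<le> Re ((T f) x) \<and> Im ((T f) x) = 0" if "nonneg_valued f" for f
    using assms that unfolding markov_op_def positive_op_def nonneg_valued_def complex_nonneg_iff by blast
  show "(T (const_bcontfun 1)) x = 1" using assms by (simp add: markov_op_def)
qed (simp add: blinfun.add_right)

lemma eval_state: "(\<lambda>f. apply_bcontfun f x) \<in> states"
  by (rule statesI) (auto simp: nonneg_valued_def)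

lemma
  fixes f g :: "'k::topological_space CK"
  assumes T: "markov_op T"
  shows markov_cscale: "T (cscale c f) = cscale c (T f)"
    and markov_const: "T (const_bcontfun c) = const_bcontfun c"
    and markov_nonneg: "nonneg_valued f \<Longrightarrow> nonneg_valued (T f)"
    and markov_real: "real_valued f \<Longrightarrow> real_valued (T f)"
    and markov_abs: "cmod (T f x) \<le> Re (T (abs_CK f) x)"
    and markov_Re_le: "(\<And>y. Re (f y) \<le> r) \<Longrightarrow> Re (T f x) \<le> r"
    and markov_Re_mono: "(\<And>y. Re (f y) \<le> Re (g y)) \<Longrightarrow> Re (T f x) \<le> Re (T g x)"
    and markov_re_CK: "T (re_CK f) = re_CK (T f)"
proof -
  note s = markov_state[OF T]
  show "T (cscale c f) = cscale c (T f)" using T by (simp add: markov_op_def complex_linear_op_def)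
  show "T (const_bcontfun c) = const_bcontfun c" by (rule bcontfun_eqI) (simp add: state_const[OF s])
  show "nonneg_valued f \<Longrightarrow> nonneg_valued (T f)"
    using state_nonneg[OF s] state_nonneg_Im[OF s] by (auto simp: nonneg_valued_def)
  show real: "real_valued f \<Longrightarrow> real_valued (T f)" for f
    using state_real[OF s] by (simp add: real_valued_def)
  show "cmod (T f x) \<le> Re (T (abs_CK f) x)" by (rule state_abs[OF s])
  show "(\<And>y. Re (f y) \<le> r) \<Longrightarrow> Re (T f x) \<le> r" by (rule state_Re_le[OF s])
  show "(\<And>y. Re (f y) \<le> Re (g y)) \<Longrightarrow> Re (T f x) \<le> Re (T g x)" by (rule state_Re_mono[OF s])
  show "T (re_CK f) = re_CK (T f)"
    using real[OF real_re_CK, of f] state_Re[OF s, of f]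
    by (intro bcontfun_eqI) (simp add: complex_eq_iff real_valued_def)
qed


section \<open>Averages and mean ergodicity\<close>

text \<open>The strong operator topology is pulled back from a product topology, whose basic open
  sets restrict finitely many coordinates only.\<close>

lemma strong_operator_topology_nbhd:
  fixes P :: "'a::real_normed_vector \<Rightarrow>\<^sub>L 'b::real_normed_vector"
  assumes "openin strong_operator_topology U" "P \<in> U"
  obtains F e where "finite F" "0 < e"
    "\<And>T. (\<And>f. f \<in> F \<Longrightarrow> norm (blinfun_apply T f - blinfun_apply P f) < e) \<Longrightarrow> T \<in> U"
proof -
  obtain V where V: "open V" "U = blinfun_apply -` V"
    using assms(1) unfolding strong_operator_topology_def openin_pullback_topology by auto
  have "openin (product_topology (\<lambda>_. euclidean) UNIV) V"
    using V(1) by (simp add: euclidean_product_topology)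
  then have "\<exists>X. blinfun_apply P \<in> Pi\<^sub>E UNIV X \<and> (\<forall>i. openin euclidean (X i)) \<and>
      finite {i. X i \<noteq> topspace euclidean} \<and> Pi\<^sub>E UNIV X \<subseteq> V"
    by (rule product_topology_open_contains_basis) (use assms(2) V(2) in simp)
  then obtain X where X: "blinfun_apply P \<in> Pi\<^sub>E UNIV X" "\<And>i. open (X i)" "finite {i. X i \<noteq> UNIV}"
      "Pi\<^sub>E UNIV X \<subseteq> V"
    unfolding open_openin[symmetric] topspace_euclidean by (elim exE conjE) simp
  let ?F = "{i. X i \<noteq> UNIV}"
  have "\<exists>e>0. ball (P i) e \<subseteq> X i" for i
    using X(1) X(2)[of i] by (metis PiE_mem UNIV_I openE)
  then obtain e where e: "\<And>i. 0 < e i" "\<And>i. ball (P i) (e i) \<subseteq> X i" by metis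
  \<comment> \<open>The entry \<open>1\<close> covers the case that no coordinate is
    restricted.\<close>
  define d where "d = Min (insert 1 (e ` ?F))"
  have d: "0 < d" "\<And>i. i \<in> ?F \<Longrightarrow> d \<le> e i"
    using X(3) e(1) by (auto simp: d_def)
  show thesis
  proof (rule that[OF X(3) d(1)])
    fix T assume T: "\<And>f. f \<in> ?F \<Longrightarrow> norm (blinfun_apply T f - blinfun_apply P f) < d"
    have "T i \<in> X i" for i
    proof (cases "i \<in> ?F")
      case True
      then have "T i \<in> ball (P i) (e i)"
        using T[OF True] d(2)[OF True] by (simp add: dist_norm norm_minus_commute)
      then show ?thesis using e(2) by blast
    qed auto
    then have "blinfun_apply T \<in> Pi\<^sub>E UNIV X" by (intro PiE_I) auto
    then have "blinfun_apply T \<in> V" using X(4) by (rule rev_subsetD)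
    then show "T \<in> U" using V(2) by simp
  qed
qed

lemma state_continuous:
  assumes "\<psi> \<in> states"
  shows "continuous_on UNIV \<psi>"
proof (rule continuous_onI)
  fix f g :: "'a CK" and e :: real assume "0 < e"
  have "dist (\<psi> g) (\<psi> f) \<le> dist g f" for g
    using state_norm[OF assms, of "g - f"] by (simp add: state_diff[OF assms] dist_norm)
  then show "\<exists>d>0. \<forall>x'\<in>UNIV. dist x' f < d \<longrightarrow> dist (\<psi> x') (\<psi> f) \<le> e"
    using \<open>0 < e\<close> by (intro exI[of _ e]) (auto intro: order_trans less_imp_le)
qed

lemma markov_norm:
  fixes f :: "'k::topological_space CK"
  assumes "markov_op T"
  shows "norm (T f) \<le> norm f"
  using state_norm[OF markov_state[OF assms]] by (intro norm_CK_le)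

lemma convex_markov: "convex {T :: 'k::topological_space CK_op. markov_op T}"
proof (rule convexI)
  fix S T :: "'k CK_op" and u v :: real
  assume S: "S \<in> {T. markov_op T}" and T: "T \<in> {T. markov_op T}" and uv: "0 \<le> u" "0 \<le> v" "u + v = 1"
  then have S: "markov_op S" and T: "markov_op T" by auto
  have v: "v = 1 - u" using uv by simp
  have app: "apply_bcontfun (blinfun_apply (u *\<^sub>R S + v *\<^sub>R T) f) x = of_real u * S f x + of_real v * T f x" for f :: "'k CK" and x
    by (simp add: blinfun.add_left blinfun.scaleR_left scaleR_conv_of_real)
  have st: "(\<lambda>f. apply_bcontfun (blinfun_apply (u *\<^sub>R S + v *\<^sub>R T) f) x) \<in> states" for x
    unfolding app unfolding v
    using uv by (intro convex_comb_state[OF markov_state[OF S] markov_state[OF T]]) auto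
  have "markov_op (u *\<^sub>R S + v *\<^sub>R T)"
    unfolding markov_op_def complex_linear_op_def positive_op_def
  proof (intro conjI allI impI)
    show "blinfun_apply (u *\<^sub>R S + v *\<^sub>R T) (cscale c f) = cscale c (blinfun_apply (u *\<^sub>R S + v *\<^sub>R T) f)"
      for c and f :: "'k CK"
      using state_cscale[OF st] by (intro bcontfun_eqI) simp
    show "blinfun_apply (u *\<^sub>R S + v *\<^sub>R T) (const_bcontfun 1) = const_bcontfun 1"
      using state_one[OF st] by (intro bcontfun_eqI) simp
    show "apply_bcontfun (blinfun_apply (u *\<^sub>R S + v *\<^sub>R T) f) x \<in> \<real>\<^sub>\<ge>\<^sub>0" if "\<forall>x. f x \<in> \<real>\<^sub>\<ge>\<^sub>0"
      for f :: "'k CK" and x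
      using state_nonneg[OF st] state_nonneg_Im[OF st] that
      unfolding complex_nonneg_iff nonneg_valued_def by blast
  qed
  then show "u *\<^sub>R S + v *\<^sub>R T \<in> {T. markov_op T}" by simp
qed

locale markov_semigroup =
  fixes \<S> :: "'k::t2_space CK_op set"
  assumes compact_K: "compact (UNIV :: 'k set)"
    and semigroup: "op_semigroup \<S>"
    and markov: "S \<in> \<S> \<Longrightarrow> markov_op S"
    and amenable: "right_amenable \<S>"
begin

definition inv_states :: "('k CK \<Rightarrow> complex) set" where
  "inv_states = {\<psi> \<in> states. \<forall>S\<in>\<S>. \<forall>f. \<psi> (S f) = \<psi> f}"

lemma inv_state_state: "\<psi> \<in> inv_states \<Longrightarrow> \<psi> \<in> states" by (simp add: inv_states_def)

lemma inv_state_inv: "\<psi> \<in> inv_states \<Longrightarrow> S \<in> \<S> \<Longrightarrow> \<psi> (S f) = \<psi> f" by (simp add: inv_states_def)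

lemma closed_inv_states: "closed inv_states"
proof -
  have *: "inv_states = states \<inter> (\<Inter>S\<in>\<S>. \<Inter>f. {\<psi>. \<psi> (blinfun_apply S f) = \<psi> f})"
    by (auto simp: inv_states_def)
  show ?thesis
    unfolding *
    by (intro closed_Int closed_states closed_INT ballI closed_Collect_eq continuous_on_eval_fun)
qed

lemma compact_inv_states: "compact inv_states"
  using closed_inv_states by (rule compact_closed_states) (auto simp: inv_states_def)

section \<open>Averaging states with the invariant mean\<close>

definition mean :: "('k CK_op \<Rightarrow> complex) \<Rightarrow> complex" where
  "mean = (SOME m. right_invariant_mean \<S> m)"

definition avg :: "('k CK \<Rightarrow> complex) \<Rightarrow> 'k CK \<Rightarrow> complex" where
  "avg \<psi> f = mean (\<lambda>T. \<psi> (blinfun_apply T f))"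

lemma mean_right_invariant: "right_invariant_mean \<S> mean"
  unfolding mean_def using amenable unfolding right_amenable_def by (rule someI_ex)

lemma
  shows mean_add: "f \<in> Cb \<S> \<Longrightarrow> g \<in> Cb \<S> \<Longrightarrow> mean (\<lambda>T. f T + g T) = mean f + mean g"
    and mean_scale: "f \<in> Cb \<S> \<Longrightarrow> mean (\<lambda>T. c * f T) = c * mean f"
    and mean_nonneg: "f \<in> Cb \<S> \<Longrightarrow> (\<And>T. T \<in> \<S> \<Longrightarrow> f T \<in> \<real>\<^sub>\<ge>\<^sub>0) \<Longrightarrow> mean f \<in> \<real>\<^sub>\<ge>\<^sub>0"
    and mean_one: "mean (\<lambda>_. 1) = 1"
    and mean_inv: "S \<in> \<S> \<Longrightarrow> f \<in> Cb \<S> \<Longrightarrow> mean (\<lambda>T. f (T o\<^sub>L S)) = mean f"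
  using mean_right_invariant unfolding right_invariant_mean_def by blast+

text \<open>The boundedness clause of the mean at \<open>b = 0\<close> makes it blind to values
  outside \<open>\<S>\<close>; \<open>mean_cong\<close> and \<open>nonempty\<close> rest on
  this.\<close>

lemma mean_zero:
  assumes "f \<in> Cb \<S>" "\<And>T. T \<in> \<S> \<Longrightarrow> f T = 0"
  shows "mean f = 0"
proof -
  obtain B where "\<And>f b. f \<in> Cb \<S> \<Longrightarrow> (\<forall>T\<in>\<S>. cmod (f T) \<le> b) \<Longrightarrow> cmod (mean f) \<le> B * b"
    using mean_right_invariant unfolding right_invariant_mean_def by blast
  from this[OF assms(1), of 0] show ?thesis using assms(2) by simp
qed

lemma Cb_const: "(\<lambda>_. c) \<in> Cb \<S>"
  by (simp add: Cb_def image_constant_conv)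

lemma Cb_add: "f \<in> Cb \<S> \<Longrightarrow> g \<in> Cb \<S> \<Longrightarrow> (\<lambda>T. f T + g T) \<in> Cb \<S>"
  unfolding Cb_def
  by (auto intro!: continuous_map_add bounded_plus_comp)

lemma Cb_scale: "f \<in> Cb \<S> \<Longrightarrow> (\<lambda>T. c * f T) \<in> Cb \<S>"
  unfolding Cb_def
  using continuous_map_compose[of _ euclidean f euclidean "\<lambda>z. c * z"]
  by (auto simp: bounded_iff norm_mult o_def intro!: continuous_intros)
    (meson mult_left_mono norm_ge_zero)

lemma mean_cong:
  assumes "f \<in> Cb \<S>" "g \<in> Cb \<S>" "\<And>T. T \<in> \<S> \<Longrightarrow> f T = g T"
  shows "mean f = mean g"
proof -
  have "mean (\<lambda>T. f T + (- 1) * g T) = 0"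
    using assms by (intro mean_zero Cb_add Cb_scale) auto
  then show ?thesis
    using mean_add[OF assms(1) Cb_scale[OF assms(2), of "- 1"]] mean_scale[OF assms(2), of "- 1"] by simp
qed

lemma nonempty: "\<S> \<noteq> {}"
proof
  assume "\<S> = {}"
  then have "mean (\<lambda>_. 1) = 0" by (intro mean_zero Cb_const) auto
  then show False by (simp add: mean_one)
qed

lemma Cb_state:
  assumes "\<psi> \<in> states"
  shows "(\<lambda>T. \<psi> (blinfun_apply T f)) \<in> Cb \<S>"
proof -
  have "continuous_map strong_operator_topology euclidean (\<psi> \<circ> (\<lambda>T. blinfun_apply T f))"
    using state_continuous[OF assms]
    by (intro continuous_map_compose[OF strong_operator_topology_continuous_evaluation]) auto
  then have "continuous_map (subtopology strong_operator_topology \<S>) euclidean (\<lambda>T. \<psi> (blinfun_apply T f))"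
    by (intro continuous_map_from_subtopology) (simp add: o_def)
  moreover have "bounded ((\<lambda>T. \<psi> (blinfun_apply T f)) ` \<S>)"
    using state_norm[OF assms] markov_norm[OF markov]
    by (auto simp: bounded_iff intro!: exI[of _ "norm f"] intro: order_trans)
  ultimately show ?thesis by (simp add: Cb_def)
qed

text \<open>Invariance is right invariance of the mean: replacing \<open>f\<close> by
  \<open>S f\<close> replaces \<open>T\<close> by \<open>T o\<^sub>L S\<close>.\<close>

lemma avg_inv_state:
  assumes \<psi>: "\<psi> \<in> states"
  shows "avg \<psi> \<in> inv_states"
proof -
  have "avg \<psi> \<in> states"
  proof (rule statesI)
    show "avg \<psi> (f + g) = avg \<psi> f + avg \<psi> g" for f g
      unfolding avg_def using mean_add[OF Cb_state[OF \<psi>, of f] Cb_state[OF \<psi>, of g]]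
      by (simp add: blinfun.add_right state_add[OF \<psi>])
    show "avg \<psi> (cscale c f) = c * avg \<psi> f" for c f
    proof -
      have "mean (\<lambda>T. \<psi> (blinfun_apply T (cscale c f))) = mean (\<lambda>T. c * \<psi> (blinfun_apply T f))"
        using markov by (intro mean_cong Cb_state Cb_scale \<psi>) (simp add: markov_cscale state_cscale[OF \<psi>])
      then show ?thesis unfolding avg_def by (simp add: mean_scale Cb_state[OF \<psi>])
    qed
    show "0 \<le> Re (avg \<psi> f) \<and> Im (avg \<psi> f) = 0" if "nonneg_valued f" for f
      unfolding avg_def complex_nonneg_iff[symmetric]
      using that markov
      by (intro mean_nonneg Cb_state[OF \<psi>])
        (simp add: complex_nonneg_iff state_nonneg[OF \<psi>] state_nonneg_Im[OF \<psi>] markov_nonneg)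
    have "mean (\<lambda>T. \<psi> (blinfun_apply T (const_bcontfun 1))) = mean (\<lambda>_. 1)"
      using markov by (intro mean_cong Cb_state Cb_const \<psi>) (simp add: markov_const state_const[OF \<psi>])
    then show "avg \<psi> (const_bcontfun 1) = 1" unfolding avg_def by (simp add: mean_one)
  qed
  moreover have "avg \<psi> (S f) = avg \<psi> f" if "S \<in> \<S>" for S f
    unfolding avg_def using mean_inv[OF that Cb_state[OF \<psi>, of f]] by simp
  ultimately show ?thesis by (simp add: inv_states_def)
qed

lemma avg_zero:
  assumes "\<psi> \<in> states" "\<And>T. T \<in> \<S> \<Longrightarrow> \<psi> (T f) = 0"
  shows "avg \<psi> f = 0"
  unfolding avg_def using assms by (intro mean_zero Cb_state)

lemma avg_fix:
  assumes "\<psi> \<in> states" "f \<in> fix_ops \<S>"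
  shows "avg \<psi> f = \<psi> f"
proof -
  have "mean (\<lambda>T. \<psi> (blinfun_apply T f)) = mean (\<lambda>T. \<psi> f * 1)"
    using assms by (intro mean_cong Cb_state Cb_const) (auto simp: fix_ops_def intro: Cb_const)
  also have "\<dots> = \<psi> f" by (subst mean_scale) (auto simp: Cb_const mean_one)
  finally show ?thesis unfolding avg_def .
qed

text \<open>Positivity of the mean concerns real values, so \<open>h\<close> is first replaced by
  its real part, which Markov operators and states respect.\<close>

lemma avg_Re_ge:
  assumes \<psi>: "\<psi> \<in> states" and ge: "\<And>T. T \<in> \<S> \<Longrightarrow> e \<le> Re (\<psi> (T h))"
  shows "e \<le> Re (avg \<psi> h)"
proof -
  let ?h = "re_CK h"
  let ?f = "\<lambda>T. \<psi> (blinfun_apply T ?h) + (\<lambda>_. of_real (- e) * 1) T"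
  have "mean ?f \<in> \<real>\<^sub>\<ge>\<^sub>0"
  proof (rule mean_nonneg[OF Cb_add[OF Cb_state[OF \<psi>] Cb_const]])
    fix T assume T: "T \<in> \<S>"
    have "Im (\<psi> (T ?h)) = 0" using markov[OF T] by (intro state_real[OF \<psi>]) (simp add: markov_real)
    moreover have "Re (\<psi> (T ?h)) = Re (\<psi> (T h))"
      using markov[OF T] state_Re[OF \<psi>, of "T h"] by (simp add: markov_re_CK)
    ultimately show "?f T \<in> \<real>\<^sub>\<ge>\<^sub>0" using ge[OF T] by (simp add: complex_nonneg_iff)
  qed
  moreover have "mean ?f = avg \<psi> ?h + of_real (- e) * 1"
    unfolding avg_def mean_add[OF Cb_state[OF \<psi>] Cb_const]
    by (simp only: mean_scale[OF Cb_const] mean_one)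
  ultimately have "e \<le> Re (avg \<psi> ?h)" by (simp add: complex_nonneg_iff)
  also have "\<dots> = Re (avg \<psi> h)"
    using avg_inv_state[OF \<psi>] by (intro state_Re[symmetric] inv_state_state)
  finally show ?thesis .
qed

section \<open>The convex hull of the semigroup\<close>

definition co :: "'k CK_op set" where "co = convex hull \<S>"

lemma co_minimal: "\<S> \<subseteq> C \<Longrightarrow> convex C \<Longrightarrow> co \<subseteq> C"
  unfolding co_def by (rule hull_minimal)

lemma co_inc: "S \<in> \<S> \<Longrightarrow> S \<in> co"
  unfolding co_def by (rule hull_inc)

lemma co_nonempty: "co \<noteq> {}"
  using nonempty co_inc by blast

lemma convex_co: "convex co" unfolding co_def by simp

lemma co_markov: "T \<in> co \<Longrightarrow> markov_op T"
  using co_minimal[of "{T. markov_op T}"] convex_markov markov by blast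

text \<open>Two hull arguments: first the left factor ranges over \<open>co\<close> with the right
  factor in \<open>\<S>\<close>, then the right factor ranges over \<open>co\<close> as
  well.\<close>

lemma co_comp:
  assumes S: "S \<in> co" and T: "T \<in> co"
  shows "S o\<^sub>L T \<in> co"
proof -
  have lin1: "linear (\<lambda>R. R o\<^sub>L T)" and lin2: "linear (\<lambda>R. T o\<^sub>L R)" for T :: "'k CK_op"
    by (auto intro!: linearI blinfun_eqI simp: blinfun.add_left blinfun.add_right blinfun.scaleR_left blinfun.scaleR_right)
  have *: "S o\<^sub>L T \<in> co" if T: "T \<in> \<S>" and S: "S \<in> co" for S T :: "'k CK_op"
  proof -
    have "co \<subseteq> (\<lambda>R. R o\<^sub>L T) -` co"
    proof (rule co_minimal)
      show "\<S> \<subseteq> (\<lambda>R. R o\<^sub>L T) -` co"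
        using semigroup T unfolding op_semigroup_def by (auto intro!: co_inc)
      show "convex ((\<lambda>R. R o\<^sub>L T) -` co)" by (intro convex_linear_vimage lin1 convex_co)
    qed
    then show ?thesis using S by auto
  qed
  have "co \<subseteq> (\<lambda>R. S o\<^sub>L R) -` co"
  proof (rule co_minimal)
    show "\<S> \<subseteq> (\<lambda>R. S o\<^sub>L R) -` co" using * S by auto
    show "convex ((\<lambda>R. S o\<^sub>L R) -` co)" by (intro convex_linear_vimage lin2 convex_co)
  qed
  then show ?thesis using T by auto
qed

lemma co_inv:
  assumes "\<psi> \<in> inv_states" "T \<in> co"
  shows "\<psi> (T f) = \<psi> f"
proof -
  have "convex {T. \<psi> (blinfun_apply T f) = \<psi> f}"
  proof (rule convexI, clarify)
    fix S T :: "'k CK_op" and u v :: real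
    assume "\<psi> (S f) = \<psi> f" "\<psi> (T f) = \<psi> f" "u + v = 1"
    then show "\<psi> (blinfun_apply (u *\<^sub>R S + v *\<^sub>R T) f) = \<psi> f"
      using inv_state_state[OF assms(1)]
      by (simp add: blinfun.add_left blinfun.scaleR_left state_add state_scaleR)
        (metis distrib_right mult_1 of_real_1 of_real_add)
  qed
  then have "co \<subseteq> {T. \<psi> (blinfun_apply T f) = \<psi> f}"
    using assms(1) by (intro co_minimal) (auto simp: inv_state_inv)
  then show ?thesis using assms(2) by auto
qed

lemma co_fix:
  assumes "f \<in> fix_ops \<S>" "T \<in> co"
  shows "T f = f"
proof -
  have "convex {T. blinfun_apply T f = f}"
    by (rule convexI) (auto simp: blinfun.add_left blinfun.scaleR_left simp flip: scaleR_add_left)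
  then have "co \<subseteq> {T. blinfun_apply T f = f}"
    using assms(1) by (intro co_minimal) (auto simp: fix_ops_def)
  then show ?thesis using assms(2) by auto
qed

text \<open>If no convex combination of \<open>\<S>\<close> pushes \<open>h\<close> below \<open>e\<close>, the Mazur--Orlicz theorem yields a state
  that is at least \<open>e\<close> on the whole orbit of \<open>h\<close>; its average is an invariant state not annihilating \<open>h\<close>.\<close>

lemma co_Re_small:
  assumes h: "\<And>\<psi>. \<psi> \<in> inv_states \<Longrightarrow> \<psi> h = 0" and e: "0 < e"
  obtains T where "T \<in> co" "\<And>x. Re (apply_bcontfun (blinfun_apply T h) x) \<le> e"
proof -
  have "\<exists>T\<in>co. \<forall>x. Re (apply_bcontfun (blinfun_apply T h) x) \<le> e"
  proof (rule ccontr)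
    assume contra: "\<not> (\<exists>T\<in>co. \<forall>x. Re (apply_bcontfun (blinfun_apply T h) x) \<le> e)"
    \<comment> \<open>A linear functional below this \<open>p\<close> is automatically positive and
      normalised, and it depends only on the real part of its argument.\<close>
    define p where "p f = (SUP x. Re (apply_bcontfun f x))" for f :: "'k CK"
    have bdd: "bdd_above (range (\<lambda>x. Re (apply_bcontfun f x)))" for f :: "'k CK"
      by (auto simp: bdd_above_def intro!: exI[of _ "norm f"] intro: order_trans[OF complex_Re_le_cmod norm_bounded])
    have p_ge: "Re (f x) \<le> p f" for f :: "'k CK" and x
      unfolding p_def using bdd by (rule cSUP_upper2) auto
    have p_le: "p f \<le> r" if "\<And>x. Re (f x) \<le> r" for f :: "'k CK" and r
      unfolding p_def using that by (intro cSUP_least) auto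
    have p: "sublinear p"
    proof (rule sublinearI)
      show "p (f + g) \<le> p f + p g" for f g by (rule p_le) (simp add: add_mono p_ge)
      show "p 0 = 0" by (simp add: p_def)
      show "p (c *\<^sub>R f) \<le> c * p f" if "c > 0" for c f
        using that by (intro p_le) (simp add: p_ge)
    qed
    have lin: "linear (\<lambda>T :: 'k CK_op. T h)"
      by (intro linearI) (auto simp: blinfun.add_left blinfun.scaleR_left)
    have "e \<le> p c" if "c \<in> (\<lambda>T. blinfun_apply T h) ` co" for c
    proof -
      from that obtain T where T: "T \<in> co" "c = T h" by blast
      then obtain x where "e < Re (apply_bcontfun (blinfun_apply T h) x)" using contra not_le by blast
      then show ?thesis using p_ge[of "T h" x] T by simp
    qed
    then obtain \<nu> where \<nu>: "linear \<nu>" "\<And>f. \<nu> f \<le> p f" "\<And>c. c \<in> (\<lambda>T. blinfun_apply T h) ` co \<Longrightarrow> e \<le> \<nu> c"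
      using Mazur_Orlicz[OF p, of "(\<lambda>T. blinfun_apply T h) ` co" e] convex_linear_image[OF lin convex_co] co_nonempty
      by (metis image_is_empty)
    have up: "\<nu> f \<le> r" if "\<And>x. Re (f x) \<le> r" for f :: "'k CK" and r using \<nu>(2)[of f] p_le[OF that] by simp
    have neg: "\<nu> (- f) = - \<nu> f" for f using linear_neg[OF \<nu>(1)] .
    have zero: "\<nu> f = 0" if "\<And>x. Re (f x) = 0" for f :: "'k CK"
      using up[of f 0] up[of "- f" 0] that by (simp add: neg)
    \<comment> \<open>The usual complexification \<open>\<nu> f - \<i> \<nu> (\<i> f)\<close> of a
      real functional.\<close>
    define \<psi> where "\<psi> f = Complex (\<nu> f) (- \<nu> (cscale \<i> f))" for f
    have sc: "\<nu> (cscale c f) = Re c * \<nu> f + Im c * \<nu> (cscale \<i> f)" for c f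
    proof -
      have "cscale c f = Re c *\<^sub>R f + Im c *\<^sub>R cscale \<i> f"
        by (rule bcontfun_eqI) (simp add: complex_eq_iff)
      then show ?thesis by (simp add: linear_add[OF \<nu>(1)] linear_scale[OF \<nu>(1)])
    qed
    have "\<psi> \<in> states"
    proof (rule statesI)
      show "\<psi> (f + g) = \<psi> f + \<psi> g" for f g
        by (simp add: \<psi>_def cscale_add linear_add[OF \<nu>(1)] complex_eq_iff)
      show "\<psi> (cscale c f) = c * \<psi> f" for c f
        by (simp add: \<psi>_def complex_eq_iff cscale_cscale sc[of c f] sc[of "\<i> * c" f] algebra_simps)
      show "0 \<le> Re (\<psi> f) \<and> Im (\<psi> f) = 0" if "nonneg_valued f" for f
        using up[of "- f" 0] zero[of "cscale \<i> f"] that by (simp add: \<psi>_def neg nonneg_valued_def)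
      show "\<psi> (const_bcontfun 1) = 1"
        using up[of "const_bcontfun 1" 1] up[of "- const_bcontfun 1" "- 1"] zero[of "cscale \<i> (const_bcontfun 1)"]
        by (simp add: \<psi>_def neg complex_eq_iff)
    qed
    moreover from this have "e \<le> Re (avg \<psi> h)"
      by (rule avg_Re_ge) (auto simp: \<psi>_def intro!: \<nu>(3) co_inc)
    ultimately show False using h[OF avg_inv_state, of \<psi>] e by simp
  qed
  then show thesis using that by blast
qed

text \<open>Once \<open>T\<close> handles the tail, some \<open>R\<close> handles
  \<open>T h\<close>, which invariant states still annihilate; being Markov, \<open>R\<close> does
  not raise the upper bounds already reached.\<close>

lemma co_Re_small_list:
  assumes "\<And>h \<psi>. h \<in> set hs \<Longrightarrow> \<psi> \<in> inv_states \<Longrightarrow> \<psi> h = 0" and e: "0 < e"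
  shows "\<exists>T\<in>co. \<forall>h\<in>set hs. \<forall>x. Re (apply_bcontfun (blinfun_apply T h) x) \<le> e"
  using assms(1)
proof (induction hs)
  case Nil
  then show ?case using co_nonempty by auto
next
  case (Cons h hs)
  then obtain T where T: "T \<in> co" "\<And>h x. h \<in> set hs \<Longrightarrow> Re (apply_bcontfun (blinfun_apply T h) x) \<le> e" by fastforce
  obtain R where R: "R \<in> co" "\<And>x. Re (apply_bcontfun (blinfun_apply R (blinfun_apply T h)) x) \<le> e"
    by (rule co_Re_small[of "T h" e]) (use Cons.prems T(1) e in \<open>auto simp: co_inv\<close>)
  have "Re (apply_bcontfun (blinfun_apply R (blinfun_apply T g)) x) \<le> e" if "g \<in> set (h # hs)" for g x
    using that R(2) markov_Re_le[OF co_markov[OF R(1)], of "T g" e x] T(2)[of g] by auto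
  then show ?case using co_comp[OF R(1) T(1)] by (intro bexI[of _ "R o\<^sub>L T"]) auto
qed

text \<open>Averaging does not change fixed functions, so \<open>Q f x\<close> is the averaged
  evaluation of \<open>f\<close> at \<open>x\<close>; hence \<open>Q\<close> is linear and
  contractive. All invariant states annihilate \<open>f - Q f\<close>, so one convex combination,
  which leaves \<open>Q f\<close> fixed, makes finitely many of these differences small.\<close>

theorem mean_ergodicI:
  assumes Q_fix: "\<And>f. Q f \<in> fix_ops \<S>" and inv: "\<And>\<psi> f. \<psi> \<in> inv_states \<Longrightarrow> \<psi> (Q f) = \<psi> f"
  shows "mean_ergodic \<S>"
proof -
  define \<phi> where "\<phi> x = avg (\<lambda>f. apply_bcontfun f x)" for x
  have \<phi>: "\<phi> x \<in> inv_states" for x unfolding \<phi>_def by (intro avg_inv_state eval_state)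
  note \<phi>s = inv_state_state[OF \<phi>]
  have Q: "Q f x = \<phi> x f" for f x
    using inv[OF \<phi>, of x f] avg_fix[OF eval_state Q_fix, of x f] by (simp add: \<phi>_def)
  have "bounded_linear Q"
  proof (rule bounded_linear_intro[where K = 1])
    show "Q (f + g) = Q f + Q g" for f g by (rule bcontfun_eqI) (simp add: Q state_add[OF \<phi>s])
    show "Q (r *\<^sub>R f) = r *\<^sub>R Q f" for r f
      by (rule bcontfun_eqI) (simp add: Q state_scaleR[OF \<phi>s] scaleR_conv_of_real)
    show "norm (Q f) \<le> norm f * 1" for f using state_norm[OF \<phi>s] by (simp add: norm_CK_le Q)
  qed
  define P where "P = Blinfun Q"
  have P: "blinfun_apply P = Q" unfolding P_def using \<open>bounded_linear Q\<close> by (rule bounded_linear_Blinfun_apply)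
  have "P \<in> strong_operator_topology closure_of co"
    unfolding in_closure_of strong_operator_topology_topspace
  proof (intro conjI UNIV_I allI impI)
    fix U assume U: "P \<in> U \<and> openin strong_operator_topology U"
    then obtain F e where F: "finite F" "0 < e"
      and FU: "\<And>T. (\<And>f. f \<in> F \<Longrightarrow> norm (blinfun_apply T f - blinfun_apply P f) < e) \<Longrightarrow> T \<in> U"
      using strong_operator_topology_nbhd[of U P] by blast
    obtain fs where fs: "set fs = F" using finite_list[OF F(1)] by blast
    \<comment> \<open>Upper bounds for real parts after multiplication by \<open>1\<close>,
      \<open>- 1\<close>, \<open>\<i>\<close>, \<open>- \<i>\<close> control the modulus; the bound
      \<open>e / 3\<close> for each of them gives \<open>2 * (e / 3) < e\<close>.\<close>
    define hs where "hs = concat (map (\<lambda>f. map (\<lambda>c. cscale c (f - Q f)) [1, - 1, \<i>, - \<i>]) fs)"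
    have hs: "set hs = (\<Union>f\<in>F. (\<lambda>c. cscale c (f - Q f)) ` {1, - 1, \<i>, - \<i>})"
      by (auto simp: hs_def fs)
    have "\<exists>T\<in>co. \<forall>h\<in>set hs. \<forall>x. Re (apply_bcontfun (blinfun_apply T h) x) \<le> e / 3"
    proof (rule co_Re_small_list)
      show "\<psi> h = 0" if "h \<in> set hs" "\<psi> \<in> inv_states" for h \<psi>
        using that inv_state_state[OF that(2)] by (auto simp: hs state_cscale state_diff inv)
    qed (use F(2) in simp)
    then obtain T where T: "T \<in> co" "\<And>h x. h \<in> set hs \<Longrightarrow> Re (apply_bcontfun (blinfun_apply T h) x) \<le> e / 3" by blast
    have "norm (T f - P f) < e" if f: "f \<in> F" for f
    proof -
      have TQ: "T (f - Q f) = T f - Q f"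
        using co_fix[OF Q_fix T(1)] by (simp add: blinfun.diff_right)
      have "cmod ((T f - Q f) x) \<le> 2 * (e / 3)" for x
      proof -
        define z where "z = (T f - Q f) x"
        have c: "Re (c * z) \<le> e / 3" if c: "c \<in> {1, - 1, \<i>, - \<i>}" for c
        proof -
          have "cscale c (f - Q f) \<in> set hs" unfolding hs using f c by (intro UN_I[OF f] imageI)
          from T(2)[OF this, of x] show ?thesis
            by (simp add: markov_cscale[OF co_markov[OF T(1)]] TQ z_def)
        qed
        have "\<bar>Re z\<bar> \<le> e / 3" "\<bar>Im z\<bar> \<le> e / 3"
          using c[of 1] c[of "- 1"] c[of \<i>] c[of "- \<i>"] by simp_all
        then show ?thesis using cmod_le[of z] unfolding z_def by linarith
      qed
      then have "norm (T f - Q f) \<le> 2 * (e / 3)" by (rule norm_CK_le)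
      then show ?thesis using F(2) P by simp
    qed
    then have "T \<in> U" by (rule FU)
    then show "\<exists>y. y \<in> co \<and> y \<in> U" using T(1) by blast
  qed
  moreover have "P o\<^sub>L S = P" "S o\<^sub>L P = P" if S: "S \<in> \<S>" for S
  proof -
    show "P o\<^sub>L S = P"
      by (intro blinfun_eqI bcontfun_eqI) (simp add: P Q inv_state_inv[OF \<phi> S])
    show "S o\<^sub>L P = P"
      using Q_fix S by (intro blinfun_eqI) (simp add: P fix_ops_def)
  qed
  ultimately show ?thesis unfolding mean_ergodic_def co_def by blast
qed

end


section \<open>States and regular measures\<close>

locale regular_probability =
  fixes \<mu> :: "'k::t2_space measure"
  assumes compact_K: "compact (UNIV :: 'k set)" and regular: "regular_prob \<mu>"
begin

sublocale prob_space \<mu> using regular by (simp add: regular_prob_def)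

lemma sets_eq: "sets \<mu> = sets borel" using regular by (simp add: regular_prob_def)

lemma space_eq: "space \<mu> = UNIV" using sets_eq_imp_space_eq[OF sets_eq] by simp

lemma measurable_cont: "continuous_on UNIV f \<Longrightarrow> f \<in> borel_measurable \<mu>"
  using borel_measurable_continuous_onI[of f] by (simp add: measurable_cong_sets[OF sets_eq refl])

lemma measurable_CK [measurable]: "apply_bcontfun f \<in> borel_measurable \<mu>" for f :: "'k CK"
  by (rule measurable_cont) simp

lemma integrable_CK [simp]: "integrable \<mu> (apply_bcontfun f)" for f :: "'k CK"
  by (rule integrable_const_bound[where B = "norm f"]) (auto intro: norm_bounded)

lemma integral_state: "(\<lambda>f :: 'k CK. \<integral>x. f x \<partial>\<mu>) \<in> states"
proof (rule statesI)
  show "0 \<le> Re (\<integral>x. f x \<partial>\<mu>) \<and> Im (\<integral>x. f x \<partial>\<mu>) = 0" if "nonneg_valued f" for f :: "'k CK"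
    using that by (auto simp: nonneg_valued_def simp flip: integral_Re integral_Im)
qed (auto simp: prob_space)

lemma functional_eq: "blinfun_apply (functional \<mu>) = (\<lambda>f :: 'k CK. \<integral>x. f x \<partial>\<mu>)"
  using functional_apply[OF regular] by blast

lemma functional_state: "blinfun_apply (functional \<mu>) \<in> states"
  unfolding functional_eq by (rule integral_state)

lemma regular_approx:
  assumes B: "B \<in> sets borel" and e: "0 < e"
  obtains C U where "compact C" "C \<subseteq> B" "B \<subseteq> U" "open U"
    "measure \<mu> B < measure \<mu> C + e" "measure \<mu> U < measure \<mu> B + e"
proof -
  have "emeasure \<mu> B < emeasure \<mu> B + ennreal e"
    using e by (simp add: emeasure_eq_measure ennreal_less_iff flip: ennreal_plus)
  then have "(INF U\<in>{U. open U \<and> B \<subseteq> U}. emeasure \<mu> U) < emeasure \<mu> B + ennreal e"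
    using regular B unfolding regular_prob_def by metis
  then obtain U where U: "open U" "B \<subseteq> U" "emeasure \<mu> U < emeasure \<mu> B + ennreal e"
    unfolding INF_less_iff by auto
  \<comment> \<open>The case split keeps \<open>measure \<mu> B - e\<close> nonnegative, since
    \<open>ennreal\<close> truncates negative numbers to zero.\<close>
  have "\<exists>C. compact C \<and> C \<subseteq> B \<and> measure \<mu> B < measure \<mu> C + e"
  proof (cases "measure \<mu> B < e")
    case True
    then show ?thesis by (intro exI[of _ "{}"]) simp
  next
    case False
    then have "ennreal (measure \<mu> B - e) < emeasure \<mu> B"
      using e by (simp add: emeasure_eq_measure ennreal_less_iff)
    also have "\<dots> = (SUP C\<in>{C. compact C \<and> C \<subseteq> B}. emeasure \<mu> C)"
      using regular B unfolding regular_prob_def by metis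
    finally obtain C where "compact C" "C \<subseteq> B" "ennreal (measure \<mu> B - e) < emeasure \<mu> C"
      unfolding less_SUP_iff by auto
    then show ?thesis using False
      by (intro exI[of _ C]) (auto simp: emeasure_eq_measure ennreal_less_iff)
  qed
  then obtain C where C: "compact C" "C \<subseteq> B" "measure \<mu> B < measure \<mu> C + e" by blast
  have "measure \<mu> U < measure \<mu> B + e"
    using U(3) e by (simp add: emeasure_eq_measure ennreal_less_iff flip: ennreal_plus)
  with C U show thesis by (intro that)
qed

end

text \<open>Inner regularity follows by complements: an open set slightly larger than
  \<open>- B\<close> has a closed complement inside \<open>B\<close>, which is compact in a compact
  space.\<close>

lemma regular_probI:
  fixes \<mu> :: "'k::t2_space measure"
  assumes cpt: "compact (UNIV :: 'k set)" and sets: "sets \<mu> = sets borel" and prob: "prob_space \<mu>"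
    and outer: "\<And>B e. B \<in> sets borel \<Longrightarrow> 0 < e \<Longrightarrow>
      \<exists>U. open U \<and> B \<subseteq> U \<and> measure \<mu> U < measure \<mu> B + e"
  shows "regular_prob \<mu>"
  unfolding regular_prob_def
proof (intro conjI ballI sets prob)
  interpret prob_space \<mu> by (rule prob)
  have sp: "space \<mu> = UNIV" using sets_eq_imp_space_eq[OF sets] by simp
  fix B :: "'k set" assume B: "B \<in> sets borel"
  show "emeasure \<mu> B = (INF U\<in>{U. open U \<and> B \<subseteq> U}. emeasure \<mu> U)"
  proof (rule antisym)
    show "emeasure \<mu> B \<le> (INF U\<in>{U. open U \<and> B \<subseteq> U}. emeasure \<mu> U)"
      by (rule INF_greatest) (auto intro!: emeasure_mono simp: sets)
    show "(INF U\<in>{U. open U \<and> B \<subseteq> U}. emeasure \<mu> U) \<le> emeasure \<mu> B"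
    proof (rule ennreal_le_epsilon)
      fix e :: real assume "0 < e"
      then obtain U where U: "open U" "B \<subseteq> U" "measure \<mu> U < measure \<mu> B + e" using outer[OF B] by blast
      have "(INF U\<in>{U. open U \<and> B \<subseteq> U}. emeasure \<mu> U) \<le> emeasure \<mu> U"
        using U by (intro INF_lower) simp
      also have "\<dots> \<le> emeasure \<mu> B + ennreal e"
        using U \<open>0 < e\<close> by (simp add: emeasure_eq_measure flip: ennreal_plus)
      finally show "(INF U\<in>{U. open U \<and> B \<subseteq> U}. emeasure \<mu> U) \<le> emeasure \<mu> B + ennreal e" .
    qed
  qed
  show "emeasure \<mu> B = (SUP C\<in>{C. compact C \<and> C \<subseteq> B}. emeasure \<mu> C)"
  proof (rule antisym)
    show "(SUP C\<in>{C. compact C \<and> C \<subseteq> B}. emeasure \<mu> C) \<le> emeasure \<mu> B"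
      by (rule SUP_least) (use B in \<open>auto intro!: emeasure_mono simp: sets\<close>)
    show "emeasure \<mu> B \<le> (SUP C\<in>{C. compact C \<and> C \<subseteq> B}. emeasure \<mu> C)"
    proof (rule ennreal_le_epsilon)
      fix e :: real assume "0 < e"
      have B': "- B \<in> sets borel" using B by (metis Compl_eq_Diff_UNIV sets.compl_sets space_borel)
      obtain U where U: "open U" "- B \<subseteq> U" "measure \<mu> U < measure \<mu> (- B) + e"
        using outer[OF B' \<open>0 < e\<close>] by blast
      have C: "compact (- U)" using compact_Int_closed[OF cpt, of "- U"] U(1) by (simp add: closed_def)
      have "measure \<mu> (- B) = 1 - measure \<mu> B" "measure \<mu> (- U) = 1 - measure \<mu> U"
        using prob_compl[of B] prob_compl[of U] B U(1) by (auto simp: sp sets Compl_eq_Diff_UNIV)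
      then have "emeasure \<mu> B \<le> emeasure \<mu> (- U) + ennreal e"
        using U(3) \<open>0 < e\<close> by (simp add: emeasure_eq_measure flip: ennreal_plus)
      also have "emeasure \<mu> (- U) \<le> (SUP C\<in>{C. compact C \<and> C \<subseteq> B}. emeasure \<mu> C)"
        using C U by (intro SUP_upper) auto
      finally show "emeasure \<mu> B \<le> (SUP C\<in>{C. compact C \<and> C \<subseteq> B}. emeasure \<mu> C) + ennreal e"
        by (simp add: add_right_mono)
    qed
  qed
qed

lemma re_CK_fun: "apply_bcontfun (re_CK f) = (\<lambda>x. complex_of_real (Re (f x)))"
  by (rule ext) simp

lemma abs_CK_fun: "apply_bcontfun (abs_CK f) = (\<lambda>x. complex_of_real (cmod (f x)))"
  by (rule ext) simp

lemma state_eqI: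
  fixes \<psi> \<phi> :: "'k::topological_space CK \<Rightarrow> complex"
  assumes "\<psi> \<in> states" "\<phi> \<in> states" "\<And>f. Re (\<psi> (re_CK f)) = Re (\<phi> (re_CK f))"
  shows "\<psi> = \<phi>"
proof
  fix f
  have *: "Re (\<psi> f) = Re (\<phi> f)" for f
    using assms(3)[of f] state_Re[OF assms(1), of f] state_Re[OF assms(2), of f] by simp
  show "\<psi> f = \<phi> f"
    using *[of f] *[of "cscale \<i> f"] by (simp add: complex_eq_iff state_cscale assms(1,2))
qed

context
  assumes compact_K: "compact (UNIV :: 'k::t2_space set)"
begin

lemma Bcontfun_apply:
  fixes f :: "'k \<Rightarrow> complex"
  assumes "continuous_on UNIV f"
  shows "apply_bcontfun (Bcontfun f) = f"
proof -
  have "bounded (range f)" using compact_continuous_image[OF assms compact_K] by (rule compact_imp_bounded)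
  then show ?thesis using assms by (intro Bcontfun_inverse) (simp add: bcontfun_def)
qed

lemma Bcontfun_real_apply:
  fixes f :: "'k \<Rightarrow> real"
  assumes "continuous_on UNIV f"
  shows "apply_bcontfun (Bcontfun (\<lambda>x. complex_of_real (f x))) x = of_real (f x)"
  by (subst Bcontfun_apply) (auto intro!: continuous_intros assms)

text \<open>The real construction is applied to the real part of \<open>\<psi>\<close> on real
  continuous functions; by \<open>state_eqI\<close> these values determine the state.\<close>

theorem Riesz_representation:
  fixes \<psi> :: "'k CK \<Rightarrow> complex"
  assumes \<psi>: "\<psi> \<in> states"
  obtains \<mu> where "regular_prob \<mu>" "blinfun_apply (functional \<mu>) = \<psi>"
proof -
  define b where "b r = Bcontfun (\<lambda>x :: 'k. complex_of_real (r x))" for r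
  have b: "apply_bcontfun (b r) x = of_real (r x)" if "continuous_on UNIV r" for r x
    using Bcontfun_real_apply[OF that] by (simp add: b_def)
  interpret state_functional "\<lambda>r. Re (\<psi> (b r))"
  proof
    fix f g :: "'k \<Rightarrow> real" and c :: real
    assume f: "continuous_on UNIV f"
    show "Re (\<psi> (b (\<lambda>x. c * f x))) = c * Re (\<psi> (b f))"
    proof -
      have "b (\<lambda>x. c * f x) = cscale (of_real c) (b f)"
        using f by (intro bcontfun_eqI) (simp add: b continuous_intros)
      then show ?thesis by (simp add: state_cscale[OF \<psi>])
    qed
    show "0 \<le> Re (\<psi> (b f))" if "\<And>x. 0 \<le> f x"
      using that f by (intro state_nonneg[OF \<psi>]) (simp add: nonneg_valued_def b)
    assume g: "continuous_on UNIV g"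
    have "b (\<lambda>x. f x + g x) = b f + b g"
      using f g by (intro bcontfun_eqI) (simp add: b continuous_intros)
    then show "Re (\<psi> (b (\<lambda>x. f x + g x))) = Re (\<psi> (b f)) + Re (\<psi> (b g))"
      by (simp add: state_add[OF \<psi>])
  next
    have "b (\<lambda>_. 1) = const_bcontfun 1" by (intro bcontfun_eqI) (simp add: b)
    then show "Re (\<psi> (b (\<lambda>_. 1))) = 1" by (simp add: state_one[OF \<psi>])
  qed (rule compact_K)
  have reg: "regular_prob riesz_measure"
    by (rule regular_probI[OF compact_K sets_riesz_measure prob_space_riesz]) (metis riesz_outer_regular)
  interpret M: regular_probability riesz_measure by unfold_locales (rule compact_K reg)+
  have "blinfun_apply (functional riesz_measure) = \<psi>"
  proof (rule state_eqI[OF M.functional_state \<psi>])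
    fix f :: "'k CK"
    have c: "continuous_on UNIV (\<lambda>x. Re (f x))" by (intro continuous_intros) simp
    have "re_CK f = b (\<lambda>x. Re (f x))" by (rule bcontfun_eqI) (simp add: b[OF c])
    then have "Re (\<psi> (re_CK f)) = (\<integral>x. Re (f x) \<partial>riesz_measure)" using integral_riesz[OF c] by simp
    also have "\<dots> = Re (functional riesz_measure (re_CK f))"
      by (simp add: M.functional_eq re_CK_fun)
    finally show "Re (functional riesz_measure (re_CK f)) = Re (\<psi> (re_CK f))" by simp
  qed
  with reg show thesis by (rule that)
qed

text \<open>A Urysohn function between a compact set nearly filling \<open>B\<close> for
  \<open>\<nu>\<close> and an open set barely exceeding \<open>B\<close> for \<open>\<mu>\<close>
  compares the two measures of \<open>B\<close>; then the roles are exchanged.\<close>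

lemma functional_inject:
  fixes \<mu> \<nu> :: "'k measure"
  assumes \<mu>: "regular_prob \<mu>" and \<nu>: "regular_prob \<nu>" and eq: "functional \<mu> = functional \<nu>"
  shows "\<mu> = \<nu>"
proof -
  have le: "measure \<nu> B \<le> measure \<mu> B"
    if \<mu>: "regular_prob \<mu>" and \<nu>: "regular_prob \<nu>" and eq: "functional \<mu> = functional \<nu>"
      and B: "B \<in> sets borel" for \<mu> \<nu> :: "'k measure" and B
  proof (rule field_le_epsilon)
    interpret M: regular_probability \<mu> by unfold_locales (rule compact_K \<mu>)+
    interpret N: regular_probability \<nu> by unfold_locales (rule compact_K \<nu>)+
    fix e :: real assume "0 < e"
    then have e: "e / 2 > 0" by simp
    obtain U where U: "B \<subseteq> U" "open U" "measure \<mu> U < measure \<mu> B + e / 2"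
      using M.regular_approx[OF B e] by metis
    obtain C where C: "compact C" "C \<subseteq> B" "measure \<nu> B < measure \<nu> C + e / 2"
      using N.regular_approx[OF B e] by metis
    obtain f where f: "continuous_on UNIV f" "\<And>x. (0::real) \<le> f x" "\<And>x. f x \<le> 1"
      "\<And>x. x \<in> - U \<Longrightarrow> f x = 0" "\<And>x. x \<in> C \<Longrightarrow> f x = 1"
      using Urysohn_compact[OF compact_K, of "- U" C] U C compact_imp_closed[OF C(1)] by auto
    let ?F = "Bcontfun (\<lambda>x. complex_of_real (f x))"
    have meq: "functional \<mu> ?F = functional \<nu> ?F" by (simp add: eq)
    have "(\<integral>x. f x \<partial>\<mu>) = (\<integral>x. f x \<partial>\<nu>)"
      using meq by (simp add: M.functional_eq N.functional_eq ext[OF Bcontfun_real_apply[OF f(1)]])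
    have "measure \<nu> C = (\<integral>x. indicator C x \<partial>\<nu>)" by (simp add: N.space_eq)
    also have "\<dots> \<le> (\<integral>x. f x \<partial>\<nu>)"
    proof (rule integral_mono)
      show "integrable \<nu> (indicator C :: _ \<Rightarrow> real)"
        using C(1) by (intro integrable_real_indicator) (auto simp: N.sets_eq N.emeasure_eq_measure compact_imp_closed)
      show "integrable \<nu> f"
        using f(2,3) by (intro N.integrable_const_bound[where B = 1] N.measurable_cont f(1)) auto
    qed (use f in \<open>auto simp: indicator_def\<close>)
    also have "\<dots> = (\<integral>x. f x \<partial>\<mu>)" using \<open>_ = (\<integral>x. f x \<partial>\<nu>)\<close> by simp
    also have "\<dots> \<le> (\<integral>x. indicator U x \<partial>\<mu>)"
    proof (rule integral_mono)
      show "integrable \<mu> (indicator U :: _ \<Rightarrow> real)"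
        using U(2) by (intro integrable_real_indicator) (auto simp: M.sets_eq M.emeasure_eq_measure)
      show "integrable \<mu> f"
        using f(2,3) by (intro M.integrable_const_bound[where B = 1] M.measurable_cont f(1)) auto
    qed (use f in \<open>auto simp: indicator_def\<close>)
    also have "\<dots> = measure \<mu> U" by (simp add: M.space_eq)
    finally show "measure \<nu> B \<le> measure \<mu> B + e" using U C by simp
  qed
  interpret M: regular_probability \<mu> by unfold_locales (rule compact_K \<mu>)+
  interpret N: regular_probability \<nu> by unfold_locales (rule compact_K \<nu>)+
  show ?thesis
  proof (rule measure_eqI)
    show "sets \<mu> = sets \<nu>" by (simp add: M.sets_eq N.sets_eq)
    show "emeasure \<mu> B = emeasure \<nu> B" if "B \<in> sets \<mu>" for B
      using le[OF \<mu> \<nu> eq, of B] le[OF \<nu> \<mu> eq[symmetric], of B] that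
      by (simp add: M.sets_eq M.emeasure_eq_measure N.emeasure_eq_measure)
  qed
qed

end

text \<open>A subsequence is Cauchy almost everywhere, and Fatou's lemma along it bounds the
  distance from every late \<open>f n\<close> to its limit.\<close>

lemma L1_complete:
  fixes f :: "nat \<Rightarrow> 'a \<Rightarrow> real"
  assumes int: "\<And>n. integrable M (f n)"
    and cauchy: "\<And>e. 0 < e \<Longrightarrow> \<exists>N. \<forall>i\<ge>N. \<forall>j\<ge>N. (\<integral>x. \<bar>f i x - f j x\<bar> \<partial>M) < e"
  obtains h where "integrable M h" "(\<lambda>n. \<integral>x. \<bar>f n x - h x\<bar> \<partial>M) \<longlonglongrightarrow> 0"
proof -
  have [measurable]: "f n \<in> borel_measurable M" for n using int by auto
  obtain r where r: "strict_mono r" "AE x in M. Cauchy (\<lambda>i. f (r i) x)"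
    using cauchy_L1_AE_cauchy_subseq[of M f] int cauchy by auto
  define h where "h x = lim (\<lambda>i. f (r i) x)" for x
  have hm [measurable]: "h \<in> borel_measurable M" unfolding h_def by measurable
  have AE: "AE x in M. (\<lambda>i. f (r i) x) \<longlonglongrightarrow> h x"
    using r(2) by eventually_elim (simp add: h_def Cauchy_convergent_iff convergent_LIMSEQ_iff)
  have bound: "(\<integral>\<^sup>+x. ennreal \<bar>f n x - h x\<bar> \<partial>M) \<le> ennreal e"
    if N: "\<And>i j. i \<ge> N \<Longrightarrow> j \<ge> N \<Longrightarrow> (\<integral>x. \<bar>f i x - f j x\<bar> \<partial>M) < e" and "n \<ge> N" for N n e
  proof -
    have "(\<integral>\<^sup>+x. ennreal \<bar>f n x - h x\<bar> \<partial>M) = (\<integral>\<^sup>+x. liminf (\<lambda>i. ennreal \<bar>f n x - f (r i) x\<bar>) \<partial>M)"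
    proof (rule nn_integral_cong_AE, use AE in eventually_elim)
      fix x assume "(\<lambda>i. f (r i) x) \<longlonglongrightarrow> h x"
      then have "(\<lambda>i. ennreal \<bar>f n x - f (r i) x\<bar>) \<longlonglongrightarrow> ennreal \<bar>f n x - h x\<bar>"
        by (intro tendsto_intros)
      then show "ennreal \<bar>f n x - h x\<bar> = liminf (\<lambda>i. ennreal \<bar>f n x - f (r i) x\<bar>)"
        by (metis lim_imp_Liminf trivial_limit_sequentially)
    qed
    also have "\<dots> \<le> liminf (\<lambda>i. \<integral>\<^sup>+x. ennreal \<bar>f n x - f (r i) x\<bar> \<partial>M)"
      by (rule nn_integral_liminf) measurable
    also have "\<dots> \<le> ennreal e"
    proof (rule Liminf_le)
      have "eventually (\<lambda>i. N \<le> i) sequentially" by (rule eventually_ge_at_top)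
      then show "\<forall>\<^sub>F i in sequentially. (\<integral>\<^sup>+x. ennreal \<bar>f n x - f (r i) x\<bar> \<partial>M) \<le> ennreal e"
      proof eventually_elim
        case (elim i)
        have "(\<integral>\<^sup>+x. ennreal \<bar>f n x - f (r i) x\<bar> \<partial>M) = ennreal (\<integral>x. \<bar>f n x - f (r i) x\<bar> \<partial>M)"
          using int by (intro nn_integral_eq_integral) auto
        also have "\<dots> \<le> ennreal e"
          using N[OF \<open>n \<ge> N\<close>, of "r i"] order_trans[OF elim strict_mono_imp_increasing[OF r(1), of i]]
          by (simp add: ennreal_leI less_imp_le)
        finally show ?case .
      qed
    qed simp
    finally show ?thesis .
  qed
  obtain N0 where N0: "\<And>i j. i \<ge> N0 \<Longrightarrow> j \<ge> N0 \<Longrightarrow> (\<integral>x. \<bar>f i x - f j x\<bar> \<partial>M) < 1"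
    using cauchy[of 1] by auto
  have "integrable M (\<lambda>x. f N0 x - h x)"
    using le_less_trans[OF bound[OF N0, of N0] ennreal_less_top] by (intro integrableI_bounded) auto
  from Bochner_Integration.integrable_diff[OF int[of N0] this] have hint: "integrable M h" by simp
  have "(\<lambda>n. \<integral>x. \<bar>f n x - h x\<bar> \<partial>M) \<longlonglongrightarrow> 0"
  proof (rule LIMSEQ_I)
    fix e :: real assume "0 < e"
    then have "0 < e / 2" by simp
    then obtain N where N: "\<And>i j. i \<ge> N \<Longrightarrow> j \<ge> N \<Longrightarrow> (\<integral>x. \<bar>f i x - f j x\<bar> \<partial>M) < e / 2"
      using cauchy by blast
    have "norm ((\<integral>x. \<bar>f n x - h x\<bar> \<partial>M) - 0) < e" if "n \<ge> N" for n
    proof -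
      have "ennreal (\<integral>x. \<bar>f n x - h x\<bar> \<partial>M) = (\<integral>\<^sup>+x. ennreal \<bar>f n x - h x\<bar> \<partial>M)"
        using int hint by (intro nn_integral_eq_integral[symmetric]) auto
      also have "\<dots> \<le> ennreal (e / 2)" using bound[OF N that] .
      finally have "(\<integral>x. \<bar>f n x - h x\<bar> \<partial>M) \<le> e / 2" using \<open>0 < e\<close> by (subst (asm) ennreal_le_iff) auto
      moreover have "0 \<le> (\<integral>x. \<bar>f n x - h x\<bar> \<partial>M)" by simp
      ultimately show ?thesis using \<open>0 < e\<close> by simp
    qed
    then show "\<exists>no. \<forall>n\<ge>no. norm ((\<integral>x. \<bar>f n x - h x\<bar> \<partial>M) - 0) < e" by blast
  qed
  with hint show thesis by (rule that)
qed


section \<open>Ergodic measures are the extreme invariant measures\<close>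

context markov_semigroup
begin

lemma functional_inv_state:
  assumes "\<mu> \<in> inv_prob \<S>"
  shows "blinfun_apply (functional \<mu>) \<in> inv_states"
proof -
  have reg: "regular_prob \<mu>" and inv: "\<And>S. S \<in> \<S> \<Longrightarrow> functional \<mu> o\<^sub>L S = functional \<mu>"
    using assms by (auto simp: inv_prob_def)
  interpret regular_probability \<mu> by unfold_locales (rule compact_K reg)+
  have "functional \<mu> (S f) = functional \<mu> f" if "S \<in> \<S>" for S f
    using inv[OF that] by (metis blinfun_apply_blinfun_compose)
  then show ?thesis using functional_state by (simp add: inv_states_def)
qed

lemma inv_state_measure:
  assumes "\<psi> \<in> inv_states"
  obtains \<mu> where "\<mu> \<in> inv_prob \<S>" "blinfun_apply (functional \<mu>) = \<psi>"
proof -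
  obtain \<mu> where \<mu>: "regular_prob \<mu>" "blinfun_apply (functional \<mu>) = \<psi>"
    using Riesz_representation[OF compact_K inv_state_state[OF assms]] by metis
  have "functional \<mu> o\<^sub>L S = functional \<mu>" if "S \<in> \<S>" for S
    by (rule blinfun_eqI) (simp add: \<mu>(2) inv_state_inv[OF assms that])
  then have "\<mu> \<in> inv_prob \<S>" using \<mu>(1) by (simp add: inv_prob_def)
  then show thesis using \<mu>(2) by (rule that)
qed

lemma inv_prob_inject:
  assumes "\<mu> \<in> inv_prob \<S>" "\<nu> \<in> inv_prob \<S>"
    "blinfun_apply (functional \<mu>) = blinfun_apply (functional \<nu>)"
  shows "\<mu> = \<nu>"
  using assms by (intro functional_inject[OF compact_K]) (auto simp: inv_prob_def blinfun_apply_inject)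

text \<open>By the Riesz theorem, splitting the state into invariant states is the same as splitting
  the functional into functionals of invariant measures. Equal end points are treated apart, because
  their \<open>open_segment\<close> is empty.\<close>

lemma ex_inv_prob_iff:
  assumes \<mu>: "\<mu> \<in> inv_prob \<S>"
  shows "\<mu> \<in> ex_inv_prob \<S> \<longleftrightarrow> face_of_funs {blinfun_apply (functional \<mu>)} inv_states"
    (is "_ \<longleftrightarrow> face_of_funs {?\<phi>} _")
proof
  assume "\<mu> \<in> ex_inv_prob \<S>"
  then have ext: "functional \<mu> \<notin> open_segment a b"
    if "a \<in> functional ` inv_prob \<S>" "b \<in> functional ` inv_prob \<S>" for a b
    using that unfolding ex_inv_prob_def extreme_point_of_def mem_Collect_eq by blast
  show "face_of_funs {?\<phi>} inv_states"
  proof (rule face_of_funsI)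
    show "{?\<phi>} \<subseteq> inv_states" using functional_inv_state[OF \<mu>] by simp
    fix a b t assume a: "a \<in> inv_states" and b: "b \<in> inv_states" and t: "0 < t" "t < (1::real)"
      and "(\<lambda>f. of_real t * a f + of_real (1 - t) * b f) \<in> {?\<phi>}"
    then have eq: "?\<phi> f = of_real t * a f + of_real (1 - t) * b f" for f
      using fun_cong[of "\<lambda>f. of_real t * a f + of_real (1 - t) * b f" ?\<phi> f] by simp
    obtain \<alpha> where \<alpha>: "\<alpha> \<in> inv_prob \<S>" "blinfun_apply (functional \<alpha>) = a"
      using inv_state_measure[OF a] by blast
    obtain \<beta> where \<beta>: "\<beta> \<in> inv_prob \<S>" "blinfun_apply (functional \<beta>) = b"
      using inv_state_measure[OF b] by blast
    have seg: "functional \<mu> = (1 - t) *\<^sub>R functional \<beta> + t *\<^sub>R functional \<alpha>"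
      by (rule blinfun_eqI)
        (simp add: eq \<alpha>(2) \<beta>(2) blinfun.add_left blinfun.scaleR_left scaleR_conv_of_real)
    have "functional \<alpha> = functional \<beta>"
    proof (rule ccontr)
      assume "functional \<alpha> \<noteq> functional \<beta>"
      then have "functional \<mu> \<in> open_segment (functional \<beta>) (functional \<alpha>)"
        using seg t unfolding in_segment by metis
      then show False using ext \<alpha>(1) \<beta>(1) by blast
    qed
    then have "a = b" using \<alpha>(2) \<beta>(2) by simp
    have "?\<phi> f = a f" for f using eq[of f] \<open>a = b\<close> by (simp add: algebra_simps)
    then have "?\<phi> = a" by (simp add: fun_eq_iff)
    then show "a \<in> {?\<phi>} \<and> b \<in> {?\<phi>}" using \<open>a = b\<close> by simp
  qed
next
  assume face: "face_of_funs {?\<phi>} inv_states"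
  have "functional \<mu> \<notin> open_segment a b"
    if a: "a \<in> functional ` inv_prob \<S>" and b: "b \<in> functional ` inv_prob \<S>" for a b
  proof
    assume "functional \<mu> \<in> open_segment a b"
    then obtain t where t: "a \<noteq> b" "0 < t" "t < 1" "functional \<mu> = (1 - t) *\<^sub>R a + t *\<^sub>R b"
      unfolding in_segment by metis
    have "(\<lambda>f. of_real t * blinfun_apply b f + of_real (1 - t) * blinfun_apply a f) \<in> {?\<phi>}"
      using t(4) by (auto simp: blinfun.add_left blinfun.scaleR_left scaleR_conv_of_real)
    moreover have "blinfun_apply a \<in> inv_states" "blinfun_apply b \<in> inv_states"
      using a b functional_inv_state by auto
    ultimately have "blinfun_apply b \<in> {?\<phi>}" "blinfun_apply a \<in> {?\<phi>}"
      using face_of_funsD[OF face _ _ t(2,3)] by blast+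
    then show False using t(1) by (simp add: blinfun_apply_inject)
  qed
  then show "\<mu> \<in> ex_inv_prob \<S>" using \<mu> by (simp add: ex_inv_prob_def extreme_point_of_def)
qed

end

definition sq_CK :: "'k::topological_space CK \<Rightarrow> 'k CK" where
  "sq_CK f = Bcontfun (\<lambda>x. of_real ((Re (f x))\<^sup>2))"

lemma sq_CK_apply [simp]: "apply_bcontfun (sq_CK f) x = of_real ((Re (f x))\<^sup>2)"
proof -
  have "cmod (complex_of_real ((Re (f x))\<^sup>2)) \<le> (norm f)\<^sup>2" for x
    using order_trans[OF abs_Re_le_cmod norm_bounded[of f x]] power_mono[of "\<bar>Re (f x)\<bar>" "norm f" 2]
    by (simp add: norm_power)
  then have "(\<lambda>x. complex_of_real ((Re (f x))\<^sup>2)) \<in> bcontfun"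
    by (intro bcontfun_normI[where b = "(norm f)\<^sup>2"]) (auto intro!: continuous_intros)
  then show ?thesis by (simp add: sq_CK_def Bcontfun_inverse)
qed

lemma sq_CK_fun: "apply_bcontfun (sq_CK f) = (\<lambda>x. complex_of_real ((Re (f x))\<^sup>2))"
  by (rule ext) simp

text \<open>The variance, the value of the state at \<open>(f - a)^2\<close> with
  \<open>a = Re (\<psi> f)\<close>, is nonnegative.\<close>

lemma state_sq:
  assumes \<psi>: "\<psi> \<in> states" and f: "real_valued f"
  shows "(Re (\<psi> f))\<^sup>2 \<le> Re (\<psi> (sq_CK f))"
proof -
  define a where "a = Re (\<psi> f)"
  have "sq_CK (f - const_bcontfun (of_real a))
      = sq_CK f - cscale (of_real (2 * a)) f + const_bcontfun (of_real (a\<^sup>2))"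
    using f by (intro bcontfun_eqI) (simp add: complex_eq_iff real_valued_def power2_eq_square algebra_simps)
  then have "Re (\<psi> (sq_CK (f - const_bcontfun (of_real a)))) = Re (\<psi> (sq_CK f)) - 2 * a * a + a\<^sup>2"
    by (simp add: state_add[OF \<psi>] state_diff[OF \<psi>] state_cscale[OF \<psi>] state_const[OF \<psi>] a_def)
  moreover have "0 \<le> Re (\<psi> (sq_CK (f - const_bcontfun (of_real a))))"
    by (rule state_nonneg[OF \<psi>]) (simp add: nonneg_valued_def)
  ultimately show ?thesis by (simp add: a_def power2_eq_square)
qed

lemma null_comparison:
  assumes "b \<longlonglongrightarrow> (0::real)" "\<And>n. 0 \<le> a n" "\<And>n. a n \<le> b n"
  shows "a \<longlonglongrightarrow> 0"
  by (rule tendsto_sandwich[OF _ _ tendsto_const assms(1)]) (use assms(2,3) in auto)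

lemma linear_le_quadratic_imp_zero:
  fixes a b :: real
  assumes "\<And>t. t * a \<le> t\<^sup>2 * b"
  shows "a = 0"
proof (rule ccontr)
  assume a: "a \<noteq> 0"
  \<comment> \<open>Positive and larger than \<open>b\<close>, so that \<open>t = a / s\<close>
    violates the bound when \<open>a\<close> is nonzero.\<close>
  define s where "s = \<bar>b\<bar> + 1"
  have s: "s > 0" by (simp add: s_def)
  have "a / s * a \<le> (a / s)\<^sup>2 * b" by (rule assms)
  then have "a\<^sup>2 * s \<le> a\<^sup>2 * b" using s by (simp add: power2_eq_square field_simps)
  then have "s \<le> b" using a by simp
  then show False by (simp add: s_def)
qed

section \<open>Fixed vectors of the operators induced on L^1\<close>

locale invariant_measure = markov_semigroup \<S> for \<S> :: "'k::t2_space CK_op set" +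
  fixes \<mu> :: "'k measure"
  assumes invariant: "\<mu> \<in> inv_prob \<S>"
begin

sublocale regular_probability \<mu>
  using compact_K invariant by unfold_locales (auto simp: inv_prob_def)

abbreviation \<phi>\<^sub>\<mu> :: "'k CK \<Rightarrow> complex" where "\<phi>\<^sub>\<mu> \<equiv> blinfun_apply (functional \<mu>)"

lemma \<phi>_inv: "\<phi>\<^sub>\<mu> \<in> inv_states" by (rule functional_inv_state) (rule invariant)

lemma integral_inv: "S \<in> \<S> \<Longrightarrow> (\<integral>x. S f x \<partial>\<mu>) = (\<integral>x. f x \<partial>\<mu>)" for f :: "'k CK"
  using inv_state_inv[OF \<phi>_inv, of S f] by (simp add: functional_eq)

lemma integral_Re_inv: "S \<in> \<S> \<Longrightarrow> (\<integral>x. Re (S f x) \<partial>\<mu>) = (\<integral>x. Re (f x) \<partial>\<mu>)" for f :: "'k CK"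
  using integral_inv[of S f] by (simp add: integral_Re)

text \<open>A witness for \<open>L1_extension S \<mu> h h\<close>: one sequence that, like its image
  under \<open>S\<close>, tends to \<open>h\<close>.\<close>

definition approx :: "'k CK_op \<Rightarrow> (nat \<Rightarrow> 'k CK) \<Rightarrow> ('k \<Rightarrow> complex) \<Rightarrow> bool" where
  "approx S f h \<longleftrightarrow> integrable \<mu> h \<and>
     (\<lambda>n. \<integral>x. cmod (apply_bcontfun (f n) x - h x) \<partial>\<mu>) \<longlonglongrightarrow> 0 \<and>
     (\<lambda>n. \<integral>x. cmod (apply_bcontfun (S (f n)) x - h x) \<partial>\<mu>) \<longlonglongrightarrow> 0"

lemma L1_fix_iff: "h \<in> L1_fix \<S> \<mu> \<longleftrightarrow> (\<forall>S\<in>\<S>. \<exists>f. approx S f h)"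
  using nonempty unfolding L1_fix_def L1_extension_def approx_def by auto

lemma approxI:
  fixes S :: "'k CK_op"
  assumes "integrable \<mu> h" "a \<longlonglongrightarrow> 0" "b \<longlonglongrightarrow> 0"
    "\<And>n. (\<integral>x. cmod (apply_bcontfun (f n) x - h x) \<partial>\<mu>) \<le> a n"
    "\<And>n. (\<integral>x. cmod (apply_bcontfun (S (f n)) x - h x) \<partial>\<mu>) \<le> b n"
  shows "approx S f h"
proof -
  have "(\<lambda>n. \<integral>x. cmod (apply_bcontfun (f n) x - h x) \<partial>\<mu>) \<longlonglongrightarrow> 0"
    by (rule null_comparison[OF assms(2) _ assms(4)]) simp
  moreover have "(\<lambda>n. \<integral>x. cmod (apply_bcontfun (S (f n)) x - h x) \<partial>\<mu>) \<longlonglongrightarrow> 0"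
    by (rule null_comparison[OF assms(3) _ assms(5)]) simp
  ultimately show ?thesis using assms(1) by (simp add: approx_def)
qed

lemma approxD:
  assumes "approx S f h"
  shows "integrable \<mu> h" "(\<lambda>n. \<integral>x. cmod (apply_bcontfun (f n) x - h x) \<partial>\<mu>) \<longlonglongrightarrow> 0"
    "(\<lambda>n. \<integral>x. cmod (apply_bcontfun (S (f n)) x - h x) \<partial>\<mu>) \<longlonglongrightarrow> 0"
  using assms by (auto simp: approx_def)

lemma approx_const: "S \<in> \<S> \<Longrightarrow> approx S (\<lambda>_. const_bcontfun c) (\<lambda>_. c)"
  by (simp add: approx_def markov_const[OF markov])

lemma approx_add:
  assumes f: "approx S f h" and g: "approx S g k"
  shows "approx S (\<lambda>n. f n + g n) (\<lambda>x. h x + k x)"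
proof (rule approxI[OF _ tendsto_add_zero[OF approxD(2)[OF f] approxD(2)[OF g]]
      tendsto_add_zero[OF approxD(3)[OF f] approxD(3)[OF g]]])
  note int = approxD(1)[OF f] approxD(1)[OF g]
  show "integrable \<mu> (\<lambda>x. h x + k x)" using int by simp
  have *: "(\<integral>x. cmod ((u + v) x - (h x + k x)) \<partial>\<mu>)
      \<le> (\<integral>x. cmod (u x - h x) \<partial>\<mu>) + (\<integral>x. cmod (v x - k x) \<partial>\<mu>)" for u v :: "'k CK"
  proof -
    have "(\<integral>x. cmod ((u + v) x - (h x + k x)) \<partial>\<mu>) \<le> (\<integral>x. cmod (u x - h x) + cmod (v x - k x) \<partial>\<mu>)"
      using int by (intro integral_mono) (auto intro: norm_diff_triangle_ineq)
    then show ?thesis using int by simp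
  qed
  show "(\<integral>x. cmod ((f n + g n) x - (h x + k x)) \<partial>\<mu>)
      \<le> (\<integral>x. cmod (f n x - h x) \<partial>\<mu>) + (\<integral>x. cmod (g n x - k x) \<partial>\<mu>)" for n
    by (rule *)
  show "(\<integral>x. cmod (S (f n + g n) x - (h x + k x)) \<partial>\<mu>)
      \<le> (\<integral>x. cmod (S (f n) x - h x) \<partial>\<mu>) + (\<integral>x. cmod (S (g n) x - k x) \<partial>\<mu>)" for n
    using * by (simp only: blinfun.add_right)
qed

lemma approx_scale:
  assumes S: "S \<in> \<S>" and f: "approx S f h"
  shows "approx S (\<lambda>n. cscale c (f n)) (\<lambda>x. c * h x)"
proof (rule approxI[OF _ tendsto_mult_right_zero[OF approxD(2)[OF f], of "cmod c"]
      tendsto_mult_right_zero[OF approxD(3)[OF f], of "cmod c"]])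
  show "integrable \<mu> (\<lambda>x. c * h x)" using approxD(1)[OF f] by simp
  have *: "(\<integral>x. cmod (cscale c u x - c * h x) \<partial>\<mu>) = cmod c * (\<integral>x. cmod (u x - h x) \<partial>\<mu>)" for u :: "'k CK"
    by (simp add: norm_mult flip: right_diff_distrib)
  show "(\<integral>x. cmod (cscale c (f n) x - c * h x) \<partial>\<mu>) \<le> cmod c * (\<integral>x. cmod (f n x - h x) \<partial>\<mu>)" for n
    using * by simp
  show "(\<integral>x. cmod (S (cscale c (f n)) x - c * h x) \<partial>\<mu>) \<le> cmod c * (\<integral>x. cmod (S (f n) x - h x) \<partial>\<mu>)" for n
    using * by (simp only: markov_cscale[OF markov[OF S]])
qed

lemma approx_diff:
  assumes S: "S \<in> \<S>" and f: "approx S f h" and g: "approx S g k"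
  shows "approx S (\<lambda>n. f n - g n) (\<lambda>x. h x - k x)"
  using approx_add[OF f approx_scale[OF S g, of "- 1"]] by (simp add: cscale_minus_one)

lemma approx_Re:
  assumes S: "S \<in> \<S>" and f: "approx S f h"
  shows "approx S (\<lambda>n. re_CK (f n)) (\<lambda>x. of_real (Re (h x)))"
proof (rule approxI[OF _ approxD(2,3)[OF f]])
  show "integrable \<mu> (\<lambda>x. complex_of_real (Re (h x)))" using approxD(1)[OF f] by simp
  have *: "(\<integral>x. cmod (re_CK u x - of_real (Re (h x))) \<partial>\<mu>) \<le> (\<integral>x. cmod (u x - h x) \<partial>\<mu>)" for u :: "'k CK"
  proof (rule integral_mono)
    show "cmod (re_CK u x - of_real (Re (h x))) \<le> cmod (u x - h x)" for x
      using abs_Re_le_cmod[of "u x - h x"] by (simp flip: of_real_diff)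
  qed (use approxD(1)[OF f] in auto)
  show "(\<integral>x. cmod (re_CK (f n) x - of_real (Re (h x))) \<partial>\<mu>) \<le> (\<integral>x. cmod (f n x - h x) \<partial>\<mu>)" for n
    by (rule *)
  show "(\<integral>x. cmod (S (re_CK (f n)) x - of_real (Re (h x))) \<partial>\<mu>) \<le> (\<integral>x. cmod (S (f n) x - h x) \<partial>\<mu>)" for n
    using *[of "S (f n)"] by (simp only: markov_re_CK[OF markov[OF S]])
qed

text \<open>The difference \<open>S |f| - |S f|\<close> is nonnegative and its integral \<open>\<integral>|f| - \<integral>|S f|\<close> tends to zero.\<close>

lemma approx_abs:
  assumes S: "S \<in> \<S>" and f: "approx S f h"
  shows "approx S (\<lambda>n. abs_CK (f n)) (\<lambda>x. of_real (cmod (h x)))"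
proof -
  note int = approxD(1)[OF f]
  have *: "(\<integral>x. \<bar>cmod (u x) - cmod (h x)\<bar> \<partial>\<mu>) \<le> (\<integral>x. cmod (u x - h x) \<partial>\<mu>)" for u :: "'k CK"
    using int by (intro integral_mono) (auto intro: norm_triangle_ineq3)
  have int_diff: "\<bar>(\<integral>x. cmod (u x) \<partial>\<mu>) - (\<integral>x. cmod (h x) \<partial>\<mu>)\<bar> \<le> (\<integral>x. cmod (u x - h x) \<partial>\<mu>)" for u :: "'k CK"
  proof -
    have "(\<integral>x. cmod (u x) \<partial>\<mu>) - (\<integral>x. cmod (h x) \<partial>\<mu>) = (\<integral>x. cmod (u x) - cmod (h x) \<partial>\<mu>)" using int by simp
    also have "\<bar>\<dots>\<bar> \<le> (\<integral>x. \<bar>cmod (u x) - cmod (h x)\<bar> \<partial>\<mu>)" by (rule integral_abs_bound)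
    finally show ?thesis using *[of u] by simp
  qed
  have lim: "(\<lambda>n. (\<integral>x. cmod (f n x - h x) \<partial>\<mu>) + ((\<integral>x. cmod (S (f n) x - h x) \<partial>\<mu>) + (\<integral>x. cmod (S (f n) x - h x) \<partial>\<mu>))) \<longlonglongrightarrow> 0"
    using approxD(2,3)[OF f] by (intro tendsto_add_zero)
  show ?thesis
  proof (rule approxI[OF _ approxD(2)[OF f] lim])
    show "integrable \<mu> (\<lambda>x. complex_of_real (cmod (h x)))" using int by simp
    fix n
    show "(\<integral>x. cmod (abs_CK (f n) x - of_real (cmod (h x))) \<partial>\<mu>) \<le> (\<integral>x. cmod (f n x - h x) \<partial>\<mu>)"
      using *[of "f n"] by (simp flip: of_real_diff)
    let ?a = "\<lambda>x. Re (S (abs_CK (f n)) x)" and ?b = "\<lambda>x. cmod (S (f n) x)"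
    have ab: "?b x \<le> ?a x" for x by (rule markov_abs[OF markov[OF S]])
    have Sa: "S (abs_CK (f n)) x = of_real (?a x)" for x
      using markov_real[OF markov[OF S], of "abs_CK (f n)"] nonneg_valued_real[OF nonneg_abs_CK]
      by (simp add: complex_eq_iff real_valued_def)
    have "(\<integral>x. cmod (S (abs_CK (f n)) x - of_real (cmod (h x))) \<partial>\<mu>) = (\<integral>x. \<bar>?a x - cmod (h x)\<bar> \<partial>\<mu>)"
      by (subst Sa) (simp flip: of_real_diff)
    also have "\<dots> \<le> (\<integral>x. (?a x - ?b x) + \<bar>?b x - cmod (h x)\<bar> \<partial>\<mu>)"
    proof (rule integral_mono)
      show "\<bar>?a x - cmod (h x)\<bar> \<le> (?a x - ?b x) + \<bar>?b x - cmod (h x)\<bar>" for x using ab[of x] by linarith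
    qed (use int in auto)
    also have "\<dots> = ((\<integral>x. ?a x \<partial>\<mu>) - (\<integral>x. ?b x \<partial>\<mu>)) + (\<integral>x. \<bar>?b x - cmod (h x)\<bar> \<partial>\<mu>)"
      using int by simp
    also have "(\<integral>x. ?a x \<partial>\<mu>) = (\<integral>x. cmod (f n x) \<partial>\<mu>)"
      using integral_Re_inv[OF S, of "abs_CK (f n)"] by simp
    finally show "(\<integral>x. cmod (S (abs_CK (f n)) x - of_real (cmod (h x))) \<partial>\<mu>)
        \<le> (\<integral>x. cmod (f n x - h x) \<partial>\<mu>) + ((\<integral>x. cmod (S (f n) x - h x) \<partial>\<mu>) + (\<integral>x. cmod (S (f n) x - h x) \<partial>\<mu>))"
      using int_diff[of "f n"] int_diff[of "S (f n)"] *[of "S (f n)"] by linarith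
  qed
qed

text \<open>Truncation to the interval from \<open>0\<close> to \<open>1\<close>, written with
  absolute values so that \<open>approx_abs\<close>, \<open>approx_add\<close> and
  \<open>approx_scale\<close> apply.\<close>

definition unit_clamp :: "real \<Rightarrow> real" where "unit_clamp r = (\<bar>r\<bar> - \<bar>r - 1\<bar> + 1) / 2"

lemma unit_clamp_range: "0 \<le> unit_clamp r" "unit_clamp r \<le> 1" by (auto simp: unit_clamp_def)

text \<open>The approximants are truncated along with \<open>h\<close>, so they stay between
  \<open>0\<close> and \<open>1\<close>; such a uniform bound is what turns L^1 convergence into
  convergence of square integrals.\<close>

lemma approx_clamp:
  assumes S: "S \<in> \<S>" and f: "approx S f h"
  obtains g where "approx S g (\<lambda>x. of_real (unit_clamp (Re (h x))))" "\<And>n. real_valued (g n)"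
    "\<And>n x. 0 \<le> Re (g n x)" "\<And>n x. Re (g n x) \<le> 1"
proof
  let ?g = "\<lambda>n. cscale (1/2) (abs_CK (re_CK (f n)) - abs_CK (re_CK (f n) - const_bcontfun 1) + const_bcontfun 1)"
  have "approx S ?g (\<lambda>x. 1/2 * (of_real (cmod (of_real (Re (h x)))) - of_real (cmod (of_real (Re (h x)) - 1)) + 1))"
    by (intro approx_scale approx_add approx_diff approx_abs approx_Re approx_const S f)
  moreover have "(1/2 * (of_real (cmod (of_real (Re (h x)))) - of_real (cmod (of_real (Re (h x)) - 1)) + 1))
      = complex_of_real (unit_clamp (Re (h x)))" for x
  proof -
    have "cmod (complex_of_real (Re (h x)) - 1) = \<bar>Re (h x) - 1\<bar>"
      using norm_of_real[of "Re (h x) - 1", where 'a = complex] by simp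
    then show ?thesis by (simp add: unit_clamp_def)
  qed
  ultimately show "approx S ?g (\<lambda>x. of_real (unit_clamp (Re (h x))))" by simp
  have g: "?g n x = of_real (unit_clamp (Re (f n x)))" for n x
  proof -
    have "cmod (complex_of_real (Re (f n x)) - 1) = \<bar>Re (f n x) - 1\<bar>"
      using norm_of_real[of "Re (f n x) - 1", where 'a = complex] by simp
    then show ?thesis by (simp add: unit_clamp_def)
  qed
  show "real_valued (?g n)" "0 \<le> Re (?g n x)" "Re (?g n x) \<le> 1" for n x
    unfolding real_valued_def g using unit_clamp_range[of "Re (f n x)"] by auto
qed

text \<open>Factor the difference of squares: \<open>2 + 2 * B\<close> bounds the sum factor, and
  the integral of the difference factor tends to zero.\<close>

lemma integral_square_limit:
  assumes p: "\<And>n x. \<bar>p n x\<bar> \<le> (1::real)" "\<And>n. p n \<in> borel_measurable \<mu>"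
    and u: "\<And>x. \<bar>u x\<bar> \<le> 1" "u \<in> borel_measurable \<mu>"
    and k: "\<And>x. \<bar>k x\<bar> \<le> B" "k \<in> borel_measurable \<mu>"
    and lim: "(\<lambda>n. \<integral>x. \<bar>p n x - u x\<bar> \<partial>\<mu>) \<longlonglongrightarrow> 0"
  shows "(\<lambda>n. \<integral>x. (p n x + k x)\<^sup>2 \<partial>\<mu>) \<longlonglongrightarrow> (\<integral>x. (u x + k x)\<^sup>2 \<partial>\<mu>)"
proof -
  have int: "integrable \<mu> (\<lambda>x. (q x + k x)\<^sup>2)" if "\<And>x. \<bar>q x\<bar> \<le> 1" "q \<in> borel_measurable \<mu>" for q
  proof (rule integrable_const_bound[where B = "(1 + B)\<^sup>2"])
    have "\<bar>q x + k x\<bar> \<le> 1 + B" for x using that(1)[of x] k(1)[of x] by linarith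
    then have "(q x + k x)\<^sup>2 \<le> (1 + B)\<^sup>2" for x
      using order_trans[OF _ abs_ge_self] unfolding abs_le_square_iff[symmetric] by blast
    then show "AE x in \<mu>. norm ((q x + k x)\<^sup>2) \<le> (1 + B)\<^sup>2" by simp
  qed (use that k in measurable)
  have int1: "integrable \<mu> q" if "\<And>x. \<bar>q x\<bar> \<le> 1" "q \<in> borel_measurable \<mu>" for q :: "_ \<Rightarrow> real"
    using that by (intro integrable_const_bound[where B = 1]) auto
  have "(\<lambda>n. \<bar>(\<integral>x. (p n x + k x)\<^sup>2 \<partial>\<mu>) - (\<integral>x. (u x + k x)\<^sup>2 \<partial>\<mu>)\<bar>) \<longlonglongrightarrow> 0"
  proof (rule null_comparison[OF tendsto_mult_right_zero[OF lim, of "2 + 2 * B"]])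
    fix n
    note ints = int[of "p n", OF p] int[of u, OF u]
    have d: "integrable \<mu> (\<lambda>x. (2 + 2 * B) * \<bar>p n x - u x\<bar>)"
      using int1[of "p n", OF p] int1[of u, OF u]
      by (intro integrable_mult_right integrable_abs Bochner_Integration.integrable_diff)
    have "\<bar>(\<integral>x. (p n x + k x)\<^sup>2 \<partial>\<mu>) - (\<integral>x. (u x + k x)\<^sup>2 \<partial>\<mu>)\<bar> = \<bar>\<integral>x. (p n x + k x)\<^sup>2 - (u x + k x)\<^sup>2 \<partial>\<mu>\<bar>"
      using ints by (subst Bochner_Integration.integral_diff) auto
    also have "\<dots> \<le> (\<integral>x. \<bar>(p n x + k x)\<^sup>2 - (u x + k x)\<^sup>2\<bar> \<partial>\<mu>)" by (rule integral_abs_bound)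
    also have "\<dots> \<le> (\<integral>x. (2 + 2 * B) * \<bar>p n x - u x\<bar> \<partial>\<mu>)"
    proof (rule integral_mono[OF _ d])
      show "integrable \<mu> (\<lambda>x. \<bar>(p n x + k x)\<^sup>2 - (u x + k x)\<^sup>2\<bar>)"
        using ints by (intro integrable_abs Bochner_Integration.integrable_diff)
      fix x
      have "\<bar>(p n x + k x)\<^sup>2 - (u x + k x)\<^sup>2\<bar> = \<bar>p n x + u x + 2 * k x\<bar> * \<bar>p n x - u x\<bar>"
        by (simp flip: abs_mult) (simp add: power2_eq_square algebra_simps)
      also have "\<dots> \<le> (2 + 2 * B) * \<bar>p n x - u x\<bar>"
        using p(1)[of n x] u(1)[of x] k(1)[of x] by (intro mult_right_mono) linarith+
      finally show "\<bar>(p n x + k x)\<^sup>2 - (u x + k x)\<^sup>2\<bar> \<le> (2 + 2 * B) * \<bar>p n x - u x\<bar>" .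
    qed
    finally show "\<bar>(\<integral>x. (p n x + k x)\<^sup>2 \<partial>\<mu>) - (\<integral>x. (u x + k x)\<^sup>2 \<partial>\<mu>)\<bar> \<le> (2 + 2 * B) * (\<integral>x. \<bar>p n x - u x\<bar> \<partial>\<mu>)"
      by simp
  qed simp
  then show ?thesis by (rule LIM_zero_cancel[OF tendsto_rabs_zero_cancel])
qed


text \<open>\<open>S\<close> contracts the norm of \<open>L\<^sup>2(\<mu>)\<close>. Comparing \<open>S (u + t f)\<close> with \<open>u + t f\<close> for small \<open>t\<close> of either
  sign shows that a vector fixed by \<open>S\<close> is also fixed by its adjoint.\<close>

lemma fixed_by_adjoint:
  assumes S: "S \<in> \<S>" and g: "approx S g (\<lambda>x. of_real (u x))"
    and g01: "\<And>n. real_valued (g n)" "\<And>n x. 0 \<le> Re (g n x)" "\<And>n x. Re (g n x) \<le> 1"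
    and u: "\<And>x. 0 \<le> u x" "\<And>x. u x \<le> 1" "u \<in> borel_measurable \<mu>"
    and f: "real_valued f"
  shows "(\<integral>x. Re (S f x) * u x \<partial>\<mu>) = (\<integral>x. Re (f x) * u x \<partial>\<mu>)"
proof -
  note mS = markov[OF S]
  have abs_u: "\<bar>u x\<bar> \<le> 1" for x using u(1,2)[of x] by simp
  have Re_le: "\<bar>Re (h x)\<bar> \<le> norm h" for h :: "'k CK" and x
    using abs_Re_le_cmod norm_bounded by (rule order_trans)
  have iu: "integrable \<mu> (\<lambda>x. Re (h x) * u x)" "integrable \<mu> (\<lambda>x. (Re (h x))\<^sup>2)" "integrable \<mu> (\<lambda>x. (u x)\<^sup>2)"
    for h :: "'k CK"
  proof -
    show "integrable \<mu> (\<lambda>x. Re (h x) * u x)"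
      using mult_mono[OF Re_le abs_u] u(3)
      by (intro integrable_const_bound[where B = "norm h * 1"]) (auto simp: abs_mult)
    show "integrable \<mu> (\<lambda>x. (Re (h x))\<^sup>2)"
    proof (rule integrable_const_bound[where B = "(norm h)\<^sup>2"])
      have "(Re (h x))\<^sup>2 \<le> (norm h)\<^sup>2" for x using power_mono[OF Re_le[of h x], of 2] by simp
      then show "AE x in \<mu>. norm ((Re (h x))\<^sup>2) \<le> (norm h)\<^sup>2" by simp
    qed measurable
    show "integrable \<mu> (\<lambda>x. (u x)\<^sup>2)"
      using u by (intro integrable_const_bound[where B = 1]) (auto intro: power_le_one)
  qed
  define p where "p n x = Re (g n x)" for n x
  define q where "q n x = Re (S (g n) x)" for n x
  have p01: "\<bar>p n x\<bar> \<le> 1" for n x using g01(2,3)[of n x] by (simp add: p_def)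
  have q01: "\<bar>q n x\<bar> \<le> 1" for n x
    using state_Re_le[OF markov_state[OF mS], of "g n" 1 x]
      state_nonneg[OF markov_state[OF mS], of "g n" x] g01
    by (simp add: q_def nonneg_valued_def real_valued_def)
  have gu: "complex_of_real (Re (g n x)) = g n x" "complex_of_real (Re (S (g n) x)) = S (g n) x" for n x
    using g01(1)[of n] markov_real[OF mS, of "g n"] by (auto simp: complex_eq_iff real_valued_def)
  have plim: "(\<lambda>n. \<integral>x. \<bar>p n x - u x\<bar> \<partial>\<mu>) \<longlonglongrightarrow> 0"
  proof -
    have "\<bar>p n x - u x\<bar> = cmod (g n x - of_real (u x))" for n x
      using norm_of_real[of "p n x - u x", where 'a = complex] gu(1)[of n x] by (simp add: p_def)
    then show ?thesis using approxD(2)[OF g] by simp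
  qed
  have qlim: "(\<lambda>n. \<integral>x. \<bar>q n x - u x\<bar> \<partial>\<mu>) \<longlonglongrightarrow> 0"
  proof -
    have "\<bar>q n x - u x\<bar> = cmod (S (g n) x - of_real (u x))" for n x
      using norm_of_real[of "q n x - u x", where 'a = complex] gu(2)[of n x] by (simp add: q_def)
    then show ?thesis using approxD(3)[OF g] by simp
  qed
  have expand: "(\<integral>x. (u x + t * Re (h x))\<^sup>2 \<partial>\<mu>)
      = (\<integral>x. (u x)\<^sup>2 \<partial>\<mu>) + 2 * t * (\<integral>x. Re (h x) * u x \<partial>\<mu>) + t\<^sup>2 * (\<integral>x. (Re (h x))\<^sup>2 \<partial>\<mu>)"
    for t and h :: "'k CK"
  proof -
    have "(\<integral>x. (u x + t * Re (h x))\<^sup>2 \<partial>\<mu>)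
        = (\<integral>x. (u x)\<^sup>2 + 2 * t * (Re (h x) * u x) + t\<^sup>2 * (Re (h x))\<^sup>2 \<partial>\<mu>)"
      by (rule Bochner_Integration.integral_cong) (auto simp: power2_eq_square algebra_simps)
    then show ?thesis using iu by simp
  qed
  have key: "(\<integral>x. (u x + t * Re (S f x))\<^sup>2 \<partial>\<mu>) \<le> (\<integral>x. (u x + t * Re (f x))\<^sup>2 \<partial>\<mu>)" for t
  proof (rule LIMSEQ_le)
    have b: "\<bar>t * Re (h x)\<bar> \<le> \<bar>t\<bar> * norm h" for h :: "'k CK" and x
      using Re_le by (simp add: abs_mult mult_left_mono)
    show "(\<lambda>n. \<integral>x. (q n x + t * Re (S f x))\<^sup>2 \<partial>\<mu>) \<longlonglongrightarrow> (\<integral>x. (u x + t * Re (S f x))\<^sup>2 \<partial>\<mu>)"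
      by (rule integral_square_limit[OF q01 _ abs_u u(3) b _ qlim]) (auto simp: q_def)
    show "(\<lambda>n. \<integral>x. (p n x + t * Re (f x))\<^sup>2 \<partial>\<mu>) \<longlonglongrightarrow> (\<integral>x. (u x + t * Re (f x))\<^sup>2 \<partial>\<mu>)"
      by (rule integral_square_limit[OF p01 _ abs_u u(3) b _ plim]) (auto simp: p_def)
    \<comment> \<open>Contraction for the continuous function \<open>h\<close>:
      \<open>(S h)^2 \<le> S (h^2)\<close> pointwise by \<open>state_sq\<close>, and the integral is
      invariant.\<close>
    have "(\<integral>x. (q n x + t * Re (S f x))\<^sup>2 \<partial>\<mu>) \<le> (\<integral>x. (p n x + t * Re (f x))\<^sup>2 \<partial>\<mu>)" for n
    proof -
      define h where "h = g n + cscale (of_real t) f"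
      have h: "real_valued h" using g01(1)[of n] f by (simp add: h_def real_valued_def)
      have Sh: "Re (S h x) = q n x + t * Re (S f x)" for x
        by (simp add: h_def q_def blinfun.add_right markov_cscale[OF mS])
      have "(\<integral>x. (q n x + t * Re (S f x))\<^sup>2 \<partial>\<mu>) = (\<integral>x. (Re (S h x))\<^sup>2 \<partial>\<mu>)" by (simp only: Sh)
      also have "\<dots> \<le> (\<integral>x. Re (S (sq_CK h) x) \<partial>\<mu>)"
        using iu(2)[of "S h"] state_sq[OF markov_state[OF mS] h] by (intro integral_mono) auto
      also have "\<dots> = (\<integral>x. Re (sq_CK h x) \<partial>\<mu>)" by (rule integral_Re_inv[OF S])
      also have "\<dots> = (\<integral>x. (p n x + t * Re (f x))\<^sup>2 \<partial>\<mu>)" by (simp add: h_def p_def)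
      finally show ?thesis .
    qed
    then show "\<exists>N. \<forall>n\<ge>N. (\<integral>x. (q n x + t * Re (S f x))\<^sup>2 \<partial>\<mu>) \<le> (\<integral>x. (p n x + t * Re (f x))\<^sup>2 \<partial>\<mu>)"
      by blast
  qed
  \<comment> \<open>In the expanded form of \<open>key\<close> the terms free of \<open>t\<close>
    cancel; a linear term is then bounded by a quadratic one for every real
    \<open>t\<close>.\<close>
  have "2 * ((\<integral>x. Re (S f x) * u x \<partial>\<mu>) - (\<integral>x. Re (f x) * u x \<partial>\<mu>)) = 0"
  proof (rule linear_le_quadratic_imp_zero)
    fix t :: real
    show "t * (2 * ((\<integral>x. Re (S f x) * u x \<partial>\<mu>) - (\<integral>x. Re (f x) * u x \<partial>\<mu>)))
        \<le> t\<^sup>2 * ((\<integral>x. (Re (f x))\<^sup>2 \<partial>\<mu>) - (\<integral>x. (Re (S f x))\<^sup>2 \<partial>\<mu>))"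
      using key[of t] unfolding expand by (simp add: algebra_simps)
  qed
  then show ?thesis by simp
qed

text \<open>A density \<open>u\<close> fixed by the adjoints yields a new invariant probability
  after normalisation. Invariance on real functions extends to complex ones by splitting into real
  and imaginary part.\<close>

lemma weighted_inv_state:
  assumes inv: "\<And>S f. S \<in> \<S> \<Longrightarrow> real_valued f \<Longrightarrow> (\<integral>x. Re (S f x) * u x \<partial>\<mu>) = (\<integral>x. Re (f x) * u x \<partial>\<mu>)"
    and u: "\<And>x. 0 \<le> u x" "\<And>x. u x \<le> 1" "u \<in> borel_measurable \<mu>" and a: "0 < (\<integral>x. u x \<partial>\<mu>)"
  shows "(\<lambda>f. (\<integral>x. apply_bcontfun f x * of_real (u x) \<partial>\<mu>) / of_real (\<integral>x. u x \<partial>\<mu>)) \<in> inv_states"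
proof -
  define w where "w f = (\<integral>x. apply_bcontfun f x * of_real (u x) \<partial>\<mu>)" for f :: "'k CK"
  have int: "integrable \<mu> (\<lambda>x. apply_bcontfun f x * of_real (u x))" for f :: "'k CK"
  proof (rule integrable_const_bound[where B = "norm f * 1"])
    have "norm (apply_bcontfun f x * complex_of_real (u x)) \<le> norm f * 1" for x
      unfolding norm_mult using u(1,2)[of x] by (intro mult_mono norm_bounded) auto
    then show "AE x in \<mu>. norm (apply_bcontfun f x * complex_of_real (u x)) \<le> norm f * 1" by simp
  qed (use u(3) in measurable)
  have intr: "integrable \<mu> (\<lambda>x. Re (f x) * u x)" for f :: "'k CK"
    using integrable_Re[OF int[of f]] by simp
  have w_add: "w (f + g) = w f + w g" for f g unfolding w_def using int by (simp add: distrib_right)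
  have w_scale: "w (cscale c f) = c * w f" for c f unfolding w_def by (simp add: mult.assoc)
  have w_real: "w f = of_real (\<integral>x. Re (f x) * u x \<partial>\<mu>)" if "real_valued f" for f
  proof -
    have "f x * of_real (u x) = complex_of_real (Re (f x) * u x)" for x
      using that by (simp add: real_valued_def complex_eq_iff)
    then show ?thesis unfolding w_def by (simp only: integral_complex_of_real)
  qed
  have w_inv: "w (S f) = w f" if S: "S \<in> \<S>" for S f
  proof -
    have *: "w (S (re_CK f)) = w (re_CK f)" for f
      using inv[OF S real_re_CK, of f] markov_real[OF markov[OF S], of "re_CK f"]
      by (simp only: w_real real_re_CK)
    have "w (S f) = w (S (re_CK f)) + \<i> * w (S (re_CK (cscale (- \<i>) f)))"
      by (subst re_CK_decomp[of f]) (simp only: blinfun.add_right w_add markov_cscale[OF markov[OF S]] w_scale)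
    also have "\<dots> = w (re_CK f) + \<i> * w (re_CK (cscale (- \<i>) f))" by (simp only: *)
    also have "\<dots> = w f" by (subst (3) re_CK_decomp[of f]) (simp only: w_add w_scale)
    finally show ?thesis .
  qed
  let ?a = "\<integral>x. u x \<partial>\<mu>"
  have "(\<lambda>f. w f / of_real ?a) \<in> states"
  proof (rule statesI)
    show "0 \<le> Re (w f / of_real ?a) \<and> Im (w f / of_real ?a) = 0" if "nonneg_valued f" for f
      using that a u(1) w_real[OF nonneg_valued_real[OF that]] by (simp add: nonneg_valued_def)
    show "w (const_bcontfun 1) / of_real ?a = 1" using a by (simp add: w_def)
  qed (simp_all add: w_add w_scale add_divide_distrib)
  then show ?thesis using w_inv by (simp add: inv_states_def w_def)
qed

text \<open>Let \<open>u\<close> be the truncated vector and \<open>a\<close> its mean. Then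
  \<open>\<mu>\<close> is the convex combination, with weights \<open>a\<close> and
  \<open>1 - a\<close>, of the normalised invariant measures with densities \<open>u\<close> and
  \<open>1 - u\<close>. Extremality gives \<open>\<integral>f u = a \<integral>f\<close> for
  continuous \<open>f\<close>; letting \<open>f\<close> tend to \<open>u\<close> leads to
  \<open>\<integral>(u - a)^2 = 0\<close>.\<close>

lemma clamp_fixed_constant:
  assumes ex: "\<mu> \<in> ex_inv_prob \<S>"
    and fix_h: "(\<lambda>x. of_real (h x)) \<in> L1_fix \<S> \<mu>"
  shows "AE x in \<mu>. unit_clamp (h x) = (\<integral>x. unit_clamp (h x) \<partial>\<mu>)"
proof -
  define u where "u x = unit_clamp (h x)" for x
  define a where "a = (\<integral>x. u x \<partial>\<mu>)"
  have approx: "\<exists>g. approx S g (\<lambda>x. of_real (u x)) \<and> (\<forall>n. real_valued (g n)) \<and> (\<forall>n x. 0 \<le> Re (g n x)) \<and>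
      (\<forall>n x. Re (g n x) \<le> 1)" if S: "S \<in> \<S>" for S
  proof -
    obtain f where f: "approx S f (\<lambda>x. of_real (h x))" using fix_h S by (auto simp: L1_fix_iff)
    obtain g where "approx S g (\<lambda>x. of_real (unit_clamp (Re (of_real (h x)))))" "\<And>n. real_valued (g n)"
      "\<And>n x. 0 \<le> Re (g n x)" "\<And>n x. Re (g n x) \<le> 1"
      using approx_clamp[OF S f] by blast
    then show ?thesis by (intro exI[of _ g]) (simp add: u_def)
  qed
  obtain S0 where S0: "S0 \<in> \<S>" using nonempty by blast
  obtain g where g: "approx S0 g (\<lambda>x. of_real (u x))" "\<And>n. real_valued (g n)"
      "\<And>n x. 0 \<le> Re (g n x)" "\<And>n x. Re (g n x) \<le> 1"
    using approx[OF S0] by blast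
  have um: "u \<in> borel_measurable \<mu>"
  proof -
    have "integrable \<mu> (\<lambda>x. complex_of_real (u x))" by (rule approxD(1)[OF g(1)])
    from integrable_Re[OF this] show ?thesis by simp
  qed
  have u01: "0 \<le> u x" "u x \<le> 1" for x by (simp_all add: u_def unit_clamp_range)
  have iu: "integrable \<mu> u" using u01 um by (intro integrable_const_bound[where B = 1]) auto
  have inv: "(\<integral>x. Re (S f x) * u x \<partial>\<mu>) = (\<integral>x. Re (f x) * u x \<partial>\<mu>)" if "S \<in> \<S>" "real_valued f" for S f
    using approx[OF that(1)] fixed_by_adjoint[OF that(1) _ _ _ _ u01 um that(2)] by blast
  have a01: "0 \<le> a" "a \<le> 1"
    using u01 integral_mono[OF iu, of "\<lambda>_. 1"] by (simp_all add: a_def prob_space)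
  have "AE x in \<mu>. u x = a"
  \<comment> \<open>At these values one of the two densities cannot be normalised, but then
    \<open>u\<close> is constant anyway.\<close>
  proof (cases "a = 0 \<or> a = 1")
    case True
    then show ?thesis
    proof
      assume "a = 0"
      then have "AE x in \<mu>. u x = 0"
        using integral_nonneg_eq_0_iff_AE[OF iu] u01 by (simp add: a_def)
      then show ?thesis using \<open>a = 0\<close> by simp
    next
      assume "a = 1"
      then have "(\<integral>x. 1 - u x \<partial>\<mu>) = 0" using iu by (simp add: a_def prob_space)
      then have "AE x in \<mu>. 1 - u x = 0"
        using integral_nonneg_eq_0_iff_AE[of \<mu> "\<lambda>x. 1 - u x"] iu u01 by simp
      then show ?thesis using \<open>a = 1\<close> by simp
    qed
  next
    case False
    then have a: "0 < a" "a < 1" using a01 by auto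
    define \<psi> where "\<psi> f = (\<integral>x. apply_bcontfun f x * of_real (u x) \<partial>\<mu>) / of_real a" for f :: "'k CK"
    define \<theta> where "\<theta> f = (\<integral>x. apply_bcontfun f x * of_real (1 - u x) \<partial>\<mu>) / of_real (1 - a)" for f :: "'k CK"
    have cint: "integrable \<mu> (\<lambda>x. apply_bcontfun f x * of_real (v x))"
      if "\<And>x. 0 \<le> v x" "\<And>x. v x \<le> 1" "v \<in> borel_measurable \<mu>" for f :: "'k CK" and v
    proof (rule integrable_const_bound[where B = "norm f * 1"])
      have "norm (apply_bcontfun f x * complex_of_real (v x)) \<le> norm f * 1" for x
        unfolding norm_mult using that(1,2)[of x] by (intro mult_mono norm_bounded) auto
      then show "AE x in \<mu>. norm (apply_bcontfun f x * complex_of_real (v x)) \<le> norm f * 1" by simp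
    qed (use that(3) in measurable)
    have "\<psi> \<in> inv_states"
      using weighted_inv_state[OF inv u01 um] a(1) unfolding \<psi>_def a_def by blast
    moreover have "\<theta> \<in> inv_states"
    proof -
      have 1: "(\<integral>x. 1 - u x \<partial>\<mu>) = 1 - a" using iu by (simp add: a_def prob_space)
      have "(\<integral>x. Re (S f x) * (1 - u x) \<partial>\<mu>) = (\<integral>x. Re (f x) * (1 - u x) \<partial>\<mu>)"
        if "S \<in> \<S>" "real_valued f" for S f
      proof -
        have "integrable \<mu> (\<lambda>x. Re (h x) * u x)" for h :: "'k CK"
          using integrable_Re[OF cint[OF u01 um, of h]] by simp
        then show ?thesis
          using inv[OF that] integral_Re_inv[OF that(1), of f] by (simp add: right_diff_distrib)
      qed
      from weighted_inv_state[OF this] show ?thesis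
        using a(2) u01 um unfolding \<theta>_def 1 by simp
    qed
    moreover have "of_real a * \<psi> f + of_real (1 - a) * \<theta> f = \<phi>\<^sub>\<mu> f" for f
    proof -
      have "of_real a * \<psi> f + of_real (1 - a) * \<theta> f
          = (\<integral>x. apply_bcontfun f x * of_real (u x) \<partial>\<mu>) + (\<integral>x. apply_bcontfun f x * of_real (1 - u x) \<partial>\<mu>)"
        using a by (simp add: \<psi>_def \<theta>_def)
      also have "\<dots> = (\<integral>x. apply_bcontfun f x * of_real (u x) + apply_bcontfun f x * of_real (1 - u x) \<partial>\<mu>)"
        using u01 um by (intro Bochner_Integration.integral_add[symmetric] cint) auto
      also have "\<dots> = \<phi>\<^sub>\<mu> f" by (simp add: functional_eq algebra_simps)
      finally show ?thesis .
    qed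
    then have "(\<lambda>f. of_real a * \<psi> f + of_real (1 - a) * \<theta> f) \<in> {\<phi>\<^sub>\<mu>}" by (simp add: fun_eq_iff)
    ultimately have "\<psi> \<in> {\<phi>\<^sub>\<mu>}"
      using ex face_of_funsD[of "{\<phi>\<^sub>\<mu>}" inv_states \<psi> \<theta> a] a unfolding ex_inv_prob_iff[OF invariant] by blast
    then have \<psi>: "(\<integral>x. f x * of_real (u x) \<partial>\<mu>) = of_real a * (\<integral>x. f x \<partial>\<mu>)" for f :: "'k CK"
      using a(1) by (simp add: \<psi>_def functional_eq fun_eq_iff field_simps)
    have gz: "(\<integral>x. Re (g n x) * (u x - a) \<partial>\<mu>) = 0" for n
    proof -
      have "Re (\<integral>x. g n x * of_real (u x) \<partial>\<mu>) = Re (of_real a * (\<integral>x. g n x \<partial>\<mu>))" using \<psi>[of "g n"] by simp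
      then have "(\<integral>x. Re (g n x) * u x \<partial>\<mu>) = a * (\<integral>x. Re (g n x) \<partial>\<mu>)"
        using cint[OF u01 um, of "g n"] by (simp flip: integral_Re)
      moreover have "(\<integral>x. Re (g n x) * (u x - a) \<partial>\<mu>) = (\<integral>x. Re (g n x) * u x - a * Re (g n x) \<partial>\<mu>)"
        by (simp add: algebra_simps)
      moreover have "\<dots> = (\<integral>x. Re (g n x) * u x \<partial>\<mu>) - a * (\<integral>x. Re (g n x) \<partial>\<mu>)"
        using integrable_Re[OF cint[OF u01 um, of "g n"]] by (subst Bochner_Integration.integral_diff) auto
      ultimately show ?thesis by simp
    qed
    have iua: "integrable \<mu> (\<lambda>x. u x * (u x - a))"
    proof (rule integrable_const_bound[where B = 1])
      have "\<bar>u x * (u x - a)\<bar> \<le> 1 * 1" for x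
        unfolding abs_mult using u01[of x] a by (intro mult_mono) auto
      then show "AE x in \<mu>. norm (u x * (u x - a)) \<le> 1" by simp
    qed (use um in measurable)
    have "(\<integral>x. u x * (u x - a) \<partial>\<mu>) = 0"
    proof -
      have le: "\<bar>\<integral>x. u x * (u x - a) \<partial>\<mu>\<bar> \<le> (\<integral>x. cmod (g n x - of_real (u x)) \<partial>\<mu>)" for n
      proof -
        have ig: "integrable \<mu> (\<lambda>x. Re (g n x) * (u x - a))"
          using integrable_Re[OF cint[OF u01 um, of "g n"]] by (simp add: right_diff_distrib)
        have "(\<integral>x. u x * (u x - a) \<partial>\<mu>) = (\<integral>x. u x * (u x - a) - Re (g n x) * (u x - a) \<partial>\<mu>)"
          using gz[of n] iua ig by simp
        also have "\<bar>\<dots>\<bar> \<le> (\<integral>x. \<bar>u x * (u x - a) - Re (g n x) * (u x - a)\<bar> \<partial>\<mu>)" by (rule integral_abs_bound)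
        also have "\<dots> \<le> (\<integral>x. cmod (g n x - of_real (u x)) \<partial>\<mu>)"
        proof (rule integral_mono)
          show "integrable \<mu> (\<lambda>x. cmod (g n x - of_real (u x)))" using approxD(1)[OF g(1)] by simp
          show "integrable \<mu> (\<lambda>x. \<bar>u x * (u x - a) - Re (g n x) * (u x - a)\<bar>)"
            using iua ig by (intro integrable_abs Bochner_Integration.integrable_diff)
          fix x
          have "\<bar>u x * (u x - a) - Re (g n x) * (u x - a)\<bar> = \<bar>Re (g n x) - u x\<bar> * \<bar>u x - a\<bar>"
            by (simp flip: abs_mult left_diff_distrib) (simp add: abs_mult abs_minus_commute)
          also have "\<dots> \<le> \<bar>Re (g n x) - u x\<bar> * 1" using u01[of x] a by (intro mult_left_mono) auto
          also have "\<dots> \<le> cmod (g n x - of_real (u x))" using abs_Re_le_cmod[of "g n x - of_real (u x)"] by simp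
          finally show "\<bar>u x * (u x - a) - Re (g n x) * (u x - a)\<bar> \<le> cmod (g n x - of_real (u x))" .
        qed
        finally show ?thesis .
      qed
      have "(\<lambda>_::nat. \<bar>\<integral>x. u x * (u x - a) \<partial>\<mu>\<bar>) \<longlonglongrightarrow> 0"
        by (rule null_comparison[OF approxD(2)[OF g(1)] _ le]) simp
      then show ?thesis by (simp add: LIMSEQ_const_iff)
    qed
    moreover have "(\<integral>x. a * (u x - a) \<partial>\<mu>) = 0" using iu by (simp add: a_def prob_space)
    ultimately have "(\<integral>x. u x * (u x - a) - a * (u x - a) \<partial>\<mu>) = 0"
      using iua iu by (subst Bochner_Integration.integral_diff) auto
    then have "(\<integral>x. (u x - a)\<^sup>2 \<partial>\<mu>) = 0" by (simp add: power2_eq_square flip: left_diff_distrib)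
    moreover have "integrable \<mu> (\<lambda>x. (u x - a)\<^sup>2)"
    proof -
      have "integrable \<mu> (\<lambda>x. u x * (u x - a) - a * (u x - a))" using iua iu by auto
      then show ?thesis by (simp add: power2_eq_square flip: left_diff_distrib)
    qed
    ultimately have "AE x in \<mu>. (u x - a)\<^sup>2 = 0"
      by (subst (asm) integral_nonneg_eq_0_iff_AE) auto
    then show ?thesis by simp
  qed
  then show ?thesis by (simp add: u_def a_def)
qed

lemma L1_fix_affine:
  assumes "h \<in> L1_fix \<S> \<mu>"
  shows "(\<lambda>x. c * h x + d) \<in> L1_fix \<S> \<mu>"
  unfolding L1_fix_iff
proof
  fix S assume S: "S \<in> \<S>"
  then obtain f where "approx S f h" using assms by (auto simp: L1_fix_iff)
  then show "\<exists>f. approx S f (\<lambda>x. c * h x + d)"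
    using approx_add[OF approx_scale[OF S, of f h c] approx_const[OF S, of d]] by blast
qed

lemma L1_fix_Re:
  assumes "h \<in> L1_fix \<S> \<mu>"
  shows "(\<lambda>x. of_real (Re (h x))) \<in> L1_fix \<S> \<mu>"
  using assms approx_Re unfolding L1_fix_iff by blast

text \<open>Let \<open>c\<close> be the mean of \<open>h\<close>. The truncation of
  \<open>h - c\<close> is a constant: if it is \<open>0\<close> then \<open>h \<le> c\<close> almost
  everywhere, otherwise \<open>h > c\<close>. As \<open>h - c\<close> has mean zero, the first case
  forces equality and the second is impossible.\<close>

lemma fixed_real_constant:
  assumes ex: "\<mu> \<in> ex_inv_prob \<S>" and h: "(\<lambda>x. of_real (h x)) \<in> L1_fix \<S> \<mu>"
  shows "AE x in \<mu>. h x = (\<integral>x. h x \<partial>\<mu>)"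
proof -
  have "integrable \<mu> (\<lambda>x. complex_of_real (h x))" using h by (simp add: L1_fix_def)
  from integrable_Re[OF this] have int: "integrable \<mu> h" by simp
  define c where "c = (\<integral>x. h x \<partial>\<mu>)"
  have mean0: "(\<integral>x. h x - c \<partial>\<mu>) = 0" using int by (simp add: c_def prob_space)
  have "(\<lambda>x. 1 * of_real (h x) + of_real (- c)) \<in> L1_fix \<S> \<mu>" by (rule L1_fix_affine[OF h])
  then have "(\<lambda>x. of_real (h x - c)) \<in> L1_fix \<S> \<mu>" by simp
  from clamp_fixed_constant[OF ex this] obtain \<alpha> where \<alpha>: "AE x in \<mu>. unit_clamp (h x - c) = \<alpha>" by blast
  have clamp0: "unit_clamp r = 0 \<longleftrightarrow> r \<le> 0" for r by (auto simp: unit_clamp_def abs_if)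
  show ?thesis
  proof (cases "\<alpha> = 0")
    case True
    then have le: "AE x in \<mu>. 0 \<le> c - h x" using \<alpha> by (auto simp: clamp0)
    have mean0': "(\<integral>x. c - h x \<partial>\<mu>) = 0" using int by (simp add: c_def prob_space)
    have "AE x in \<mu>. c - h x = 0"
      by (subst integral_nonneg_eq_0_iff_AE[symmetric]) (use le int mean0' in auto)
    then show ?thesis by eventually_elim (simp add: c_def)
  next
    case False
    have pos: "AE x in \<mu>. 0 < h x - c"
      using \<alpha>
    proof eventually_elim
      case (elim x)
      then have "unit_clamp (h x - c) \<noteq> 0" using False by simp
      then show ?case unfolding clamp0 by simp
    qed
    then have "AE x in \<mu>. 0 \<le> h x - c" by eventually_elim simp
    then have "AE x in \<mu>. h x - c = 0"
      by (subst integral_nonneg_eq_0_iff_AE[symmetric]) (use int mean0 in auto)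
    with pos have "AE x in \<mu>. False" by eventually_elim simp
    then show ?thesis by simp
  qed
qed

lemma one_L1_fix: "(\<lambda>_. 1) \<in> L1_fix \<S> \<mu>"
  unfolding L1_fix_iff using approx_const by blast

text \<open>The constant \<open>1\<close> is a fixed vector, so a one-dimensional fixed space can
  only consist of constants.\<close>

lemma ergodic_iff_constant:
  "ergodic \<S> \<mu> \<longleftrightarrow> (\<forall>h\<in>L1_fix \<S> \<mu>. \<exists>c. AE x in \<mu>. h x = c)"
proof
  assume "ergodic \<S> \<mu>"
  then obtain k where k: "\<And>g. g \<in> L1_fix \<S> \<mu> \<Longrightarrow> \<exists>c. AE x in \<mu>. g x = c * k x"
    unfolding ergodic_def by blast
  obtain d where d: "AE x in \<mu>. 1 = d * k x" using k[OF one_L1_fix] by blast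
  have "d \<noteq> 0"
  proof
    assume "d = 0"
    with d have "AE x in \<mu>. False" by simp
    then show False by simp
  qed
  show "\<forall>h\<in>L1_fix \<S> \<mu>. \<exists>c. AE x in \<mu>. h x = c"
  proof
    fix h assume "h \<in> L1_fix \<S> \<mu>"
    then obtain c where "AE x in \<mu>. h x = c * k x" using k by blast
    with d have "AE x in \<mu>. h x = c / d"
    proof eventually_elim
      case (elim x)
      then show ?case using \<open>d \<noteq> 0\<close> by (simp add: field_simps)
    qed
    then show "\<exists>c. AE x in \<mu>. h x = c" by blast
  qed
next
  assume const: "\<forall>h\<in>L1_fix \<S> \<mu>. \<exists>c. AE x in \<mu>. h x = c"
  show "ergodic \<S> \<mu>"
    unfolding ergodic_def
    using invariant one_L1_fix const by (intro conjI bexI[of _ "\<lambda>_. 1"]) auto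
qed

lemma extreme_imp_ergodic:
  assumes ex: "\<mu> \<in> ex_inv_prob \<S>"
  shows "ergodic \<S> \<mu>"
  unfolding ergodic_iff_constant
proof
  fix h assume h: "h \<in> L1_fix \<S> \<mu>"
  have 1: "AE x in \<mu>. Re (h x) = (\<integral>x. Re (h x) \<partial>\<mu>)"
    by (rule fixed_real_constant[OF ex L1_fix_Re[OF h]])
  have "(\<lambda>x. - \<i> * h x) \<in> L1_fix \<S> \<mu>" using L1_fix_affine[OF h, of "- \<i>" 0] by simp
  from fixed_real_constant[OF ex L1_fix_Re[OF this]]
  have 2: "AE x in \<mu>. Im (h x) = (\<integral>x. Im (h x) \<partial>\<mu>)" by simp
  from 1 2 have "AE x in \<mu>. h x = Complex (\<integral>x. Re (h x) \<partial>\<mu>) (\<integral>x. Im (h x) \<partial>\<mu>)"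
    by eventually_elim (simp add: complex_eq_iff)
  then show "\<exists>c. AE x in \<mu>. h x = c" by blast
qed


text \<open>If \<open>t a \<le> \<mu>\<close> for an invariant state \<open>a\<close>, then \<open>a\<close> has a density with respect to \<open>\<mu>\<close>, obtained here as the
  limit of a minimizing sequence of \<open>J f = \<integral>f\<^sup>2 - 2 a f\<close>. As \<open>J (S f) \<le> J f\<close>, the operators of \<open>\<S>\<close> map
  minimizing sequences to minimizing sequences, so this density is a fixed vector.\<close>

lemma ergodic_dominated_state:
  assumes erg: "ergodic \<S> \<mu>" and a: "a \<in> inv_states" and t: "0 < t"
    and dom: "\<And>f. nonneg_valued f \<Longrightarrow> t * Re (a f) \<le> Re (\<phi>\<^sub>\<mu> f)"
  shows "a = \<phi>\<^sub>\<mu>"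
proof -
  note as = inv_state_state[OF a] and \<phi>s = inv_state_state[OF \<phi>_inv]
  define I where "I f = (\<integral>x. (Re (f x))\<^sup>2 \<partial>\<mu>)" for f :: "'k CK"
  define J where "J f = I f - 2 * Re (a f)" for f
  have I_sq: "I f = Re (\<phi>\<^sub>\<mu> (sq_CK f))" for f
    by (simp add: I_def functional_eq sq_CK_fun del: of_real_power)
  have int_sq: "integrable \<mu> (\<lambda>x. (Re (f x))\<^sup>2)" for f :: "'k CK"
    using integrable_Re[OF integrable_CK[of "sq_CK f"]] by simp
  have int_mult: "integrable \<mu> (\<lambda>x. Re (f x) * Re (g x))" for f g :: "'k CK"
  proof -
    have "Re (f x) * Re (g x) = ((Re ((f + g) x))\<^sup>2 - (Re (f x))\<^sup>2 - (Re (g x))\<^sup>2) / 2" for x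
      by (simp add: power2_eq_square algebra_simps)
    moreover have "integrable \<mu> (\<lambda>x. ((Re ((f + g) x))\<^sup>2 - (Re (f x))\<^sup>2 - (Re (g x))\<^sup>2) / 2)"
      by (intro integrable_divide Bochner_Integration.integrable_diff int_sq)
    ultimately show ?thesis by presburger
  qed
  \<comment> \<open>With \<open>r = Re (a f)\<close>, domination and \<open>state_sq\<close> give
    \<open>t r^2 \<le> I f\<close>; completing the square bounds \<open>t r^2 - 2 r\<close> below by
    \<open>- 1 / t\<close>.\<close>
  have J_lower: "- 1 / t \<le> J f" if f: "real_valued f" for f
  proof -
    define r where "r = Re (a f)"
    have "t * r\<^sup>2 \<le> t * Re (a (sq_CK f))" using state_sq[OF as f] t by (simp add: r_def)
    also have "\<dots> \<le> I f" unfolding I_sq by (rule dom) (simp add: nonneg_valued_def)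
    finally have "t * r\<^sup>2 - 2 * r \<le> J f" by (simp add: J_def r_def)
    moreover have "- 1 / t \<le> t * r\<^sup>2 - 2 * r"
    proof -
      have "0 \<le> (t * r - 1)\<^sup>2 / t" using t by simp
      also have "\<dots> = t * r\<^sup>2 - 2 * r + 1 / t" using t by (simp add: power2_eq_square field_simps)
      finally show ?thesis by simp
    qed
    ultimately show ?thesis by simp
  qed
  define m where "m = (INF f\<in>{f. real_valued f}. J f)"
  have bdd: "bdd_below (J ` {f. real_valued f})" using J_lower unfolding bdd_below_def by blast
  have zero: "real_valued (0 :: 'k CK)" by (simp add: real_valued_def)
  have m_le: "m \<le> J f" if "real_valued f" for f
    unfolding m_def using that by (intro cINF_lower bdd) simp
  have "\<exists>f. real_valued f \<and> J f < m + 1 / real (Suc n)" for n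
  proof (rule ccontr)
    assume "\<not> ?thesis"
    then have "m + 1 / real (Suc n) \<le> m"
      unfolding m_def using zero by (intro cINF_greatest) (auto simp: m_def not_less)
    then show False by simp
  qed
  then obtain f where f: "\<And>n. real_valued (f n)" "\<And>n. J (f n) < m + 1 / real (Suc n)" by metis
  have a_lin: "Re (a (g + h)) = Re (a g) + Re (a h)" "Re (a (cscale (of_real s) g)) = s * Re (a g)" for g h s
    by (simp_all add: state_add[OF as] state_cscale[OF as])
  \<comment> \<open>Parallelogram law at the midpoint \<open>k\<close> of \<open>g\<close> and
    \<open>h\<close>, where \<open>m \<le> J k\<close>: minimizing sequences are Cauchy in
    L^2.\<close>
  have L2: "I (g - h) \<le> 2 * (J g - m) + 2 * (J h - m)" if g: "real_valued g" and h: "real_valued h" for g h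
  proof -
    define k where "k = cscale (of_real (1/2)) (g + h)"
    have "real_valued k" using g h by (simp add: k_def real_valued_def)
    then have "m \<le> J k" by (rule m_le)
    moreover have "I (g - h) + 4 * I k = 2 * I g + 2 * I h"
    proof -
      have "I (g - h) + 4 * I k = (\<integral>x. (Re ((g - h) x))\<^sup>2 + 4 * (Re (k x))\<^sup>2 \<partial>\<mu>)"
        unfolding I_def using int_sq[of "g - h"] int_sq[of k] by simp
      also have "\<dots> = (\<integral>x. 2 * (Re (g x))\<^sup>2 + 2 * (Re (h x))\<^sup>2 \<partial>\<mu>)"
        by (rule Bochner_Integration.integral_cong) (auto simp: k_def power2_eq_square algebra_simps)
      also have "\<dots> = 2 * I g + 2 * I h" unfolding I_def using int_sq[of g] int_sq[of h] by simp
      finally show ?thesis .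
    qed
    moreover have "Re (a k) = (Re (a g) + Re (a h)) / 2" unfolding k_def a_lin by simp
    ultimately show ?thesis unfolding J_def by argo
  qed
  have L1: "(\<integral>x. \<bar>Re (g x)\<bar> \<partial>\<mu>)\<^sup>2 \<le> I g" for g :: "'k CK"
    using state_sq[OF \<phi>s, of "abs_CK (re_CK g)"] nonneg_valued_real[OF nonneg_abs_CK[of "re_CK g"]]
    by (simp add: functional_eq I_def abs_CK_fun sq_CK_fun del: of_real_power)
  have L1_small: "(\<integral>x. \<bar>Re (g x) - Re (h x)\<bar> \<partial>\<mu>) < e"
    if e: "0 < e" and gh: "real_valued g" "real_valued h" "J g < m + e\<^sup>2 / 4" "J h < m + e\<^sup>2 / 4" for g h e
  proof -
    have "(\<integral>x. \<bar>Re ((g - h) x)\<bar> \<partial>\<mu>)\<^sup>2 \<le> I (g - h)" by (rule L1)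
    also have "\<dots> < e\<^sup>2" using L2[OF gh(1,2)] gh(3,4) by simp
    finally show ?thesis using e by (simp add: power2_less_imp_less)
  qed
  have J_S: "J (S g) \<le> J g" if S: "S \<in> \<S>" and g: "real_valued g" for S g
  proof -
    have "I (S g) \<le> Re (\<phi>\<^sub>\<mu> (S (sq_CK g)))"
    proof -
      have "I (S g) \<le> (\<integral>x. Re (S (sq_CK g) x) \<partial>\<mu>)"
        unfolding I_def
        by (rule integral_mono[OF int_sq]) (use state_sq[OF markov_state[OF markov[OF S]] g] in auto)
      then show ?thesis by (simp add: functional_eq)
    qed
    then show ?thesis by (simp add: J_def I_sq[of g] inv_state_inv[OF \<phi>_inv S] inv_state_inv[OF a S])
  qed
  have close: "\<exists>N. \<forall>n\<ge>N. J (f n) < m + e\<^sup>2 / 4" if "0 < e" for e :: real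
  proof -
    have "0 < e\<^sup>2 / 4" using that by simp
    then obtain N where N: "1 / real (Suc N) < e\<^sup>2 / 4" using nat_approx_posE by blast
    have "J (f n) < m + e\<^sup>2 / 4" if "n \<ge> N" for n
    proof -
      have "1 / real (Suc n) \<le> 1 / real (Suc N)" using that by (intro divide_left_mono) auto
      with f(2)[of n] N show ?thesis by simp
    qed
    then show ?thesis by blast
  qed
  have Sf_real: "real_valued (S (f n))" if "S \<in> \<S>" for S n using markov_real[OF markov[OF that] f(1)] .
  obtain h where h: "integrable \<mu> h" "(\<lambda>n. \<integral>x. \<bar>Re (f n x) - h x\<bar> \<partial>\<mu>) \<longlonglongrightarrow> 0"
  proof (rule L1_complete[of \<mu> "\<lambda>n x. Re (f n x)"])
    show "\<exists>N. \<forall>i\<ge>N. \<forall>j\<ge>N. (\<integral>x. \<bar>Re (f i x) - Re (f j x)\<bar> \<partial>\<mu>) < e" if "0 < e" for e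
      using close[OF that] L1_small[OF that f(1) f(1)] by blast
  qed auto
  have to_cmod: "cmod (g x - of_real r) = \<bar>Re (g x) - r\<bar>" if "real_valued g" for g :: "'k CK" and x r
    using that norm_of_real[of "Re (g x) - r", where 'a = complex]
    by (simp add: real_valued_def cmod_eq_Re)
  have "(\<lambda>x. of_real (h x)) \<in> L1_fix \<S> \<mu>"
    unfolding L1_fix_iff
  proof
    fix S assume S: "S \<in> \<S>"
    have Slim: "(\<lambda>n. \<integral>x. \<bar>Re (S (f n) x) - Re (f n x)\<bar> \<partial>\<mu>) \<longlonglongrightarrow> 0"
    proof (rule LIMSEQ_I)
      fix e :: real assume e: "0 < e"
      then obtain N where N: "\<And>n. n \<ge> N \<Longrightarrow> J (f n) < m + e\<^sup>2 / 4" using close by blast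
      have "(\<integral>x. \<bar>Re (S (f n) x) - Re (f n x)\<bar> \<partial>\<mu>) < e" if "n \<ge> N" for n
        using L1_small[OF e Sf_real[OF S] f(1), of n n] J_S[OF S f(1), of n] N[OF that] by simp
      then show "\<exists>no. \<forall>n\<ge>no. norm ((\<integral>x. \<bar>Re (S (f n) x) - Re (f n x)\<bar> \<partial>\<mu>) - 0) < e" by auto
    qed
    have "approx S f (\<lambda>x. of_real (h x))"
    proof (rule approxI[OF _ h(2) tendsto_add_zero[OF Slim h(2)]])
      show "integrable \<mu> (\<lambda>x. complex_of_real (h x))" using h(1) by simp
      show "(\<integral>x. cmod (f n x - of_real (h x)) \<partial>\<mu>) \<le> (\<integral>x. \<bar>Re (f n x) - h x\<bar> \<partial>\<mu>)" for n
        by (simp add: to_cmod f(1))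
      show "(\<integral>x. cmod (S (f n) x - of_real (h x)) \<partial>\<mu>)
          \<le> (\<integral>x. \<bar>Re (S (f n) x) - Re (f n x)\<bar> \<partial>\<mu>) + (\<integral>x. \<bar>Re (f n x) - h x\<bar> \<partial>\<mu>)" for n
      proof -
        have "(\<integral>x. cmod (S (f n) x - of_real (h x)) \<partial>\<mu>) = (\<integral>x. \<bar>Re (S (f n) x) - h x\<bar> \<partial>\<mu>)"
          by (simp add: to_cmod Sf_real[OF S])
        also have "\<dots> \<le> (\<integral>x. \<bar>Re (S (f n) x) - Re (f n x)\<bar> + \<bar>Re (f n x) - h x\<bar> \<partial>\<mu>)"
          using h(1) by (intro integral_mono) auto
        also have "\<dots> = (\<integral>x. \<bar>Re (S (f n) x) - Re (f n x)\<bar> \<partial>\<mu>) + (\<integral>x. \<bar>Re (f n x) - h x\<bar> \<partial>\<mu>)"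
          using h(1) by (intro Bochner_Integration.integral_add) auto
        finally show ?thesis .
      qed
    qed
    then show "\<exists>f. approx S f (\<lambda>x. of_real (h x))" by blast
  qed
  from bspec[OF erg[unfolded ergodic_iff_constant] this]
  obtain d where "AE x in \<mu>. of_real (h x) = (d :: complex)" by blast
  then have hc: "AE x in \<mu>. h x = Re d" by eventually_elim auto
  define c where "c = Re d"
  \<comment> \<open>The Euler--Lagrange equation: \<open>m \<le> J (f n + s g)\<close> for every
    real \<open>s\<close>, while \<open>f n\<close> tends to the constant \<open>c\<close> in
    L^1.\<close>
  have var: "Re (a g) = c * (\<integral>x. Re (g x) \<partial>\<mu>)" if g: "real_valued g" for g
  proof -
    have lim: "(\<lambda>n. \<integral>x. Re (f n x) * Re (g x) \<partial>\<mu>) \<longlonglongrightarrow> c * (\<integral>x. Re (g x) \<partial>\<mu>)"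
    proof -
      have "(\<lambda>n. \<bar>(\<integral>x. Re (f n x) * Re (g x) \<partial>\<mu>) - c * (\<integral>x. Re (g x) \<partial>\<mu>)\<bar>) \<longlonglongrightarrow> 0"
      proof (rule null_comparison[OF tendsto_mult_right_zero[OF h(2), of "norm g"]])
        fix n
        have "(\<integral>x. Re (f n x) * Re (g x) \<partial>\<mu>) - c * (\<integral>x. Re (g x) \<partial>\<mu>)
            = (\<integral>x. Re (f n x) * Re (g x) - c * Re (g x) \<partial>\<mu>)"
          using int_mult[of "f n" g] by simp
        also have "\<bar>\<dots>\<bar> \<le> (\<integral>x. \<bar>Re (f n x) * Re (g x) - c * Re (g x)\<bar> \<partial>\<mu>)" by (rule integral_abs_bound)
        also have "\<dots> \<le> (\<integral>x. norm g * \<bar>Re (f n x) - h x\<bar> \<partial>\<mu>)"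
        proof (rule integral_mono_AE)
          show "AE x in \<mu>. \<bar>Re (f n x) * Re (g x) - c * Re (g x)\<bar> \<le> norm g * \<bar>Re (f n x) - h x\<bar>"
            using hc
          proof eventually_elim
            case (elim x)
            have "\<bar>Re (f n x) * Re (g x) - c * Re (g x)\<bar> = \<bar>Re (g x)\<bar> * \<bar>Re (f n x) - h x\<bar>"
              by (simp only: elim c_def flip: abs_mult) (simp add: algebra_simps)
            also have "\<dots> \<le> norm g * \<bar>Re (f n x) - h x\<bar>"
              using order_trans[OF abs_Re_le_cmod norm_bounded[of g x]] by (intro mult_right_mono) auto
            finally show ?case .
          qed
        qed (use h(1) int_mult[of "f n" g] in auto)
        finally show "\<bar>(\<integral>x. Re (f n x) * Re (g x) \<partial>\<mu>) - c * (\<integral>x. Re (g x) \<partial>\<mu>)\<bar>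
            \<le> norm g * (\<integral>x. \<bar>Re (f n x) - h x\<bar> \<partial>\<mu>)" by simp
      qed simp
      then show ?thesis by (rule LIM_zero_cancel[OF tendsto_rabs_zero_cancel])
    qed
    have "2 * (Re (a g) - c * (\<integral>x. Re (g x) \<partial>\<mu>)) = 0"
    proof (rule linear_le_quadratic_imp_zero)
      fix s :: real
      have ge: "s * (2 * (Re (a g) - (\<integral>x. Re (f n x) * Re (g x) \<partial>\<mu>))) \<le> s\<^sup>2 * I g + 1 / real (Suc n)" for n
      proof -
        define k where "k = f n + cscale (of_real s) g"
        have "real_valued k" using f(1)[of n] g by (simp add: k_def real_valued_def)
        then have "m \<le> J k" by (rule m_le)
        moreover have "I k = I (f n) + 2 * s * (\<integral>x. Re (f n x) * Re (g x) \<partial>\<mu>) + s\<^sup>2 * I g"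
        proof -
          have "I k = (\<integral>x. (Re (f n x))\<^sup>2 + 2 * s * (Re (f n x) * Re (g x)) + s\<^sup>2 * (Re (g x))\<^sup>2 \<partial>\<mu>)"
            unfolding I_def k_def
            by (rule Bochner_Integration.integral_cong) (auto simp: power2_eq_square algebra_simps)
          then show ?thesis unfolding I_def using int_sq[of "f n"] int_sq[of g] int_mult[of "f n" g] by simp
        qed
        moreover have "Re (a k) = Re (a (f n)) + s * Re (a g)" unfolding k_def a_lin ..
        ultimately show ?thesis using f(2)[of n] by (simp add: J_def algebra_simps)
      qed
      have lim1: "(\<lambda>n. s\<^sup>2 * I g + 1 / real (Suc n)) \<longlonglongrightarrow> s\<^sup>2 * I g"
        using tendsto_add[OF tendsto_const LIMSEQ_Suc[OF lim_1_over_n]] by simp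
      have lim2: "(\<lambda>n. s * (2 * (Re (a g) - (\<integral>x. Re (f n x) * Re (g x) \<partial>\<mu>))))
          \<longlonglongrightarrow> s * (2 * (Re (a g) - c * (\<integral>x. Re (g x) \<partial>\<mu>)))"
        by (intro tendsto_intros lim)
      show "s * (2 * (Re (a g) - c * (\<integral>x. Re (g x) \<partial>\<mu>))) \<le> s\<^sup>2 * I g"
        by (rule LIMSEQ_le[OF lim2 lim1]) (use ge in blast)
    qed
    then show ?thesis by simp
  qed
  have "real_valued (const_bcontfun 1 :: 'k CK)" by (simp add: real_valued_def)
  from var[OF this] have "c = 1" by (simp add: state_one[OF as] prob_space)
  then show ?thesis
    using var[OF real_re_CK] by (intro state_eqI[OF as \<phi>s]) (simp add: functional_eq re_CK_fun)
qed

text \<open>In a decomposition \<open>t a + (1 - t) b\<close> the state \<open>b\<close> is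
  positive, so \<open>t a\<close> lies below the state of \<open>\<mu>\<close>; by symmetry the same
  holds for \<open>b\<close>.\<close>

lemma ergodic_imp_extreme:
  assumes erg: "ergodic \<S> \<mu>"
  shows "\<mu> \<in> ex_inv_prob \<S>"
  unfolding ex_inv_prob_iff[OF invariant]
proof (rule face_of_funsI)
  show "{\<phi>\<^sub>\<mu>} \<subseteq> inv_states" using \<phi>_inv by simp
  have dom: "a = \<phi>\<^sub>\<mu>" if a: "a \<in> inv_states" and b: "b \<in> inv_states" and t: "0 < t" "t < 1"
    and eq: "\<And>f. \<phi>\<^sub>\<mu> f = of_real t * a f + of_real (1 - t) * b f" for a b and t :: real
  proof (rule ergodic_dominated_state[OF erg a t(1)])
    fix f :: "'k CK" assume "nonneg_valued f"
    then have "0 \<le> Re (b f)" by (rule state_nonneg[OF inv_state_state[OF b]])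
    then show "t * Re (a f) \<le> Re (\<phi>\<^sub>\<mu> f)" using t by (simp add: eq)
  qed
  fix a b t assume a: "a \<in> inv_states" and b: "b \<in> inv_states" and t: "0 < t" "t < (1::real)"
    and "(\<lambda>f. of_real t * a f + of_real (1 - t) * b f) \<in> {\<phi>\<^sub>\<mu>}"
  then have eq: "\<phi>\<^sub>\<mu> f = of_real t * a f + of_real (1 - t) * b f" for f
    using fun_cong[of "\<lambda>f. of_real t * a f + of_real (1 - t) * b f" \<phi>\<^sub>\<mu> f] by simp
  have "a = \<phi>\<^sub>\<mu>" by (rule dom[OF a b t eq])
  moreover have "b = \<phi>\<^sub>\<mu>" by (rule dom[OF b a, of "1 - t"]) (use t eq in auto)
  ultimately show "a \<in> {\<phi>\<^sub>\<mu>} \<and> b \<in> {\<phi>\<^sub>\<mu>}" by simp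
qed

theorem ergodic_iff_extreme: "ergodic \<S> \<mu> \<longleftrightarrow> \<mu> \<in> ex_inv_prob \<S>"
  using ergodic_imp_extreme extreme_imp_ergodic by blast

text \<open>Functions decreasing to the indicator of \<open>L\<close> are mapped to functions that are still \<open>1\<close> on \<open>L\<close>
  and have the same integral, so the indicator is a fixed vector.\<close>

lemma ergodic_zero_one:
  assumes erg: "ergodic \<S> \<mu>" and L: "closed L"
    and inv: "\<And>S f x. S \<in> \<S> \<Longrightarrow> (\<And>y. y \<in> L \<Longrightarrow> apply_bcontfun f y = 0) \<Longrightarrow> x \<in> L \<Longrightarrow>
      apply_bcontfun (blinfun_apply S f) x = 0"
  shows "measure \<mu> L = 0 \<or> measure \<mu> L = 1"
proof -
  have Lb: "L \<in> sets borel" using L by simp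
  have ind: "integrable \<mu> (indicator L :: 'k \<Rightarrow> real)"
    using Lb by (intro integrable_real_indicator) (auto simp: sets_eq emeasure_eq_measure)
  have "\<exists>g :: 'k CK. nonneg_valued g \<and> (\<forall>x. Re (g x) \<le> 1) \<and> (\<forall>x\<in>L. g x = 1) \<and>
      (\<integral>x. Re (g x) \<partial>\<mu>) < measure \<mu> L + 1 / real (Suc n)" for n
  proof -
    have "0 < 1 / real (Suc n)" by simp
    then obtain U where U: "L \<subseteq> U" "open U" "measure \<mu> U < measure \<mu> L + 1 / real (Suc n)"
      using regular_approx[OF Lb, of "1 / real (Suc n)"] by metis
    obtain f where f: "continuous_on UNIV f" "\<And>x. (0::real) \<le> f x" "\<And>x. f x \<le> 1"
      "\<And>x. x \<in> - U \<Longrightarrow> f x = 0" "\<And>x. x \<in> L \<Longrightarrow> f x = 1"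
      using Urysohn_compact[OF compact_K, of "- U" L] U L by auto
    let ?g = "Bcontfun (\<lambda>x. complex_of_real (f x))"
    note g = Bcontfun_real_apply[OF compact_K f(1)]
    have "(\<integral>x. Re (?g x) \<partial>\<mu>) \<le> (\<integral>x. indicator U x \<partial>\<mu>)"
    proof (rule integral_mono)
      show "integrable \<mu> (indicator U :: 'k \<Rightarrow> real)"
        using U(2) by (intro integrable_real_indicator) (auto simp: sets_eq emeasure_eq_measure)
      show "Re (?g x) \<le> indicator U x" for x using f(3,4)[of x] by (auto simp: g indicator_def)
    qed simp
    also have "\<dots> = measure \<mu> U" by (simp add: space_eq)
    finally show ?thesis using U(3) f by (intro exI[of _ ?g]) (auto simp: nonneg_valued_def g)
  qed
  then obtain g :: "nat \<Rightarrow> 'k CK" where g: "\<And>n. nonneg_valued (g n)" "\<And>n x. Re (g n x) \<le> 1"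
      "\<And>n x. x \<in> L \<Longrightarrow> g n x = 1" "\<And>n. (\<integral>x. Re (g n x) \<partial>\<mu>) < measure \<mu> L + 1 / real (Suc n)"
    by metis
  \<comment> \<open>For nonnegative \<open>k\<close> with value \<open>1\<close> on \<open>L\<close>
    the distance to the indicator is the excess of the integral over the measure of
    \<open>L\<close>; this serves both \<open>g n\<close> and \<open>S (g n)\<close>.\<close>
  have est: "(\<integral>x. cmod (k x - of_real (indicator L x)) \<partial>\<mu>) \<le> 1 / real (Suc n)"
    if k: "nonneg_valued k" "\<And>x. x \<in> L \<Longrightarrow> k x = 1" "(\<integral>x. Re (k x) \<partial>\<mu>) < measure \<mu> L + 1 / real (Suc n)"
    for k :: "'k CK" and n
  proof -
    have "cmod (k x - of_real (indicator L x)) = Re (k x) - indicator L x" for x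
      using k(1) k(2)[of x] by (cases "x \<in> L") (auto simp: nonneg_valued_def cmod_eq_Re)
    then have "(\<integral>x. cmod (k x - of_real (indicator L x)) \<partial>\<mu>) = (\<integral>x. Re (k x) - indicator L x \<partial>\<mu>)" by simp
    also have "\<dots> = (\<integral>x. Re (k x) \<partial>\<mu>) - measure \<mu> L" using ind by (simp add: space_eq)
    finally show ?thesis using k(3) by simp
  qed
  have "(\<lambda>x. of_real (indicator L x)) \<in> L1_fix \<S> \<mu>"
    unfolding L1_fix_iff
  proof
    fix S assume S: "S \<in> \<S>"
    have lim: "(\<lambda>n. 1 / real (Suc n)) \<longlonglongrightarrow> 0" by (intro LIMSEQ_Suc lim_1_over_n)
    have "approx S g (\<lambda>x. of_real (indicator L x))"
    proof (rule approxI[OF _ lim lim])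
      show "integrable \<mu> (\<lambda>x. complex_of_real (indicator L x))" using ind by simp
      show "(\<integral>x. cmod (g n x - of_real (indicator L x)) \<partial>\<mu>) \<le> 1 / real (Suc n)" for n
        by (rule est[OF g(1,3,4)])
      show "(\<integral>x. cmod (S (g n) x - of_real (indicator L x)) \<partial>\<mu>) \<le> 1 / real (Suc n)" for n
      proof (rule est)
        show "nonneg_valued (S (g n))" by (rule markov_nonneg[OF markov[OF S] g(1)])
        show "S (g n) x = 1" if "x \<in> L" for x
        proof -
          have "S (g n - const_bcontfun 1) x = 0" using g(3) that by (intro inv[OF S]) auto
          then show ?thesis by (simp add: blinfun.diff_right markov_const[OF markov[OF S]])
        qed
        show "(\<integral>x. Re (S (g n) x) \<partial>\<mu>) < measure \<mu> L + 1 / real (Suc n)"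
          using g(4)[of n] by (simp add: integral_Re_inv[OF S])
      qed
    qed
    then show "\<exists>f. approx S f (\<lambda>x. of_real (indicator L x))" by blast
  qed
  from bspec[OF erg[unfolded ergodic_iff_constant] this]
  obtain c where c: "AE x in \<mu>. of_real (indicator L x) = (c::complex)" by blast
  show ?thesis
  proof (cases "c = 1")
    case True
    then have "AE x in \<mu>. x \<in> L" using c by (auto simp: indicator_def split: if_splits)
    then have "measure \<mu> L = 1" using Lb by (intro prob_eq_1[THEN iffD2]) (auto simp: sets_eq)
    then show ?thesis ..
  next
    case False
    have "AE x in \<mu>. x \<notin> L" using c by eventually_elim (use False in \<open>auto simp: indicator_def\<close>)
    then have "measure \<mu> L = 0" using Lb by (intro prob_eq_0[THEN iffD2]) (auto simp: sets_eq)
    then show ?thesis ..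
  qed
qed

end


section \<open>The primitive spectrum\<close>

definition zeros :: "'k::topological_space CK set \<Rightarrow> 'k set" where
  "zeros J = {x. \<forall>f\<in>J. apply_bcontfun f x = 0}"

lemma zeros_antimono: "J \<subseteq> J' \<Longrightarrow> zeros J' \<subseteq> zeros J"
  by (auto simp: zeros_def)

lemma closed_zeros: "closed (zeros (J :: 'k::t2_space CK set))"
proof -
  have *: "zeros J = (\<Inter>f\<in>J. {x. apply_bcontfun f x = 0})" by (auto simp: zeros_def)
  show ?thesis unfolding * by (intro closed_INT ballI closed_Collect_eq continuous_intros) auto
qed

text \<open>The null ideal of a measure expressed through its state, see
  \<open>null_ideal_nid\<close>.\<close>

definition nid :: "('k::topological_space CK \<Rightarrow> complex) \<Rightarrow> 'k CK set" where
  "nid \<psi> = {f. \<psi> (abs_CK f) = 0}"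

text \<open>The state annihilates \<open>g\<close>, so the bound leaves at most \<open>e\<close> at
  \<open>|f|\<close>, whatever the multiple \<open>c\<close>.\<close>

lemma nidI:
  fixes f g :: "'k::topological_space CK"
  assumes \<psi>: "\<psi> \<in> states" and "\<psi> g = 0" "nonneg_valued g"
    and le: "\<And>e. 0 < e \<Longrightarrow> \<exists>c. \<forall>x. cmod (f x) \<le> e + c * Re (g x)"
  shows "f \<in> nid \<psi>"
proof -
  have "Re (\<psi> (abs_CK f)) \<le> 0"
  proof (rule field_le_epsilon)
    fix e :: real assume "0 < e"
    then obtain c where c: "\<And>x. cmod (f x) \<le> e + c * Re (g x)" using le by blast
    have "Re (\<psi> (abs_CK f)) \<le> Re (\<psi> (const_bcontfun (of_real e) + cscale (of_real c) g))"
      by (rule state_Re_mono[OF \<psi>]) (simp add: c)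
    also have "\<dots> = e" by (simp add: state_add[OF \<psi>] state_cscale[OF \<psi>] state_const[OF \<psi>] assms(2))
    finally show "Re (\<psi> (abs_CK f)) \<le> 0 + e" by simp
  qed
  moreover have "0 \<le> Re (\<psi> (abs_CK f))" by (rule state_nonneg[OF \<psi>]) simp
  ultimately show ?thesis using state_nonneg_Im[OF \<psi>, of "abs_CK f"] by (simp add: nid_def complex_eq_iff)
qed

lemma nid_mono:
  fixes f g :: "'k::topological_space CK"
  assumes "\<psi> \<in> states" "g \<in> nid \<psi>" "\<And>x. cmod (f x) \<le> c * cmod (g x)"
  shows "f \<in> nid \<psi>"
proof (rule nidI[OF assms(1), of "abs_CK g"])
  show "\<psi> (abs_CK g) = 0" using assms(2) by (simp add: nid_def)
  show "\<exists>c. \<forall>x. cmod (f x) \<le> e + c * Re (abs_CK g x)" if "0 < e" for e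
    using assms(3) that by (intro exI[of _ c]) (auto intro: add_increasing)
qed simp

lemma nid_zero: "\<psi> \<in> states \<Longrightarrow> f \<in> nid \<psi> \<Longrightarrow> \<psi> f = 0"
  using state_abs[of \<psi> f] by (simp add: nid_def)

lemma nid_one: "\<psi> \<in> states \<Longrightarrow> const_bcontfun 1 \<notin> nid \<psi>"
proof -
  assume \<psi>: "\<psi> \<in> states"
  have "abs_CK (const_bcontfun 1) = (const_bcontfun 1 :: 'a CK)" by (rule bcontfun_eqI) simp
  then show ?thesis using state_one[OF \<psi>] by (simp add: nid_def)
qed

text \<open>Compactness: where \<open>|h| \<ge> e\<close>, finitely many members of \<open>N\<close> add up to a strictly positive function.\<close>

lemma dominated_by_zero_set:
  fixes h :: "'k::t2_space CK"
  assumes cpt: "compact (UNIV :: 'k set)" and zero: "0 \<in> N"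
    and add: "\<And>f g. f \<in> N \<Longrightarrow> g \<in> N \<Longrightarrow> f + g \<in> N" and nn: "\<And>g. g \<in> N \<Longrightarrow> nonneg_valued g"
    and h: "\<And>x. (\<And>g. g \<in> N \<Longrightarrow> apply_bcontfun g x = 0) \<Longrightarrow> h x = 0" and e: "0 < e"
  obtains g c where "g \<in> N" "0 \<le> c" "\<And>x. cmod (h x) \<le> e + c * Re (g x)"
proof -
  define C where "C = {x. e \<le> cmod (h x)}"
  have "closed C" unfolding C_def by (intro closed_Collect_le continuous_intros) auto
  then have C: "compact C" using compact_Int_closed[OF cpt, of C] by simp
  have op: "open {x. 0 < Re (apply_bcontfun g x)}" for g :: "'k CK"
    by (intro open_Collect_less continuous_intros) auto
  have "C \<subseteq> (\<Union>g\<in>N. {x. 0 < Re (apply_bcontfun g x)})"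
  proof
    fix x assume "x \<in> C"
    then have "h x \<noteq> 0" using e by (auto simp: C_def)
    then obtain g where g: "g \<in> N" "apply_bcontfun g x \<noteq> 0" using h by blast
    then have "0 < Re (g x)"
      using nn[OF g(1)] unfolding nonneg_valued_def by (metis complex_eq_iff order_le_less zero_complex.simps)
    then show "x \<in> (\<Union>g\<in>N. {x. 0 < Re (apply_bcontfun g x)})" using g(1) by blast
  qed
  then obtain G where G: "G \<subseteq> N" "finite G" "C \<subseteq> (\<Union>g\<in>G. {x. 0 < Re (apply_bcontfun g x)})"
    by (rule compactE_image[OF C op])
  have sum_N: "(\<Sum>g\<in>G. g) \<in> N"
    using G(2,1) by (induction G) (auto simp: zero add)
  have sum_apply: "Re (apply_bcontfun (\<Sum>g\<in>G. g) x) = (\<Sum>g\<in>G. Re (apply_bcontfun g x))" for x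
    using G(2) by (induction G) auto
  show thesis
  proof (cases "C = {}")
    case True
    have "cmod (h x) \<le> e" for x
    proof -
      have "x \<notin> C" using True by simp
      then show ?thesis by (simp add: C_def)
    qed
    then show thesis using zero by (intro that[of 0 0]) auto
  next
    case False
    define s where "s = (\<Sum>g\<in>G. g)"
    have pos: "0 < Re (s x)" if "x \<in> C" for x
    proof -
      have "x \<in> (\<Union>g\<in>G. {x. 0 < Re (apply_bcontfun g x)})" using G(3) that by (rule subsetD)
      then obtain g where g: "g \<in> G" "0 < Re (apply_bcontfun g x)" unfolding UN_iff mem_Collect_eq ..
      have "0 \<le> Re (apply_bcontfun g' x)" if "g' \<in> G" for g'
        using nn G(1) that by (auto simp: nonneg_valued_def)
      then show ?thesis unfolding s_def sum_apply using G(2) g by (intro sum_pos2[of G g]) auto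
    qed
    have "continuous_on C (\<lambda>x. Re (s x))" by (intro continuous_intros) auto
    then obtain x0 where x0: "x0 \<in> C" "\<And>x. x \<in> C \<Longrightarrow> Re (s x0) \<le> Re (s x)"
      using continuous_attains_inf[OF C False] by blast
    define c where "c = norm h / Re (s x0)"
    have c: "0 \<le> c" using pos[OF x0(1)] by (simp add: c_def)
    have s_nn: "0 \<le> Re (s x)" for x using nn[OF sum_N] by (simp add: s_def nonneg_valued_def)
    have "cmod (h x) \<le> e + c * Re (s x)" for x
    proof (cases "x \<in> C")
      case True
      have "norm h = c * Re (s x0)" using pos[OF x0(1)] by (simp add: c_def)
      also have "\<dots> \<le> c * Re (s x)" using x0(2)[OF True] c by (rule mult_left_mono)
      finally show ?thesis using norm_bounded[of h x] e by simp
    next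
      case False
      then have "cmod (h x) \<le> e" by (simp add: C_def)
      then show ?thesis using c s_nn[of x] by (simp add: add_increasing2)
    qed
    then show thesis using sum_N c by (intro that[of s c]) (auto simp: s_def)
  qed
qed

text \<open>A closed ideal contains everything that vanishes on its zero set. Here
  \<open>dominated_by_zero_set\<close> bounds \<open>|f|\<close> by \<open>e\<close> plus a multiple
  of a nonnegative function on which the state is zero.\<close>

lemma vanish_imp_nid:
  fixes f :: "'k::t2_space CK"
  assumes cpt: "compact (UNIV :: 'k set)" and \<psi>: "\<psi> \<in> states"
    and f: "\<And>x. x \<in> zeros (nid \<psi>) \<Longrightarrow> f x = 0"
  shows "f \<in> nid \<psi>"
proof -
  define N where "N = {g. nonneg_valued g \<and> \<psi> g = 0}"
  have "Re (\<psi> (abs_CK f)) \<le> 0"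
  proof (rule field_le_epsilon)
    fix e :: real assume e: "0 < e"
    obtain g c where g: "g \<in> N" "\<And>x. cmod (f x) \<le> e + c * Re (g x)"
    proof (rule dominated_by_zero_set[OF cpt, of N f e])
      show "0 \<in> N" by (simp add: N_def nonneg_valued_def state_zero[OF \<psi>])
      show "f + g \<in> N" if "f \<in> N" "g \<in> N" for f g
        using that by (simp add: N_def nonneg_valued_def state_add[OF \<psi>])
      show "f x = 0" if N: "\<And>g. g \<in> N \<Longrightarrow> apply_bcontfun g x = 0" for x
      proof (rule f)
        have "apply_bcontfun g x = 0" if "g \<in> nid \<psi>" for g
          using N[of "abs_CK g"] that by (simp add: N_def nid_def)
        then show "x \<in> zeros (nid \<psi>)" by (simp add: zeros_def)
      qed
    qed (use e in \<open>auto simp: N_def\<close>)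
    have "Re (\<psi> (abs_CK f)) \<le> Re (\<psi> (const_bcontfun (of_real e) + cscale (of_real c) g))"
      by (rule state_Re_mono[OF \<psi>]) (simp add: g(2))
    also have "\<dots> = e"
      using g(1) by (simp add: N_def state_add[OF \<psi>] state_cscale[OF \<psi>] state_const[OF \<psi>])
    finally show "Re (\<psi> (abs_CK f)) \<le> 0 + e" by simp
  qed
  moreover have "0 \<le> Re (\<psi> (abs_CK f))" by (rule state_nonneg[OF \<psi>]) simp
  ultimately show ?thesis using state_nonneg_Im[OF \<psi>, of "abs_CK f"] by (simp add: nid_def complex_eq_iff)
qed

lemma Urysohn_CK:
  fixes A B :: "'k::t2_space set"
  assumes "compact (UNIV :: 'k set)" "closed A" "closed B" "A \<inter> B = {}"
  obtains f :: "'k CK" where "nonneg_valued f" "\<And>x. Re (f x) \<le> 1" "\<And>x. x \<in> A \<Longrightarrow> f x = 0" "\<And>x. x \<in> B \<Longrightarrow> f x = 1"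
proof -
  obtain f :: "'k \<Rightarrow> real" where f: "continuous_on UNIV f" "\<And>x. 0 \<le> f x" "\<And>x. f x \<le> 1"
    "\<And>x. x \<in> A \<Longrightarrow> f x = 0" "\<And>x. x \<in> B \<Longrightarrow> f x = 1"
    using Urysohn_compact[OF assms] by metis
  note app = Bcontfun_real_apply[OF assms(1) f(1)]
  show thesis
    using f by (intro that[of "Bcontfun (\<lambda>x. complex_of_real (f x))"]) (auto simp: nonneg_valued_def app)
qed

lemma (in regular_probability) null_ideal_eq: "null_ideal \<mu> = nid (blinfun_apply (functional \<mu>))"
  by (simp add: null_ideal_def nid_def functional_eq abs_CK_fun)

context markov_semigroup
begin

text \<open>The states of the ergodic measures, by \<open>ex_inv_prob_ext\<close> and
  \<open>ergodic_ex\<close>.\<close>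

definition ext :: "('k CK \<Rightarrow> complex) set" where
  "ext = {\<psi>. face_of_funs {\<psi>} inv_states}"

lemma ext_inv: "\<psi> \<in> ext \<Longrightarrow> \<psi> \<in> inv_states"
  using face_of_funs_subset by (fastforce simp: ext_def)

lemma ext_state: "\<psi> \<in> ext \<Longrightarrow> \<psi> \<in> states"
  by (intro inv_state_state ext_inv)

lemma inv_prob_measure:
  assumes "\<mu> \<in> inv_prob \<S>" shows "invariant_measure \<S> \<mu>"
  using assms by unfold_locales

lemma null_ideal_nid:
  assumes "\<mu> \<in> inv_prob \<S>"
  shows "null_ideal \<mu> = nid (blinfun_apply (functional \<mu>))"
proof -
  interpret invariant_measure \<S> \<mu> using assms by (rule inv_prob_measure)
  show ?thesis by (rule null_ideal_eq)
qed

lemma ex_inv_prob_ext: "(\<lambda>\<mu>. blinfun_apply (functional \<mu>)) ` ex_inv_prob \<S> = ext"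
proof
  show "(\<lambda>\<mu>. blinfun_apply (functional \<mu>)) ` ex_inv_prob \<S> \<subseteq> ext"
    using ex_inv_prob_iff by (auto simp: ext_def ex_inv_prob_def)
  show "ext \<subseteq> (\<lambda>\<mu>. blinfun_apply (functional \<mu>)) ` ex_inv_prob \<S>"
  proof
    fix \<psi> assume \<psi>: "\<psi> \<in> ext"
    obtain \<mu> where \<mu>: "\<mu> \<in> inv_prob \<S>" "blinfun_apply (functional \<mu>) = \<psi>"
      using inv_state_measure[OF ext_inv[OF \<psi>]] by blast
    then have "\<mu> \<in> ex_inv_prob \<S>" using \<psi> by (simp add: ex_inv_prob_iff ext_def)
    then show "\<psi> \<in> (\<lambda>\<mu>. blinfun_apply (functional \<mu>)) ` ex_inv_prob \<S>" using \<mu>(2) by blast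
  qed
qed

lemma ergodic_ex: "{\<mu>. ergodic \<S> \<mu>} = ex_inv_prob \<S>"
proof -
  have "ergodic \<S> \<mu> \<longleftrightarrow> \<mu> \<in> ex_inv_prob \<S>" for \<mu>
  proof (cases "\<mu> \<in> inv_prob \<S>")
    case True
    then interpret invariant_measure \<S> \<mu> by (rule inv_prob_measure)
    show ?thesis by (rule ergodic_iff_extreme)
  qed (auto simp: ergodic_def ex_inv_prob_def)
  then show ?thesis by blast
qed

lemma Prim_ex: "Prim \<S> = null_ideal ` ex_inv_prob \<S>"
  by (simp add: Prim_def ergodic_ex)

lemma Prim_nid: "Prim \<S> = nid ` ext"
  unfolding Prim_ex ex_inv_prob_ext[symmetric] image_image
  by (rule image_cong) (auto simp: ex_inv_prob_def null_ideal_nid)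

lemma nid_Prim: "\<psi> \<in> ext \<Longrightarrow> nid \<psi> \<in> Prim \<S>"
  by (simp add: Prim_nid)

text \<open>\<open>|S f| \<le> S |f|\<close>, and the invariant state has the same value at
  \<open>S |f|\<close> and at \<open>|f|\<close>.\<close>

lemma nid_invariant:
  assumes \<psi>: "\<psi> \<in> inv_states" and S: "S \<in> \<S>" and f: "f \<in> nid \<psi>"
  shows "S f \<in> nid \<psi>"
proof (rule nidI[OF inv_state_state[OF \<psi>], of "S (abs_CK f)"])
  show "\<psi> (S (abs_CK f)) = 0" using f by (simp add: inv_state_inv[OF \<psi> S] nid_def)
  show "nonneg_valued (S (abs_CK f))" by (rule markov_nonneg[OF markov[OF S]]) simp
  show "\<exists>c. \<forall>x. cmod (S f x) \<le> e + c * Re (S (abs_CK f) x)" if "0 < e" for e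
    using markov_abs[OF markov[OF S], of f] that by (intro exI[of _ 1]) (auto intro: add_increasing)
qed

lemma Prim_invariant: "A \<subseteq> Prim \<S> \<Longrightarrow> S \<in> \<S> \<Longrightarrow> f \<in> \<Inter>A \<Longrightarrow> S f \<in> \<Inter>A"
  using nid_invariant ext_inv unfolding Prim_nid by blast

lemma Prim_mono:
  fixes f g :: "'k CK"
  assumes "A \<subseteq> Prim \<S>" "g \<in> \<Inter>A" "\<And>x. cmod (f x) \<le> c * cmod (g x)"
  shows "f \<in> \<Inter>A"
proof
  fix p assume p: "p \<in> A"
  then obtain \<psi> where "\<psi> \<in> ext" "p = nid \<psi>" using assms(1) unfolding Prim_nid by blast
  then show "f \<in> p" using nid_mono[OF ext_state _ assms(3)] assms(2) p by blast
qed

lemma Prim_vanish: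
  assumes "A \<subseteq> Prim \<S>" "\<And>x. x \<in> zeros (\<Inter>A) \<Longrightarrow> apply_bcontfun f x = 0"
  shows "f \<in> \<Inter>A"
proof
  fix p assume p: "p \<in> A"
  then obtain \<psi> where \<psi>: "\<psi> \<in> ext" "p = nid \<psi>" using assms(1) unfolding Prim_nid by blast
  show "f \<in> p" unfolding \<psi>(2)
  proof (rule vanish_imp_nid[OF compact_K ext_state[OF \<psi>(1)]])
    fix x assume "x \<in> zeros (nid \<psi>)"
    moreover have "zeros (nid \<psi>) \<subseteq> zeros (\<Inter>A)" using p \<psi>(2) by (intro zeros_antimono) blast
    ultimately show "f x = 0" using assms(2) by blast
  qed
qed

text \<open>Existence is \<open>Prim_vanish\<close> for the whole spectrum; uniqueness holds because
  Urysohn functions separate a point from a closed set.\<close>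

lemma rad_support_eq: "rad_support \<S> = zeros (rad \<S>)"
  unfolding rad_support_def
proof (rule the_equality)
  show "closed (zeros (rad \<S>)) \<and> rad \<S> = {f. \<forall>x\<in>zeros (rad \<S>). apply_bcontfun f x = 0}"
    using closed_zeros Prim_vanish[of "Prim \<S>"] unfolding rad_def by (auto simp: zeros_def)
  fix M assume M: "closed M \<and> rad \<S> = {f. \<forall>x\<in>M. apply_bcontfun f x = 0}"
  show "M = zeros (rad \<S>)"
  proof (intro equalityI subsetI)
    show "x \<in> zeros (rad \<S>)" if "x \<in> M" for x using that M by (auto simp: zeros_def)
    fix x assume x: "x \<in> zeros (rad \<S>)"
    show "x \<in> M"
    proof (rule ccontr)
      assume "x \<notin> M"
      then have disj: "M \<inter> {x} = {}" by simp
      have clM: "closed M" using M by blast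
      obtain f :: "'k CK" where f: "\<And>y. y \<in> M \<Longrightarrow> f y = 0" "f x = 1"
        using Urysohn_CK[OF compact_K clM closed_singleton disj] by (metis singletonI)
      then have "f \<in> rad \<S>" using M by auto
      then show False using x f(2) by (auto simp: zeros_def)
    qed
  qed
qed

text \<open>The ergodic measure of \<open>p\<close> gives both closed invariant zero sets mass
  \<open>0\<close> or \<open>1\<close>, and mass \<open>1\<close> puts the ideal into
  \<open>p\<close>. If both were null, inner regularity and a Urysohn function would produce a
  member of both ideals with positive integral.\<close>

lemma Prim_prime:
  assumes p: "p \<in> Prim \<S>" and A: "A \<subseteq> Prim \<S>" and B: "B \<subseteq> Prim \<S>" and sub: "\<Inter>A \<inter> \<Inter>B \<subseteq> p"
  shows "\<Inter>A \<subseteq> p \<or> \<Inter>B \<subseteq> p"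
proof -
  obtain \<mu> where erg: "ergodic \<S> \<mu>" and p_eq: "p = null_ideal \<mu>" using p by (auto simp: Prim_def)
  interpret invariant_measure \<S> \<mu> using erg by (intro inv_prob_measure) (simp add: ergodic_def)
  have zo: "measure \<mu> (zeros (\<Inter>C)) = 0 \<or> measure \<mu> (zeros (\<Inter>C)) = 1" if C: "C \<subseteq> Prim \<S>" for C
  proof (rule ergodic_zero_one[OF erg closed_zeros])
    show "apply_bcontfun (blinfun_apply S f) x = 0"
      if "S \<in> \<S>" "\<And>y. y \<in> zeros (\<Inter>C) \<Longrightarrow> apply_bcontfun f y = 0" "x \<in> zeros (\<Inter>C)" for S f x
      using Prim_invariant[OF C that(1) Prim_vanish[OF C that(2)]] that(3) unfolding zeros_def by blast
  qed
  have one: "\<Inter>C \<subseteq> p" if "measure \<mu> (zeros (\<Inter>C)) = 1" for C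
  proof
    fix f assume f: "f \<in> \<Inter>C"
    have "AE x in \<mu>. x \<in> zeros (\<Inter>C)"
      using that closed_zeros[of "\<Inter>C"] by (subst prob_eq_1[symmetric]) (auto simp: sets_eq)
    then have "AE x in \<mu>. cmod (apply_bcontfun f x) = 0"
      by eventually_elim (use f in \<open>auto simp: zeros_def\<close>)
    then have "(\<integral>x. cmod (apply_bcontfun f x) \<partial>\<mu>) = 0" by (rule integral_eq_zero_AE)
    then show "f \<in> p" by (simp add: p_eq null_ideal_def)
  qed
  have "measure \<mu> (zeros (\<Inter>A)) = 1 \<or> measure \<mu> (zeros (\<Inter>B)) = 1"
  proof (rule ccontr)
    assume "\<not> ?thesis"
    then have 0: "measure \<mu> (zeros (\<Inter>A)) = 0" "measure \<mu> (zeros (\<Inter>B)) = 0" using zo A B by blast+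
    let ?L = "zeros (\<Inter>A) \<union> zeros (\<Inter>B)"
    have cl: "closed ?L" by (intro closed_Un closed_zeros)
    have "measure \<mu> ?L \<le> measure \<mu> (zeros (\<Inter>A)) + measure \<mu> (zeros (\<Inter>B))"
      by (rule measure_Un_le) (auto simp: sets_eq closed_zeros)
    then have "measure \<mu> ?L = 0" using 0 by (simp add: measure_le_0_iff)
    then have "measure \<mu> (- ?L) = 1"
      using prob_compl[of ?L] cl by (simp add: sets_eq space_eq Compl_eq_Diff_UNIV)
    moreover have "- ?L \<in> sets borel" using cl by (intro borel_open) (simp add: closed_def)
    ultimately obtain C where C: "compact C" "C \<subseteq> - ?L" "1 < measure \<mu> C + 1 / 2"
      using regular_approx[of "- ?L" "1/2"] by (metis half_gt_zero_iff zero_less_one)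
    have "?L \<inter> C = {}" using C(2) by blast
    then obtain f :: "'k CK" where f: "nonneg_valued f" "\<And>x. x \<in> ?L \<Longrightarrow> f x = 0" "\<And>x. x \<in> C \<Longrightarrow> f x = 1"
      using Urysohn_CK[OF compact_K cl compact_imp_closed[OF C(1)]] by metis
    have "f \<in> \<Inter>A" "f \<in> \<Inter>B" using f(2) by (intro Prim_vanish A B; blast)+
    then have "f \<in> p" using sub by blast
    then have "(\<integral>x. cmod (f x) \<partial>\<mu>) = 0" by (simp add: p_eq null_ideal_def)
    moreover have "measure \<mu> C \<le> (\<integral>x. cmod (f x) \<partial>\<mu>)"
    proof -
      have Cs: "C \<in> sets \<mu>" using compact_imp_closed[OF C(1)] by (simp add: sets_eq)
      have "measure \<mu> C = (\<integral>x. indicator C x \<partial>\<mu>)" by (simp add: space_eq)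
      also have "\<dots> \<le> (\<integral>x. cmod (f x) \<partial>\<mu>)"
        using f(3) Cs by (intro integral_mono integrable_real_indicator)
          (auto simp: indicator_def emeasure_eq_measure)
      finally show ?thesis .
    qed
    ultimately show False using C(3) by simp
  qed
  then show ?thesis using one by blast
qed

section \<open>The hull-kernel topology\<close>

lemma hk_closure_subset: "hk_closure \<S> A \<subseteq> Prim \<S>" by (auto simp: hk_closure_def)

text \<open>Complements of hull-kernel closed sets are stable under the generation of the topology:
  finite intersections by primeness, unions because kernels shrink as families grow.\<close>

lemma openin_Prim_topology:
  assumes "openin (Prim_topology \<S>) U"
  shows "U \<subseteq> Prim \<S> \<and> hk_closure \<S> (Prim \<S> - U) \<subseteq> Prim \<S> - U"
proof -
  have "generate_topology_on {Prim \<S> - hk_closure \<S> A |A. A \<subseteq> Prim \<S>} U"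
    using assms by (simp add: Prim_topology_def openin_topology_generated_by_iff)
  then show ?thesis
  proof (induction rule: generate_topology_on.induct)
    case Empty
    then show ?case by (auto simp: hk_closure_def)
  next
    case (Int a b)
    have "p \<notin> a \<inter> b" if p: "p \<in> hk_closure \<S> (Prim \<S> - a \<inter> b)" for p
    proof -
      have "\<Inter>(Prim \<S> - a) \<inter> \<Inter>(Prim \<S> - b) \<subseteq> p" "p \<in> Prim \<S>"
        using p by (auto simp: hk_closure_def)
      then have "p \<in> hk_closure \<S> (Prim \<S> - a) \<or> p \<in> hk_closure \<S> (Prim \<S> - b)"
        using Prim_prime[of p "Prim \<S> - a" "Prim \<S> - b"] by (auto simp: hk_closure_def)
      then show ?thesis using Int.IH by blast
    qed
    then show ?case using Int.IH hk_closure_subset by blast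
  next
    case (UN K)
    have "p \<notin> \<Union>K" if p: "p \<in> hk_closure \<S> (Prim \<S> - \<Union>K)" for p
    proof
      assume "p \<in> \<Union>K"
      then obtain k where k: "k \<in> K" "p \<in> k" by blast
      have "p \<in> hk_closure \<S> (Prim \<S> - k)" using p k by (auto simp: hk_closure_def)
      then show False using UN.IH[OF k(1)] k(2) by blast
    qed
    then show ?case using UN.IH hk_closure_subset by blast
  next
    case (Basis s)
    then show ?case by (auto simp: hk_closure_def)
  qed
qed

lemma openin_Prim_basic: "A \<subseteq> Prim \<S> \<Longrightarrow> openin (Prim_topology \<S>) (Prim \<S> - hk_closure \<S> A)"
  unfolding Prim_topology_def by (intro topology_generated_by_Basis) blast

text \<open>The empty intersection is all of \<open>C(K)\<close>, and no null ideal of a state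
  contains \<open>1\<close>.\<close>

lemma hk_closure_empty: "hk_closure \<S> {} = {}"
  using nid_one[OF ext_state] by (auto simp: hk_closure_def Prim_nid)

lemma topspace_Prim: "topspace (Prim_topology \<S>) = Prim \<S>"
proof (rule antisym)
  show "topspace (Prim_topology \<S>) \<subseteq> Prim \<S>" using openin_Prim_topology openin_topspace by blast
  show "Prim \<S> \<subseteq> topspace (Prim_topology \<S>)"
    using openin_subset[OF openin_Prim_basic[of "{}"]] by (simp add: hk_closure_empty)
qed

text \<open>The families are the complements of two disjoint neighbourhoods; they are hull-kernel
  closed by \<open>openin_Prim_topology\<close>, so \<open>p\<close> is not in the closure of
  \<open>A\<close>, nor \<open>q\<close> in that of \<open>B\<close>.\<close>

lemma Hausdorff_Prim_separation:
  assumes "Hausdorff_space (Prim_topology \<S>)" "p \<in> Prim \<S>" "q \<in> Prim \<S>" "p \<noteq> q"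
  obtains A B where "A \<union> B = Prim \<S>" "\<not> \<Inter>A \<subseteq> p" "\<not> \<Inter>B \<subseteq> q"
proof -
  obtain U V where UV: "openin (Prim_topology \<S>) U" "openin (Prim_topology \<S>) V" "p \<in> U" "q \<in> V" "disjnt U V"
    using assms unfolding Hausdorff_space_def topspace_Prim by blast
  have "\<not> \<Inter>(Prim \<S> - U) \<subseteq> p" "\<not> \<Inter>(Prim \<S> - V) \<subseteq> q"
    using openin_Prim_topology[OF UV(1)] openin_Prim_topology[OF UV(2)] UV(3,4) assms(2,3)
    by (auto simp: hk_closure_def)
  moreover have "(Prim \<S> - U) \<union> (Prim \<S> - V) = Prim \<S>" using UV(5) by (auto simp: disjnt_def)
  ultimately show thesis using that by blast
qed

end


section \<open>Mean ergodicity from a Hausdorff primitive spectrum\<close>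

text \<open>The first assumption says that \<open>a\<close> is a cluster point of
  \<open>\<phi>\<close> along \<open>F\<close>. Filters stand in for convergent subsequences, which
  may fail to exist.\<close>

lemma cluster_closed:
  assumes "inf (nhds a) (filtermap \<phi> F) \<noteq> bot" "closed C" "\<forall>\<^sub>F y in F. \<phi> y \<in> C"
  shows "a \<in> C"
proof (rule ccontr)
  assume "a \<notin> C"
  then have "\<forall>\<^sub>F x in nhds a. x \<notin> C"
    using assms(2) eventually_nhds[of "\<lambda>x. x \<notin> C" a] by (auto simp: closed_def intro!: exI[of _ "- C"])
  moreover have "\<forall>\<^sub>F x in filtermap \<phi> F. x \<in> C" using assms(3) by (simp add: eventually_filtermap)
  ultimately have "\<forall>\<^sub>F x in inf (nhds a) (filtermap \<phi> F). False"
    unfolding eventually_inf by (intro exI[of _ "\<lambda>x. x \<notin> C"] exI[of _ "\<lambda>x. x \<in> C"]) simp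
  then show False using assms(1) by (simp add: trivial_limit_def)
qed

text \<open>If \<open>\<phi>\<close> were not eventually in a neighbourhood \<open>U\<close> of
  \<open>a\<close>, the filter refined to the complement of \<open>U\<close> would have a cluster
  point in \<open>X\<close>; uniqueness makes it \<open>a\<close>, which is absurd.\<close>

lemma tendsto_unique_cluster:
  assumes X: "compact X" and ev: "\<forall>\<^sub>F y in F. \<phi> y \<in> X"
    and uniq: "\<And>b. b \<in> X \<Longrightarrow> inf (nhds b) (filtermap \<phi> F) \<noteq> bot \<Longrightarrow> b = a"
  shows "(\<phi> \<longlongrightarrow> a) F"
proof (rule topological_tendstoI, rule ccontr)
  fix U assume U: "open U" "a \<in> U" and neg: "\<not> (\<forall>\<^sub>F y in F. \<phi> y \<in> U)"
  let ?G = "inf (filtermap \<phi> F) (principal (- U))"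
  have "?G \<noteq> bot"
    using neg by (simp add: trivial_limit_def eventually_inf_principal eventually_filtermap)
  moreover have "\<forall>\<^sub>F x in ?G. x \<in> X"
    unfolding eventually_inf_principal eventually_filtermap using ev by (rule eventually_mono) simp
  ultimately have "\<exists>b\<in>X. inf (nhds b) ?G \<noteq> bot"
    using X[unfolded compact_filter, rule_format, of ?G] by simp
  then obtain b where b: "b \<in> X" "inf (nhds b) ?G \<noteq> bot" ..
  have le: "inf (nhds b) ?G \<le> inf (nhds b) (filtermap \<phi> F)" by (intro inf_mono order_refl inf_le1)
  have "inf (nhds b) (filtermap \<phi> F) \<noteq> bot"
  proof
    assume "inf (nhds b) (filtermap \<phi> F) = bot"
    with le b(2) show False by (simp add: le_bot)
  qed
  then have "b = a" by (rule uniq[OF b(1)])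
  have "\<forall>\<^sub>F x in nhds b. x \<in> U" unfolding \<open>b = a\<close> by (rule eventually_nhds_in_open[OF U])
  moreover have "\<forall>\<^sub>F x in ?G. x \<notin> U" by (simp add: eventually_inf_principal)
  ultimately have "\<forall>\<^sub>F x in inf (nhds b) ?G. False"
    unfolding eventually_inf by (intro exI[of _ "\<lambda>x. x \<in> U"] exI[of _ "\<lambda>x. x \<notin> U"]) simp
  then show False using b(2) by (simp add: trivial_limit_def)
qed

context markov_semigroup
begin

section \<open>Faces of invariant states and closed orbits\<close>

definition face :: "'k CK set \<Rightarrow> ('k CK \<Rightarrow> complex) set" where
  "face N = {\<nu> \<in> inv_states. \<forall>g\<in>N. \<nu> g = 0}"

text \<open>A proper convex combination of nonnegative numbers vanishes only if both numbers
  do.\<close>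

lemma face_closed_face:
  assumes "\<And>g. g \<in> N \<Longrightarrow> nonneg_valued g"
  shows "face_of_funs (face N) inv_states" "closed (face N)"
proof -
  have "face N = inv_states \<inter> (\<Inter>g\<in>N. {\<nu>. \<nu> g = 0})" by (auto simp: face_def)
  then show "closed (face N)"
    by (auto intro!: closed_Int closed_inv_states closed_INT closed_Collect_eq continuous_on_eval_fun)
  show "face_of_funs (face N) inv_states"
  proof (rule face_of_funsI)
    fix a b t assume a: "a \<in> inv_states" and b: "b \<in> inv_states" and t: "0 < t" "t < (1::real)"
      and F: "(\<lambda>f. of_real t * a f + of_real (1 - t) * b f) \<in> face N"
    have "a g = 0 \<and> b g = 0" if g: "g \<in> N" for g
    proof -
      have nn: "0 \<le> Re (a g)" "Im (a g) = 0" "0 \<le> Re (b g)" "Im (b g) = 0"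
        using state_nonneg[OF inv_state_state assms[OF g]] state_nonneg_Im[OF inv_state_state assms[OF g]] a b
        by auto
      have "of_real t * a g + of_real (1 - t) * b g = 0" using F g by (simp add: face_def)
      from arg_cong[OF this, of Re] have "t * Re (a g) + (1 - t) * Re (b g) = 0" by simp
      moreover have "0 \<le> t * Re (a g)" "0 \<le> (1 - t) * Re (b g)" using nn t by auto
      ultimately have "t * Re (a g) = 0" "(1 - t) * Re (b g) = 0" by linarith+
      then show ?thesis using t nn by (simp add: complex_eq_iff)
    qed
    then show "a \<in> face N \<and> b \<in> face N" using a b by (simp add: face_def)
  qed (auto simp: face_def)
qed

lemma extI: "face_of_funs {\<psi>} inv_states \<Longrightarrow> \<psi> \<in> ext" by (simp add: ext_def)

text \<open>A Krein--Milman argument: each functional \<open>Re (c * \<psi> g)\<close> is maximal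
  over the face at an extreme point, hence at \<open>\<psi>0\<close>; the values \<open>1\<close>,
  \<open>- 1\<close>, \<open>\<i>\<close>, \<open>- \<i>\<close> of \<open>c\<close> turn the
  inequalities into equality.\<close>

lemma face_singleton:
  assumes N: "\<And>g. g \<in> N \<Longrightarrow> nonneg_valued g" and \<nu>: "\<nu> \<in> face N"
    and uniq: "\<And>\<psi>. \<psi> \<in> ext \<Longrightarrow> \<psi> \<in> face N \<Longrightarrow> \<psi> = \<psi>0"
  shows "\<nu> = \<psi>0 \<and> \<psi>0 \<in> ext"
proof -
  have ne: "face N \<noteq> {}" using \<nu> by blast
  have le: "Re (c * \<nu> g) \<le> Re (c * \<psi>0 g) \<and> \<psi>0 \<in> ext" for c g
  proof -
    obtain \<phi> where \<phi>: "\<phi> \<in> face N" "face_of_funs {\<phi>} inv_states"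
      "\<And>\<psi>. \<psi> \<in> face N \<Longrightarrow> Re (c * \<psi> g) \<le> Re (c * \<phi> g)"
      using Bauer_maximum[OF compact_inv_states face_closed_face[OF N] ne] by metis
    have "\<phi> = \<psi>0" using uniq[OF extI[OF \<phi>(2)] \<phi>(1)] .
    then show ?thesis using \<phi>(3)[OF \<nu>] extI[OF \<phi>(2)] by simp
  qed
  have "\<nu> g = \<psi>0 g" for g
    using le[of 1 g] le[of "- 1" g] le[of \<i> g] le[of "- \<i>" g] by (simp add: complex_eq_iff)
  then show ?thesis using le by (auto simp: fun_eq_iff)
qed

text \<open>Bauer's principle on all of \<open>inv_states\<close> reduces identities for invariant
  states to ergodic ones.\<close>

lemma ext_zero_imp_zero:
  assumes "\<And>\<psi>. \<psi> \<in> ext \<Longrightarrow> \<psi> h = 0" and \<nu>: "\<nu> \<in> inv_states"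
  shows "\<nu> h = 0"
proof -
  have "inv_states \<noteq> {}" using \<nu> by blast
  then have "Re (c * \<nu> h) \<le> 0" for c
    using Bauer_maximum[OF compact_inv_states face_of_funs_refl closed_inv_states, where c = c and g = h]
      assms(1)[OF extI] \<nu> by (metis mult_zero_right zero_complex.simps(1))
  from this[of 1] this[of "- 1"] this[of \<i>] this[of "- \<i>"] show ?thesis by (simp add: complex_eq_iff)
qed

text \<open>The nonnegative functions vanishing on the closed orbit of \<open>x\<close>, that is, on
  the smallest closed invariant set containing \<open>x\<close>, which is thus
  \<open>zeros (orbit_null x)\<close>. The value at \<open>x\<close> is listed separately because
  the identity may be missing from \<open>\<S>\<close>.\<close>

definition orbit_null :: "'k \<Rightarrow> 'k CK set" where
  "orbit_null x = {g. nonneg_valued g \<and> apply_bcontfun g x = 0 \<and>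
     (\<forall>T\<in>\<S>. apply_bcontfun (blinfun_apply T g) x = 0)}"

definition point_state :: "'k \<Rightarrow> 'k CK \<Rightarrow> complex" where
  "point_state x = avg (\<lambda>f. apply_bcontfun f x)"

lemma point_state_inv: "point_state x \<in> inv_states"
  unfolding point_state_def by (intro avg_inv_state eval_state)

lemma point_state_face: "point_state x \<in> face (orbit_null x)"
  using point_state_inv by (auto simp: face_def orbit_null_def point_state_def intro!: avg_zero eval_state)

lemma orbit_null_nn: "g \<in> orbit_null x \<Longrightarrow> nonneg_valued g" by (simp add: orbit_null_def)

lemma Prim_orbit_null:
  assumes A: "A \<subseteq> Prim \<S>" and x: "x \<in> zeros (\<Inter>A)" and f: "f \<in> \<Inter>A"
  shows "abs_CK f \<in> orbit_null x"
proof -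
  have abs: "abs_CK f \<in> \<Inter>A" by (rule Prim_mono[OF A f, where c = 1]) simp
  have "apply_bcontfun g x = 0" if "g \<in> \<Inter>A" for g using x that unfolding zeros_def by blast
  then show ?thesis using abs Prim_invariant[OF A _ abs] unfolding orbit_null_def mem_Collect_eq
    by (intro conjI ballI nonneg_abs_CK) blast+
qed

text \<open>The zero set of an invariant ideal contains with \<open>x\<close> its closed orbit, so
  the invariant states on this orbit annihilate the ideal.\<close>

lemma face_orbit_nid:
  assumes A: "A \<subseteq> Prim \<S>" and x: "x \<in> zeros (\<Inter>A)" and \<nu>: "\<nu> \<in> face (orbit_null x)"
  shows "\<Inter>A \<subseteq> nid \<nu>"
proof
  fix f assume f: "f \<in> \<Inter>A"
  show "f \<in> nid \<nu>" using Prim_orbit_null[OF A x f] \<nu> by (simp add: nid_def face_def)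
qed

text \<open>If \<open>f\<close> in the first ideal and \<open>g\<close> in the second are both
  nonzero at \<open>x\<close>, their product lies in both ideals and is nonzero at
  \<open>x\<close>.\<close>

lemma zeros_Un:
  assumes A: "A \<subseteq> Prim \<S>" and B: "B \<subseteq> Prim \<S>" and x: "x \<in> zeros (\<Inter>(A \<union> B))"
  shows "x \<in> zeros (\<Inter>A) \<or> x \<in> zeros (\<Inter>B)"
proof (rule ccontr)
  assume "\<not> ?thesis"
  then obtain f g where f: "f \<in> \<Inter>A" "apply_bcontfun f x \<noteq> 0" and g: "g \<in> \<Inter>B" "apply_bcontfun g x \<noteq> 0"
    unfolding zeros_def by blast
  define h where "h = Bcontfun (\<lambda>x. f x * g x)"
  have h: "apply_bcontfun h x = f x * g x" for x
    unfolding h_def by (subst Bcontfun_apply[OF compact_K]) (auto intro!: continuous_intros)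
  have "h \<in> \<Inter>A"
    by (rule Prim_mono[OF A f(1), where c = "norm g"])
      (simp add: h norm_mult mult.commute[of "norm g"] mult_left_mono norm_bounded)
  moreover have "h \<in> \<Inter>B"
    by (rule Prim_mono[OF B g(1), where c = "norm f"])
      (auto simp: h norm_mult intro!: mult_right_mono norm_bounded)
  ultimately have "h \<in> \<Inter>(A \<union> B)" by blast
  then have "apply_bcontfun h x = 0" using x unfolding zeros_def by blast
  then show False using f g by (simp add: h)
qed

lemma extension_exists:
  fixes f :: "'k \<Rightarrow> complex"
  assumes M: "closed M" and f: "continuous_on M f"
  obtains F :: "'k CK" where "\<And>x. x \<in> M \<Longrightarrow> F x = f x"
proof -
  obtain u where u: "continuous_on UNIV u" "\<And>x. x \<in> M \<Longrightarrow> u x = Re (f x)"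
    using Tietze_compact[OF compact_K M, of "\<lambda>x. Re (f x)"] f by (auto intro: continuous_intros)
  obtain v where v: "continuous_on UNIV v" "\<And>x. x \<in> M \<Longrightarrow> v x = Im (f x)"
    using Tietze_compact[OF compact_K M, of "\<lambda>x. Im (f x)"] f by (auto intro: continuous_intros)
  have "continuous_on UNIV (\<lambda>x. of_real (u x) + \<i> * of_real (v x))"
    using u(1) v(1) by (intro continuous_intros)
  then have "apply_bcontfun (Bcontfun (\<lambda>x. of_real (u x) + \<i> * of_real (v x))) x = f x" if "x \<in> M" for x
    using that u(2) v(2) by (simp add: Bcontfun_apply[OF compact_K] complex_eq_iff)
  then show thesis by (rule that)
qed

end

text \<open>What (b) and (c) have in common apart from the extension property.\<close>

locale hausdorff_prim = markov_semigroup +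
  assumes hausdorff: "Hausdorff_space (Prim_topology \<S>)"
    and nid_inj: "inj_on nid ext"
begin

lemma separation:
  assumes "\<psi> \<in> ext" "\<psi>' \<in> ext" "\<psi> \<noteq> \<psi>'"
  obtains A B where "A \<union> B = Prim \<S>" "\<not> \<Inter>A \<subseteq> nid \<psi>" "\<not> \<Inter>B \<subseteq> nid \<psi>'"
  using Hausdorff_Prim_separation[OF hausdorff nid_Prim[OF assms(1)] nid_Prim[OF assms(2)]]
    inj_onD[OF nid_inj _ assms(1,2)] assms(3) by blast

text \<open>Hausdorff spaces are T1: if the states differed, \<open>nid \<psi>'\<close> could belong
  to neither of the two separating families, although these cover the spectrum.\<close>

lemma nid_subset_imp_eq:
  assumes "\<psi> \<in> ext" "\<psi>' \<in> ext" "nid \<psi>' \<subseteq> nid \<psi>"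
  shows "\<psi> = \<psi>'"
proof (rule ccontr)
  assume "\<psi> \<noteq> \<psi>'"
  then obtain A B where AB: "A \<union> B = Prim \<S>" "\<not> \<Inter>A \<subseteq> nid \<psi>" "\<not> \<Inter>B \<subseteq> nid \<psi>'"
    using separation[OF assms(1,2)] by blast
  then have "nid \<psi>' \<notin> A" "nid \<psi>' \<notin> B" using assms(3) by blast+
  then show False using AB(1) nid_Prim[OF assms(2)] by blast
qed

text \<open>For two extreme points of this face, \<open>zeros_Un\<close> puts \<open>x\<close> into
  the zero set of one of the separating families, against \<open>face_orbit_nid\<close>. A face with
  one extreme point is that point.\<close>

lemma face_point:
  assumes x: "x \<in> zeros (rad \<S>)"
  shows "point_state x \<in> ext" "\<nu> \<in> face (orbit_null x) \<Longrightarrow> \<nu> = point_state x"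
proof -
  have uniq: "\<psi> = \<psi>'" if as: "\<psi> \<in> ext" "\<psi> \<in> face (orbit_null x)" "\<psi>' \<in> ext" "\<psi>' \<in> face (orbit_null x)" for \<psi> \<psi>'
  proof (rule ccontr)
    assume ne: "\<psi> \<noteq> \<psi>'"
    obtain A B where AB: "A \<union> B = Prim \<S>" "\<not> \<Inter>A \<subseteq> nid \<psi>" "\<not> \<Inter>B \<subseteq> nid \<psi>'"
      by (rule separation[OF as(1,3) ne])
    have A: "A \<subseteq> Prim \<S>" and B: "B \<subseteq> Prim \<S>" using AB(1) by auto
    have "x \<in> zeros (\<Inter>(A \<union> B))" using x unfolding AB(1) rad_def .
    then have "x \<in> zeros (\<Inter>A) \<or> x \<in> zeros (\<Inter>B)" by (rule zeros_Un[OF A B])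
    then show False
    proof
      assume "x \<in> zeros (\<Inter>A)"
      from face_orbit_nid[OF A this as(2)] AB(2) show False by simp
    next
      assume "x \<in> zeros (\<Inter>B)"
      from face_orbit_nid[OF B this as(4)] AB(3) show False by simp
    qed
  qed
  have ne: "face (orbit_null x) \<noteq> {}" using point_state_face by blast
  obtain \<psi>0 where \<psi>0: "\<psi>0 \<in> face (orbit_null x)" "face_of_funs {\<psi>0} inv_states"
    by (rule Bauer_maximum[OF compact_inv_states face_closed_face[OF orbit_null_nn] ne, where c = 1 and g = 0])
  note \<psi>0_ext = extI[OF \<psi>0(2)]
  have *: "\<nu> = \<psi>0 \<and> \<psi>0 \<in> ext" if "\<nu> \<in> face (orbit_null x)" for \<nu>
  proof (rule face_singleton[OF _ that])
    show "nonneg_valued g" if "g \<in> orbit_null x" for g using that by (rule orbit_null_nn)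
    show "\<psi> = \<psi>0" if "\<psi> \<in> ext" "\<psi> \<in> face (orbit_null x)" for \<psi>
      using that \<psi>0_ext \<psi>0(1) by (rule uniq)
  qed
  have p: "point_state x = \<psi>0" using *[OF point_state_face] by simp
  show "point_state x \<in> ext" using \<psi>0_ext p by simp
  show "\<nu> \<in> face (orbit_null x) \<Longrightarrow> \<nu> = point_state x" using * p by simp
qed

text \<open>A cluster point \<open>\<nu>\<close> is not known to be ergodic, so the face of states
  vanishing on its nonnegative null functions is studied. If an extreme point of it is separated by
  \<open>A\<close> and \<open>B\<close> from \<open>point_state x\<close>, then points of the
  radical's support near \<open>x\<close> are zeros of the kernel of \<open>B\<close>. That kernel
  hence lies in the null ideals of the nearby point states, then in that of \<open>\<nu>\<close>,
  then in that of the extreme point, a contradiction.\<close>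

lemma point_state_tendsto:
  assumes x: "x \<in> zeros (rad \<S>)"
  shows "(point_state \<longlongrightarrow> point_state x) (at x within zeros (rad \<S>))"
proof (rule tendsto_unique_cluster[OF compact_inv_states])
  let ?F = "at x within zeros (rad \<S>)"
  show "\<forall>\<^sub>F y in ?F. point_state y \<in> inv_states" by (simp add: point_state_inv)
  fix \<nu> assume \<nu>: "\<nu> \<in> inv_states" and cl: "inf (nhds \<nu>) (filtermap point_state ?F) \<noteq> bot"
  let ?N = "{g. nonneg_valued g \<and> \<nu> g = 0}"
  have "\<nu> = point_state x \<and> point_state x \<in> ext"
  proof (rule face_singleton[of ?N])
    show "\<nu> \<in> face ?N" using \<nu> by (simp add: face_def)
    fix \<psi> assume \<psi>: "\<psi> \<in> ext" "\<psi> \<in> face ?N"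
    show "\<psi> = point_state x"
    proof (rule ccontr)
      assume "\<psi> \<noteq> point_state x"
      then have "point_state x \<noteq> \<psi>" by simp
      then obtain A B where AB: "A \<union> B = Prim \<S>" "\<not> \<Inter>A \<subseteq> nid (point_state x)" "\<not> \<Inter>B \<subseteq> nid \<psi>"
        using separation[OF face_point(1)[OF x] \<psi>(1)] by blast
      have A: "A \<subseteq> Prim \<S>" and B: "B \<subseteq> Prim \<S>" using AB(1) by auto
      have "x \<notin> zeros (\<Inter>A)" using face_orbit_nid[OF A _ point_state_face] AB(2) by blast
      then have "\<forall>\<^sub>F y in ?F. y \<notin> zeros (\<Inter>A)"
        using closed_zeros[of "\<Inter>A"] unfolding eventually_at_topological closed_def
        by (intro exI[of _ "- zeros (\<Inter>A)"]) auto
      moreover have "\<forall>\<^sub>F y in ?F. y \<in> zeros (rad \<S>)" by (simp add: eventually_at_filter)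
      ultimately have ev: "\<forall>\<^sub>F y in ?F. y \<in> zeros (\<Inter>B)"
      proof eventually_elim
        case (elim y)
        then have "y \<in> zeros (\<Inter>(A \<union> B))" unfolding AB(1) rad_def by simp
        then show ?case using zeros_Un[OF A B] elim by blast
      qed
      have "\<Inter>B \<subseteq> nid \<psi>"
      proof
        fix f assume f: "f \<in> \<Inter>B"
        have "\<nu> \<in> {\<nu>. \<nu> (abs_CK f) = 0}"
        proof (rule cluster_closed[OF cl])
          show "closed {\<nu>. \<nu> (abs_CK f) = (0 :: complex)}"
            by (intro closed_Collect_eq continuous_on_eval_fun continuous_on_const)
          show "\<forall>\<^sub>F y in ?F. point_state y \<in> {\<nu>. \<nu> (abs_CK f) = 0}"
            using ev
          proof eventually_elim
            case (elim y)
            have "f \<in> nid (point_state y)" using face_orbit_nid[OF B elim point_state_face] f by blast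
            then show ?case by (simp add: nid_def)
          qed
        qed
        then have "abs_CK f \<in> ?N" by simp
        then have "\<psi> (abs_CK f) = 0" using \<psi>(2) unfolding face_def by blast
        then show "f \<in> nid \<psi>" by (simp add: nid_def)
      qed
      then show False using AB(3) by blast
    qed
  qed simp
  then show "\<nu> = point_state x" by simp
qed

lemma continuous_point_state: "continuous_on (zeros (rad \<S>)) (\<lambda>x. point_state x f)"
  unfolding continuous_on_def
proof
  fix x assume "x \<in> zeros (rad \<S>)"
  then have "(point_state \<longlongrightarrow> point_state x) (at x within zeros (rad \<S>))" by (rule point_state_tendsto)
  then have "((\<lambda>x. (\<lambda>\<psi>. \<psi> f) (point_state x)) \<longlongrightarrow> (\<lambda>\<psi>. \<psi> f) (point_state x)) (at x within zeros (rad \<S>))"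
    by (rule continuous_on_tendsto_compose[OF continuous_on_product_coordinates]) auto
  then show "((\<lambda>x. point_state x f) \<longlongrightarrow> point_state x f) (at x within zeros (rad \<S>))" by simp
qed

text \<open>The semigroup property makes \<open>orbit_null x\<close> invariant, so it is contained
  in \<open>orbit_null y\<close>; the face of \<open>y\<close> then lies in the one-point face of
  \<open>x\<close>.\<close>

lemma orbit_zeros_point_state:
  assumes x: "x \<in> zeros (rad \<S>)" and y: "y \<in> zeros (orbit_null x)"
  shows "y \<in> zeros (rad \<S>)" "point_state y = point_state x"
proof -
  have van: "apply_bcontfun g y = 0" if "g \<in> orbit_null x" for g using y that by (simp add: zeros_def)
  show "y \<in> zeros (rad \<S>)"
    unfolding zeros_def
  proof (intro CollectI ballI)
    fix f assume "f \<in> rad \<S>"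
    then have "abs_CK f \<in> orbit_null x" using x Prim_orbit_null[of "Prim \<S>" x f] by (simp add: rad_def)
    from van[OF this] show "apply_bcontfun f y = 0" by simp
  qed
  have "orbit_null x \<subseteq> orbit_null y"
  proof
    fix g assume g: "g \<in> orbit_null x"
    have "blinfun_apply T g \<in> orbit_null x" if T: "T \<in> \<S>" for T
    proof -
      have "apply_bcontfun (blinfun_apply R (blinfun_apply T g)) x = 0" if R: "R \<in> \<S>" for R
      proof -
        have "R o\<^sub>L T \<in> \<S>" using semigroup R T by (simp add: op_semigroup_def)
        then have "apply_bcontfun (blinfun_apply (R o\<^sub>L T) g) x = 0" using g by (simp only: orbit_null_def mem_Collect_eq)
        then show ?thesis by simp
      qed
      then show ?thesis using g T markov_nonneg[OF markov[OF T]] by (simp add: orbit_null_def)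
    qed
    then show "g \<in> orbit_null y" using van g unfolding orbit_null_def[of y] by (simp add: orbit_null_nn)
  qed
  then have "face (orbit_null y) \<subseteq> face (orbit_null x)" by (auto simp: face_def)
  then show "point_state y = point_state x" using point_state_face face_point(2)[OF x] by blast
qed

text \<open>By \<open>orbit_zeros_point_state\<close>, an extension of the point state function
  minus its value at \<open>x\<close> vanishes on the closed orbit of \<open>x\<close>. Domination
  by members of \<open>orbit_null x\<close>, which \<open>S\<close> sends to functions vanishing at
  \<open>x\<close>, bounds its image at \<open>x\<close> by any \<open>e > 0\<close>.\<close>

lemma point_state_rad_fix: "restrict (\<lambda>x. point_state x f) (rad_support \<S>) \<in> rad_fix \<S>"
proof -
  let ?M = "rad_support \<S>"
  define F0 where "F0 = restrict (\<lambda>x. point_state x f) ?M"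
  have M: "?M = zeros (rad \<S>)" by (rule rad_support_eq)
  have clM: "closed ?M" unfolding M by (rule closed_zeros)
  have F0: "F0 x = point_state x f" if "x \<in> ?M" for x using that by (simp add: F0_def)
  have cont: "continuous_on ?M F0"
  proof -
    have eq: "continuous_on ?M F0 \<longleftrightarrow> continuous_on ?M (\<lambda>x. point_state x f)"
      by (rule continuous_on_cong[OF refl]) (rule F0)
    show ?thesis unfolding eq unfolding M by (rule continuous_point_state)
  qed
  define G :: "'a CK" where "G = (SOME F. \<forall>x\<in>?M. apply_bcontfun F x = F0 x)"
  obtain F1 :: "'a CK" where F1: "\<And>x. x \<in> ?M \<Longrightarrow> apply_bcontfun F1 x = F0 x"
    by (rule extension_exists[OF clM cont]) (rule that)
  then have "\<forall>x\<in>?M. apply_bcontfun F1 x = F0 x" by (intro ballI)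
  then have "\<forall>x\<in>?M. apply_bcontfun G x = F0 x" unfolding G_def by (rule someI)
  then have G: "apply_bcontfun G x = F0 x" if "x \<in> ?M" for x
    using that by (rule bspec)
  have SG: "apply_bcontfun (blinfun_apply S G) x = F0 x" if S: "S \<in> \<S>" and x: "x \<in> ?M" for S x
  proof -
    have x': "x \<in> zeros (rad \<S>)" using x M by simp
    define h where "h = G - const_bcontfun (F0 x)"
    have hz: "h y = 0" if "\<And>g. g \<in> orbit_null x \<Longrightarrow> apply_bcontfun g y = 0" for y
    proof -
      have "y \<in> zeros (orbit_null x)"
        unfolding zeros_def by (rule CollectI, rule ballI) (rule that)
      from orbit_zeros_point_state[OF x' this] show ?thesis using G[of y] F0[of y] F0[OF x] M by (simp add: h_def)
    qed
    have "cmod (S h x) \<le> 0"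
    proof (rule field_le_epsilon)
      fix e :: real assume e: "0 < e"
      obtain g c where g: "g \<in> orbit_null x" "0 \<le> c" "\<And>y. cmod (h y) \<le> e + c * Re (g y)"
      proof (rule dominated_by_zero_set[OF compact_K, of "orbit_null x" h e])
        show "0 \<in> orbit_null x" by (simp add: orbit_null_def nonneg_valued_def blinfun.zero_right)
        show "f + g \<in> orbit_null x" if "f \<in> orbit_null x" "g \<in> orbit_null x" for f g
          using that by (simp add: orbit_null_def nonneg_valued_def blinfun.add_right)
      qed (use hz e orbit_null_nn in auto)
      have "cmod (S h x) \<le> Re (S (abs_CK h) x)" by (rule markov_abs[OF markov[OF S]])
      also have "\<dots> \<le> Re (S (const_bcontfun (of_real e) + cscale (of_real c) g) x)"
        by (rule markov_Re_mono[OF markov[OF S]]) (simp add: g(3))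
      also have "\<dots> = e"
        using g(1) S by (simp add: blinfun.add_right markov_const[OF markov[OF S]] markov_cscale[OF markov[OF S]] orbit_null_def)
      finally show "cmod (S h x) \<le> 0 + e" by simp
    qed
    then show ?thesis by (simp add: h_def blinfun.diff_right markov_const[OF markov[OF S]])
  qed
  have "induced_op ?M S F0 = F0" if S: "S \<in> \<S>" for S
  proof
    fix x
    show "induced_op ?M S F0 x = F0 x"
      unfolding induced_op_def G_def[symmetric]
      using SG[OF S, of x] by (cases "x \<in> ?M") (simp_all add: F0_def)
  qed
  moreover have "F0 \<in> C_on ?M" using cont by (simp add: C_on_def F0_def)
  ultimately show ?thesis unfolding rad_fix_def F0_def[symmetric] by simp
qed

text \<open>On the zero set of \<open>nid \<psi>\<close> with \<open>\<psi>\<close> ergodic, every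
  point state is \<open>\<psi>\<close> by \<open>nid_subset_imp_eq\<close>, so \<open>Q f\<close> is
  the constant \<open>\<psi> f\<close> there. The resulting identity
  \<open>\<psi> (Q f) = \<psi> f\<close> passes to all invariant states by
  \<open>ext_zero_imp_zero\<close>.\<close>

lemma mean_ergodic_if_extension:
  assumes ext: "\<forall>f\<in>rad_fix \<S>. \<exists>F\<in>fix_ops \<S>. f = restrict (apply_bcontfun F) (rad_support \<S>)"
  shows "mean_ergodic \<S>"
proof -
  have "\<exists>F\<in>fix_ops \<S>. \<forall>x\<in>zeros (rad \<S>). apply_bcontfun F x = point_state x f" for f :: "'a CK"
  proof -
    obtain F where F: "F \<in> fix_ops \<S>"
      "restrict (\<lambda>x. point_state x f) (rad_support \<S>) = restrict (apply_bcontfun F) (rad_support \<S>)"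
      using ext point_state_rad_fix by blast
    have "apply_bcontfun F x = point_state x f" if "x \<in> zeros (rad \<S>)" for x
      using fun_cong[OF F(2), of x] that by (simp add: rad_support_eq)
    then show ?thesis using F(1) by blast
  qed
  then obtain Q where Q: "\<And>f. Q f \<in> fix_ops \<S>" "\<And>f x. x \<in> zeros (rad \<S>) \<Longrightarrow> apply_bcontfun (Q f) x = point_state x f"
    by metis
  have ext_Q: "\<psi> (Q f - f) = 0" if \<psi>: "\<psi> \<in> ext" for \<psi> f
  proof -
    note \<psi>s = ext_state[OF \<psi>]
    have "Q f - const_bcontfun (\<psi> f) \<in> nid \<psi>"
    proof (rule vanish_imp_nid[OF compact_K \<psi>s])
      fix x assume x: "x \<in> zeros (nid \<psi>)"
      have sub: "{nid \<psi>} \<subseteq> Prim \<S>" using nid_Prim[OF \<psi>] by simp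
      have xM: "x \<in> zeros (rad \<S>)"
        using x zeros_antimono[of "rad \<S>" "nid \<psi>"] nid_Prim[OF \<psi>] unfolding rad_def by blast
      have "nid \<psi> \<subseteq> nid (point_state x)"
        using face_orbit_nid[OF sub _ point_state_face, of x] x by simp
      then have "point_state x = \<psi>" by (rule nid_subset_imp_eq[OF face_point(1)[OF xM] \<psi>])
      then show "(Q f - const_bcontfun (\<psi> f)) x = 0" by (simp add: Q(2)[OF xM])
    qed
    from nid_zero[OF \<psi>s this] show ?thesis by (simp add: state_diff[OF \<psi>s] state_const[OF \<psi>s])
  qed
  show ?thesis
  proof (rule mean_ergodicI[of Q])
    show "\<nu> (Q f) = \<nu> f" if \<nu>: "\<nu> \<in> inv_states" for \<nu> f
    proof -
      have "\<nu> (Q f - f) = 0" by (rule ext_zero_imp_zero[OF ext_Q \<nu>])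
      then show ?thesis by (simp add: state_diff[OF inv_state_state[OF \<nu>]])
    qed
  qed (rule Q(1))
qed

end


section \<open>Consequences of mean ergodicity\<close>

context regular_probability
begin

lemma closed_msupp: "closed (msupp \<mu>)"
  unfolding msupp_def by (rule closed_Inter) blast

text \<open>The support has full measure although it may be an uncountable intersection: a compact
  part of its complement is covered by finitely many open null sets, and inner regularity does the
  rest.\<close>

lemma null_ideal_vanish:
  fixes f :: "'k CK"
  shows "f \<in> null_ideal \<mu> \<longleftrightarrow> (\<forall>x\<in>msupp \<mu>. f x = 0)"
proof
  assume "f \<in> null_ideal \<mu>"
  then have int0: "(\<integral>x. cmod (f x) \<partial>\<mu>) = 0" by (simp add: null_ideal_def)
  have "AE x in \<mu>. cmod (f x) = 0"
    by (subst integral_nonneg_eq_0_iff_AE[symmetric]) (use int0 in auto)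
  then have "AE x in \<mu>. x \<in> {x. f x = 0}" by eventually_elim simp
  moreover have cl: "closed {x. f x = 0}" by (intro closed_Collect_eq continuous_intros) auto
  ultimately have "measure \<mu> {x. f x = 0} = 1" by (subst prob_eq_1) (auto simp: sets_eq)
  then show "\<forall>x\<in>msupp \<mu>. f x = 0" using cl unfolding msupp_def by blast
next
  assume f: "\<forall>x\<in>msupp \<mu>. f x = 0"
  have U: "- msupp \<mu> \<in> sets borel" using closed_msupp by (intro borel_open) (simp add: closed_def)
  have "measure \<mu> (- msupp \<mu>) \<le> 0"
  proof (rule field_le_epsilon)
    fix e :: real assume "0 < e"
    then obtain C where C: "compact C" "C \<subseteq> - msupp \<mu>" "measure \<mu> (- msupp \<mu>) < measure \<mu> C + e"
      using regular_approx[OF U] by metis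
    have "C \<subseteq> (\<Union>A\<in>{A. closed A \<and> measure \<mu> A = 1}. - A)" using C(2) unfolding msupp_def by blast
    then obtain D where D: "D \<subseteq> {A. closed A \<and> measure \<mu> A = 1}" "finite D" "C \<subseteq> (\<Union>A\<in>D. - A)"
      by (rule compactE_image[OF C(1), rotated]) (auto simp: closed_def)
    have null: "- A \<in> null_sets \<mu>" if "A \<in> D" for A
    proof -
      have A: "closed A" "measure \<mu> A = 1" using D(1) that by auto
      then have "measure \<mu> (- A) = 0"
        using prob_compl[of A] by (simp add: sets_eq space_eq Compl_eq_Diff_UNIV)
      moreover have "- A \<in> sets borel" using A(1) by (intro borel_open) (simp add: closed_def)
      ultimately show ?thesis by (intro null_setsI) (auto simp: sets_eq emeasure_eq_measure)
    qed
    have "(\<Union>A\<in>D. - A) \<in> null_sets \<mu>" by (rule null_sets_UN') (use D(2) null in \<open>auto intro: countable_finite\<close>)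
    moreover have "C \<in> sets \<mu>" using compact_imp_closed[OF C(1)] by (simp add: sets_eq)
    ultimately have "C \<in> null_sets \<mu>" using D(3) by (rule null_sets_subset)
    then have "measure \<mu> C = 0" by (simp add: measure_eq_0_null_sets)
    then show "measure \<mu> (- msupp \<mu>) \<le> 0 + e" using C(3) by simp
  qed
  then have "measure \<mu> (- msupp \<mu>) = 0" by (simp add: measure_le_0_iff)
  then have "AE x in \<mu>. x \<notin> - msupp \<mu>" using U by (subst prob_eq_0[symmetric]) (auto simp: sets_eq)
  then have "AE x in \<mu>. cmod (f x) = 0" by eventually_elim (use f in auto)
  then have "(\<integral>x. cmod (f x) \<partial>\<mu>) = 0" by (rule integral_eq_zero_AE)
  then show "f \<in> null_ideal \<mu>" by (simp add: null_ideal_def)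
qed

end

context markov_semigroup
begin

lemma msupp_subset_iff:
  assumes \<mu>: "\<mu> \<in> inv_prob \<S>" and \<nu>: "\<nu> \<in> inv_prob \<S>"
  shows "msupp \<nu> \<subseteq> msupp \<mu> \<longleftrightarrow> null_ideal \<mu> \<subseteq> null_ideal \<nu>"
proof -
  interpret M: invariant_measure \<S> \<mu> using \<mu> by (rule inv_prob_measure)
  interpret N: invariant_measure \<S> \<nu> using \<nu> by (rule inv_prob_measure)
  show ?thesis
  proof
    assume "msupp \<nu> \<subseteq> msupp \<mu>"
    then show "null_ideal \<mu> \<subseteq> null_ideal \<nu>"
      using M.null_ideal_vanish N.null_ideal_vanish by (meson subsetD subsetI)
  next
    assume sub: "null_ideal \<mu> \<subseteq> null_ideal \<nu>"
    show "msupp \<nu> \<subseteq> msupp \<mu>"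
    proof (rule subsetI, rule ccontr)
      fix x assume x: "x \<in> msupp \<nu>" "x \<notin> msupp \<mu>"
      then have disj: "msupp \<mu> \<inter> {x} = {}" by simp
      obtain f :: "'k CK" where f: "\<And>y. y \<in> msupp \<mu> \<Longrightarrow> f y = 0" "\<And>y. y \<in> {x} \<Longrightarrow> f y = 1"
        by (rule Urysohn_CK[OF compact_K M.closed_msupp closed_singleton disj]) (rule that)
      have "f \<in> null_ideal \<nu>" using f(1) sub M.null_ideal_vanish[of f] by (simp add: subset_iff)
      then have "f x = 0" using x(1) N.null_ideal_vanish[of f] by simp
      then show False using f(2)[of x] by simp
    qed
  qed
qed

lemma uniquely_ergodic_imp_null_ideal_inj:
  assumes uniq: "\<forall>\<mu>\<in>ex_inv_prob \<S>. uniquely_ergodic \<S> \<mu>"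
  shows "inj_on null_ideal (ex_inv_prob \<S>)"
proof (rule inj_onI)
  fix \<mu> \<nu> assume \<mu>: "\<mu> \<in> ex_inv_prob \<S>" and \<nu>: "\<nu> \<in> ex_inv_prob \<S>" and eq: "null_ideal \<mu> = null_ideal \<nu>"
  have inv: "\<mu> \<in> inv_prob \<S>" "\<nu> \<in> inv_prob \<S>" using \<mu> \<nu> by (auto simp: ex_inv_prob_def)
  have "msupp \<nu> \<subseteq> msupp \<mu>" using msupp_subset_iff[OF inv] eq by simp
  then have "\<nu> = \<mu>" using bspec[OF uniq \<mu>] inv(2) by (simp add: uniquely_ergodic_def)
  then show "\<mu> = \<nu>" by simp
qed

lemma null_ideal_inj_imp_nid_inj:
  assumes "inj_on null_ideal (ex_inv_prob \<S>)"
  shows "inj_on nid ext"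
proof (rule inj_onI)
  fix \<psi> \<psi>' assume "\<psi> \<in> ext" "\<psi>' \<in> ext" and eq: "nid \<psi> = nid \<psi>'"
  then obtain \<mu> \<nu> where \<mu>: "\<mu> \<in> ex_inv_prob \<S>" "\<psi> = blinfun_apply (functional \<mu>)"
    and \<nu>: "\<nu> \<in> ex_inv_prob \<S>" "\<psi>' = blinfun_apply (functional \<nu>)"
    unfolding ex_inv_prob_ext[symmetric] by blast
  have "null_ideal \<mu> = null_ideal \<nu>"
    using eq \<mu> \<nu> null_ideal_nid[of \<mu>] null_ideal_nid[of \<nu>] by (simp add: ex_inv_prob_def)
  then have "\<mu> = \<nu>" using assms \<mu>(1) \<nu>(1) by (simp add: inj_on_def)
  then show "\<psi> = \<psi>'" using \<mu>(2) \<nu>(2) by simp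
qed

section \<open>The weak* topology on the extreme invariant measures\<close>

lemma topspace_inv_prob: "topspace (inv_prob_topology \<S>) = inv_prob \<S>"
  by (simp add: inv_prob_topology_def topspace_pullback_topology strong_operator_topology_topspace)

lemma topspace_ex_inv_prob: "topspace (ex_inv_prob_topology \<S>) = ex_inv_prob \<S>"
  by (auto simp: ex_inv_prob_topology_def topspace_inv_prob ex_inv_prob_def)

lemma openin_ex_inv_prob:
  "openin (ex_inv_prob_topology \<S>) W \<longleftrightarrow>
    (\<exists>U. openin strong_operator_topology U \<and> W = {\<mu> \<in> ex_inv_prob \<S>. functional \<mu> \<in> U})"
proof -
  have "openin (ex_inv_prob_topology \<S>) W \<longleftrightarrow>
      (\<exists>U. openin strong_operator_topology U \<and> W = (functional -` U \<inter> inv_prob \<S>) \<inter> ex_inv_prob \<S>)"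
    unfolding ex_inv_prob_topology_def inv_prob_topology_def openin_subtopology openin_pullback_topology
    by blast
  moreover have "(functional -` U \<inter> inv_prob \<S>) \<inter> ex_inv_prob \<S> = {\<mu> \<in> ex_inv_prob \<S>. functional \<mu> \<in> U}" for U
    by (auto simp: ex_inv_prob_def)
  ultimately show ?thesis by simp
qed

lemma openin_ex_inv_prob_eval:
  assumes "open V"
  shows "openin (ex_inv_prob_topology \<S>) {\<mu> \<in> ex_inv_prob \<S>. functional \<mu> f \<in> V}"
proof -
  have "openin strong_operator_topology {T \<in> topspace strong_operator_topology. blinfun_apply T f \<in> V}"
    by (rule openin_continuous_map_preimage[OF strong_operator_topology_continuous_evaluation])
      (use assms in simp)
  then show ?thesis
    unfolding openin_ex_inv_prob
    by (intro exI[of _ "{T \<in> topspace strong_operator_topology. blinfun_apply T f \<in> V}"])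
      (simp add: strong_operator_topology_topspace)
qed

lemma Hausdorff_ex_inv_prob: "Hausdorff_space (ex_inv_prob_topology \<S>)"
  unfolding Hausdorff_space_def topspace_ex_inv_prob
proof (intro allI impI)
  fix \<mu> \<nu> assume *: "\<mu> \<in> ex_inv_prob \<S> \<and> \<nu> \<in> ex_inv_prob \<S> \<and> \<mu> \<noteq> \<nu>"
  then have inv: "\<mu> \<in> inv_prob \<S>" "\<nu> \<in> inv_prob \<S>" by (auto simp: ex_inv_prob_def)
  have "blinfun_apply (functional \<mu>) \<noteq> blinfun_apply (functional \<nu>)"
    using inv_prob_inject[OF inv] * by blast
  then obtain f where "functional \<mu> f \<noteq> functional \<nu> f" by (meson ext)
  then obtain U V where UV: "open U" "open V" "functional \<mu> f \<in> U" "functional \<nu> f \<in> V" "U \<inter> V = {}"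
    by (metis hausdorff)
  show "\<exists>U V. openin (ex_inv_prob_topology \<S>) U \<and> openin (ex_inv_prob_topology \<S>) V \<and>
      \<mu> \<in> U \<and> \<nu> \<in> V \<and> disjnt U V"
    using UV * by (intro exI[of _ "{\<mu> \<in> ex_inv_prob \<S>. functional \<mu> f \<in> U}"]
        exI[of _ "{\<mu> \<in> ex_inv_prob \<S>. functional \<mu> f \<in> V}"] conjI openin_ex_inv_prob_eval)
      (auto simp: disjnt_def)
qed

text \<open>The preimage of a generating open set consists of the measures with
  \<open>\<integral>|f| \<noteq> 0\<close> for some \<open>f\<close> in the kernel of
  \<open>A\<close>, a union of weak* open sets.\<close>

lemma continuous_null_ideal: "continuous_map (ex_inv_prob_topology \<S>) (Prim_topology \<S>) null_ideal"
  unfolding Prim_topology_def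
proof (rule continuous_on_generated_topo)
  fix U assume "U \<in> {Prim \<S> - hk_closure \<S> A |A. A \<subseteq> Prim \<S>}"
  then obtain A where A: "A \<subseteq> Prim \<S>" "U = Prim \<S> - hk_closure \<S> A" by blast
  have mem: "null_ideal \<mu> \<in> U \<longleftrightarrow> (\<exists>f\<in>\<Inter>A. functional \<mu> (abs_CK f) \<in> - {0})" if "\<mu> \<in> ex_inv_prob \<S>" for \<mu>
  proof -
    have "null_ideal \<mu> \<in> U \<longleftrightarrow> \<not> \<Inter>A \<subseteq> null_ideal \<mu>"
      using that by (auto simp: A(2) hk_closure_def Prim_ex)
    also have "\<dots> \<longleftrightarrow> (\<exists>f\<in>\<Inter>A. functional \<mu> (abs_CK f) \<in> - {0})"
      using that null_ideal_nid[of \<mu>] by (auto simp: ex_inv_prob_def nid_def)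
    finally show ?thesis .
  qed
  have "null_ideal -` U \<inter> topspace (ex_inv_prob_topology \<S>)
      = (\<Union>f\<in>\<Inter>A. {\<mu> \<in> ex_inv_prob \<S>. functional \<mu> (abs_CK f) \<in> - {0}})"
    unfolding topspace_ex_inv_prob using mem by blast
  also have "openin (ex_inv_prob_topology \<S>) \<dots>"
  proof (rule openin_Union)
    fix W assume "W \<in> (\<lambda>f. {\<mu> \<in> ex_inv_prob \<S>. functional \<mu> (abs_CK f) \<in> - {0}}) ` \<Inter>A"
    then obtain f where "W = {\<mu> \<in> ex_inv_prob \<S>. functional \<mu> (abs_CK f) \<in> - {0}}" by (rule imageE)
    then show "openin (ex_inv_prob_topology \<S>) W" by (simp only:) (rule openin_ex_inv_prob_eval[OF open_Compl[OF closed_singleton]])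
  qed
  finally show "openin (ex_inv_prob_topology \<S>) (null_ideal -` U \<inter> topspace (ex_inv_prob_topology \<S>))" .
next
  have "Prim \<S> = Prim \<S> - hk_closure \<S> {}" by (simp add: hk_closure_empty)
  then have "Prim \<S> \<subseteq> \<Union>{Prim \<S> - hk_closure \<S> A |A. A \<subseteq> Prim \<S>}" by blast
  then show "null_ideal ` topspace (ex_inv_prob_topology \<S>) \<subseteq> \<Union>{Prim \<S> - hk_closure \<S> A |A. A \<subseteq> Prim \<S>}"
    by (simp add: topspace_ex_inv_prob flip: Prim_ex)
qed

text \<open>A continuous fixed function is a fixed vector of L^1, hence constant almost everywhere
  for the ergodic measure of \<open>\<psi>\<close>.\<close>

lemma fix_constant_mod_nid:
  assumes \<psi>: "\<psi> \<in> ext" and g: "g \<in> fix_ops \<S>"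
  shows "g - const_bcontfun (\<psi> g) \<in> nid \<psi>"
proof -
  obtain \<mu> where \<mu>: "\<mu> \<in> ex_inv_prob \<S>" "\<psi> = blinfun_apply (functional \<mu>)"
    using \<psi> unfolding ex_inv_prob_ext[symmetric] by blast
  then interpret invariant_measure \<S> \<mu> by (intro inv_prob_measure) (simp add: ex_inv_prob_def)
  have "approx S (\<lambda>_. g) (apply_bcontfun g)" if "S \<in> \<S>" for S
    using g that by (simp add: approx_def fix_ops_def)
  then have "apply_bcontfun g \<in> L1_fix \<S> \<mu>" unfolding L1_fix_iff by blast
  from bspec[OF extreme_imp_ergodic[OF \<mu>(1), unfolded ergodic_iff_constant] this]
  obtain c where c: "AE x in \<mu>. g x = c" by blast
  have "(\<integral>x. g x \<partial>\<mu>) = (\<integral>x. c \<partial>\<mu>)" by (rule integral_cong_AE) (use c in auto)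
  then have gc: "\<psi> g = c" by (simp add: \<mu>(2) functional_eq prob_space)
  have "AE x in \<mu>. cmod ((g - const_bcontfun c) x) = 0" using c by eventually_elim simp
  then have "(\<integral>x. cmod ((g - const_bcontfun c) x) \<partial>\<mu>) = 0" by (rule integral_eq_zero_AE)
  then have "g - const_bcontfun c \<in> null_ideal \<mu>" unfolding null_ideal_def by blast
  then show ?thesis by (simp add: null_ideal_eq gc \<mu>(2)[symmetric])
qed

end

section \<open>The mean ergodic projection\<close>

locale mean_ergodic_semigroup = markov_semigroup \<S> for \<S> :: "'k::t2_space CK_op set" +
  fixes P :: "'k CK_op"
  assumes P_closure: "P \<in> strong_operator_topology closure_of (convex hull \<S>)"
    and SP: "S \<in> \<S> \<Longrightarrow> S o\<^sub>L P = P"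
begin

lemma P_fix: "P f \<in> fix_ops \<S>"
  using SP by (auto simp: fix_ops_def simp flip: blinfun_apply_blinfun_compose)

text \<open>The operators \<open>T\<close> with \<open>\<psi> (T f) = c\<close> form a convex set
  that is closed in the strong operator topology.\<close>

lemma state_P:
  assumes \<psi>: "\<psi> \<in> states" and const: "\<And>S. S \<in> \<S> \<Longrightarrow> \<psi> (S f) = c"
  shows "\<psi> (P f) = c"
proof -
  let ?D = "{T :: 'k CK_op. \<psi> (blinfun_apply T f) = c}"
  have "convex ?D"
  proof (rule convexI, clarify)
    fix S T :: "'k CK_op" and u v :: real
    assume "c = \<psi> (blinfun_apply S f)" and T: "\<psi> (blinfun_apply T f) = \<psi> (blinfun_apply S f)" and uv: "u + v = 1"
    have "of_real u * \<psi> (blinfun_apply S f) + of_real v * \<psi> (blinfun_apply S f) = of_real (u + v) * \<psi> (blinfun_apply S f)"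
      by (simp add: distrib_right)
    then show "\<psi> (blinfun_apply (u *\<^sub>R S + v *\<^sub>R T) f) = \<psi> (blinfun_apply S f)"
      using T uv by (simp add: blinfun.add_left blinfun.scaleR_left state_add[OF \<psi>] state_scaleR[OF \<psi>])
  qed
  then have "convex hull \<S> \<subseteq> ?D" using const by (intro hull_minimal) auto
  moreover have "closedin strong_operator_topology ?D"
  proof -
    have "closed {h. \<psi> h = c}"
      using continuous_closed_preimage_constant[OF state_continuous[OF \<psi>] closed_UNIV, of c] by simp
    then have "closedin strong_operator_topology
        {T \<in> topspace strong_operator_topology. blinfun_apply T f \<in> {h. \<psi> h = c}}"
      by (intro closedin_continuous_map_preimage[OF strong_operator_topology_continuous_evaluation]) simp
    then show ?thesis by (simp add: strong_operator_topology_topspace)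
  qed
  ultimately have "strong_operator_topology closure_of (convex hull \<S>) \<subseteq> ?D" by (rule closure_of_minimal)
  then show ?thesis using P_closure by blast
qed

lemma inv_state_P:
  assumes "\<nu> \<in> inv_states"
  shows "\<nu> (P f) = \<nu> f"
  using inv_state_state[OF assms] by (rule state_P) (rule inv_state_inv[OF assms])

text \<open>For the chosen extension \<open>G\<close> of \<open>f\<close> every \<open>S G\<close>
  agrees with \<open>f\<close> on the support of the radical; \<open>state_P\<close> at point
  evaluations transfers this to the fixed function \<open>P G\<close>.\<close>

lemma P_extends_rad_fix:
  assumes f: "f \<in> rad_fix \<S>"
  shows "\<exists>F\<in>fix_ops \<S>. f = restrict (apply_bcontfun F) (rad_support \<S>)"
proof -
  let ?M = "rad_support \<S>"
  have fM: "f \<in> extensional ?M" "continuous_on ?M f" and ind: "\<And>S. S \<in> \<S> \<Longrightarrow> induced_op ?M S f = f"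
    using f by (auto simp: rad_fix_def C_on_def)
  define G :: "'k CK" where "G = (SOME F. \<forall>x\<in>?M. apply_bcontfun F x = f x)"
  have SG: "apply_bcontfun (blinfun_apply S G) x = f x" if "S \<in> \<S>" "x \<in> ?M" for S x
    using fun_cong[OF ind[OF that(1)], of x] that(2) by (simp add: induced_op_def G_def)
  have "apply_bcontfun (P G) x = f x" if "x \<in> ?M" for x
    by (rule state_P[OF eval_state]) (rule SG[OF _ that])
  then have "f = restrict (apply_bcontfun (P G)) ?M"
    using fM(1) by (auto simp: fun_eq_iff restrict_def extensional_def)
  then show ?thesis using P_fix by blast
qed

lemma uniquely_ergodic_ex:
  assumes \<mu>: "\<mu> \<in> ex_inv_prob \<S>"
  shows "uniquely_ergodic \<S> \<mu>"
  unfolding uniquely_ergodic_def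
proof (intro ballI impI)
  fix \<nu> assume \<nu>: "\<nu> \<in> inv_prob \<S>" and sub: "msupp \<nu> \<subseteq> msupp \<mu>"
  have \<mu>_inv: "\<mu> \<in> inv_prob \<S>" using \<mu> by (simp add: ex_inv_prob_def)
  let ?\<psi> = "blinfun_apply (functional \<mu>)" and ?\<phi> = "blinfun_apply (functional \<nu>)"
  have \<psi>: "?\<psi> \<in> ext" using \<mu> ex_inv_prob_ext by blast
  have \<phi>: "?\<phi> \<in> inv_states" by (rule functional_inv_state[OF \<nu>])
  note \<phi>s = inv_state_state[OF \<phi>]
  have nid: "nid ?\<psi> \<subseteq> nid ?\<phi>"
    using msupp_subset_iff[OF \<mu>_inv \<nu>] sub by (simp add: null_ideal_nid[OF \<mu>_inv] null_ideal_nid[OF \<nu>])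
  have "?\<phi> f = ?\<psi> f" for f
  proof -
    have "P f - const_bcontfun (?\<psi> (P f)) \<in> nid ?\<phi>" using fix_constant_mod_nid[OF \<psi> P_fix] nid by blast
    from nid_zero[OF \<phi>s this] have "?\<phi> (P f) = ?\<psi> (P f)" by (simp add: state_diff[OF \<phi>s] state_const[OF \<phi>s])
    then show ?thesis using inv_state_P[OF \<phi>, of f] inv_state_P[OF ext_inv[OF \<psi>], of f] by simp
  qed
  then show "\<nu> = \<mu>" by (intro inv_prob_inject[OF \<nu> \<mu>_inv]) (simp add: fun_eq_iff)
qed

lemma P_constant_on_zeros:
  assumes "\<psi> \<in> ext" "x \<in> zeros (nid \<psi>)"
  shows "apply_bcontfun (P f) x = \<psi> f"
proof -
  have "P f - const_bcontfun (\<psi> (P f)) \<in> nid \<psi>" by (rule fix_constant_mod_nid[OF assms(1) P_fix])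
  then have "(P f - const_bcontfun (\<psi> (P f))) x = 0" using assms(2) unfolding zeros_def by blast
  then show ?thesis using inv_state_P[OF ext_inv[OF assms(1)]] by simp
qed

lemma closed_null_ideal: "closed_map (ex_inv_prob_topology \<S>) (Prim_topology \<S>) null_ideal"
  unfolding closed_map_def
proof (intro allI impI)
  fix C assume C: "closedin (ex_inv_prob_topology \<S>) C"
  then have C_sub: "C \<subseteq> ex_inv_prob \<S>" using closedin_subset topspace_ex_inv_prob by blast
  let ?A = "null_ideal ` C"
  have A_sub: "?A \<subseteq> Prim \<S>" using C_sub by (auto simp: Prim_ex)
  have "hk_closure \<S> ?A \<subseteq> ?A"
  proof
    fix q assume q: "q \<in> hk_closure \<S> ?A"
    then obtain \<nu> where \<nu>: "\<nu> \<in> ex_inv_prob \<S>" "q = null_ideal \<nu>" by (auto simp: hk_closure_def Prim_ex)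
    have inter: "\<Inter>?A \<subseteq> null_ideal \<nu>" using q \<nu>(2) by (simp add: hk_closure_def)
    have "\<nu> \<in> C"
    proof (rule ccontr)
      assume "\<nu> \<notin> C"
      have "openin (ex_inv_prob_topology \<S>) (ex_inv_prob \<S> - C)"
        using C by (simp add: closedin_def topspace_ex_inv_prob)
      then obtain U where U: "openin strong_operator_topology U"
        "ex_inv_prob \<S> - C = {\<mu> \<in> ex_inv_prob \<S>. functional \<mu> \<in> U}"
        unfolding openin_ex_inv_prob by blast
      have \<nu>U: "functional \<nu> \<in> U" using U(2) \<nu>(1) \<open>\<nu> \<notin> C\<close> by blast
      obtain F e where F: "finite F" "0 < e"
        "\<And>T. (\<And>f. f \<in> F \<Longrightarrow> norm (blinfun_apply T f - blinfun_apply (functional \<nu>) f) < e) \<Longrightarrow> T \<in> U"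
        using strong_operator_topology_nbhd[OF U(1) \<nu>U] by metis
      let ?\<phi> = "blinfun_apply (functional \<nu>)"
      \<comment> \<open>This function vanishes on the support of each measure in \<open>C\<close>,
        where some constant \<open>P f\<close> with \<open>f\<close> in \<open>F\<close> is at least
        \<open>e\<close> away from its value for \<open>\<nu>\<close>; on the support of
        \<open>\<nu>\<close> the sum vanishes and \<open>k\<close> equals \<open>e\<close>.\<close>
      define k where "k = Bcontfun (\<lambda>x. complex_of_real (max (e - (\<Sum>f\<in>F. cmod (apply_bcontfun (P f) x - ?\<phi> f))) 0))"
      have k: "apply_bcontfun k x = of_real (max (e - (\<Sum>f\<in>F. cmod (apply_bcontfun (P f) x - ?\<phi> f))) 0)" for x
        unfolding k_def
        by (rule Bcontfun_real_apply[OF compact_K]) (auto intro!: continuous_intros)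
      have "k \<in> \<Inter>?A"
      proof (rule InterI)
        fix p assume "p \<in> ?A"
        then obtain \<mu> where \<mu>: "\<mu> \<in> C" "p = null_ideal \<mu>" by blast
        then have \<mu>_ex: "\<mu> \<in> ex_inv_prob \<S>" using C_sub by blast
        let ?\<psi> = "blinfun_apply (functional \<mu>)"
        have \<psi>: "?\<psi> \<in> ext" using \<mu>_ex ex_inv_prob_ext by blast
        have "functional \<mu> \<notin> U" using U(2) \<mu>(1) \<mu>_ex by blast
        then obtain f where f: "f \<in> F" "e \<le> cmod (?\<psi> f - ?\<phi> f)" using F(3)[of "functional \<mu>"] by force
        have "k \<in> nid ?\<psi>"
        proof (rule vanish_imp_nid[OF compact_K ext_state[OF \<psi>]])
          fix x assume x: "x \<in> zeros (nid ?\<psi>)"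
          have "e \<le> cmod (apply_bcontfun (P f) x - ?\<phi> f)" using f(2) P_constant_on_zeros[OF \<psi> x] by simp
          also have "\<dots> \<le> (\<Sum>f\<in>F. cmod (apply_bcontfun (P f) x - ?\<phi> f))"
            by (rule member_le_sum) (use f(1) F(1) in auto)
          finally show "k x = 0" by (simp add: k)
        qed
        then show "k \<in> p" using \<mu>_ex by (simp add: \<mu>(2) null_ideal_nid ex_inv_prob_def)
      qed
      then have k_nid: "k \<in> nid ?\<phi>" using inter \<nu>(1) null_ideal_nid[of \<nu>] by (auto simp: ex_inv_prob_def)
      have \<phi>: "?\<phi> \<in> ext" using \<nu>(1) ex_inv_prob_ext by blast
      \<comment> \<open>Since \<open>k\<close> lies in the ideal and equals \<open>e\<close> on its
        zero set, that set is empty; the ideal would then contain \<open>1\<close>.\<close>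
      have "zeros (nid ?\<phi>) = {}"
      proof (rule equals0I)
        fix x assume x: "x \<in> zeros (nid ?\<phi>)"
        then have "apply_bcontfun k x = 0" using k_nid by (simp add: zeros_def)
        then show False using F(2) by (simp add: k P_constant_on_zeros[OF \<phi> x])
      qed
      then have "const_bcontfun 1 \<in> nid ?\<phi>" by (intro vanish_imp_nid[OF compact_K ext_state[OF \<phi>]]) simp
      then show False using nid_one[OF ext_state[OF \<phi>]] by blast
    qed
    then show "q \<in> ?A" using \<nu>(2) by blast
  qed
  moreover have "?A \<subseteq> hk_closure \<S> ?A" using A_sub by (auto simp: hk_closure_def)
  ultimately have "hk_closure \<S> ?A = ?A" by blast
  then have "openin (Prim_topology \<S>) (Prim \<S> - ?A)" using openin_Prim_basic[OF A_sub] by simp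
  then show "closedin (Prim_topology \<S>) ?A" using A_sub by (simp add: closedin_def topspace_Prim)
qed

lemma homeomorphic_null_ideal:
  "homeomorphic_map (ex_inv_prob_topology \<S>) (Prim_topology \<S>) null_ideal"
proof (rule bijective_closed_imp_homeomorphic_map[OF continuous_null_ideal closed_null_ideal])
  show "null_ideal ` topspace (ex_inv_prob_topology \<S>) = topspace (Prim_topology \<S>)"
    by (simp add: topspace_ex_inv_prob topspace_Prim Prim_ex)
  show "inj_on null_ideal (topspace (ex_inv_prob_topology \<S>))"
    unfolding topspace_ex_inv_prob by (rule uniquely_ergodic_imp_null_ideal_inj) (use uniquely_ergodic_ex in blast)
qed

end

theorem theorem7p1:
  fixes \<S> :: "'k::t2_space CK_op set"
  assumes "compact (UNIV :: 'k set)"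
    and "op_semigroup \<S>"
    and "\<forall>S\<in>\<S>. markov_op S"
    and "right_amenable \<S>"
  shows
    "(mean_ergodic \<S>
      \<longleftrightarrow>
        homeomorphic_map (ex_inv_prob_topology \<S>) (Prim_topology \<S>) null_ideal \<and>
        (\<forall>f\<in>rad_fix \<S>. \<exists>F\<in>fix_ops \<S>. f = restrict F (rad_support \<S>)))
     \<and>
     (mean_ergodic \<S>
      \<longleftrightarrow>
        Hausdorff_space (Prim_topology \<S>) \<and>
        (\<forall>\<mu>\<in>ex_inv_prob \<S>. uniquely_ergodic \<S> \<mu>) \<and>
        (\<forall>f\<in>rad_fix \<S>. \<exists>F\<in>fix_ops \<S>. f = restrict F (rad_support \<S>)))"
    (is "(?a \<longleftrightarrow> ?h \<and> ?e) \<and> (?a \<longleftrightarrow> ?H \<and> ?u \<and> ?e)")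
proof -
  interpret markov_semigroup \<S> using assms by unfold_locales auto
  have fwd: "?h \<and> ?u \<and> ?e" if me: "mean_ergodic \<S>"
  proof -
    obtain P where P: "P \<in> strong_operator_topology closure_of (convex hull \<S>)" "\<And>S. S \<in> \<S> \<Longrightarrow> S o\<^sub>L P = P"
      using me unfolding mean_ergodic_def by blast
    then interpret mean_ergodic_semigroup \<S> P by unfold_locales
    show ?thesis using homeomorphic_null_ideal uniquely_ergodic_ex P_extends_rad_fix by (intro conjI ballI)
  qed
  \<comment> \<open>The extreme measures form a Hausdorff space, and the homeomorphism carries this
    over.\<close>
  have H: "?H" if "?h"
    using homeomorphic_Hausdorff_space[OF homeomorphic_map_imp_homeomorphic_space[OF that]]
      Hausdorff_ex_inv_prob by simp
  \<comment> \<open>Injectivity is supplied in (b) by the homeomorphism and in (c) by unique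
    ergodicity of the supports.\<close>
  have bwd: "?a" if "?H" "inj_on null_ideal (ex_inv_prob \<S>)" "?e"
  proof -
    interpret hausdorff_prim \<S>
      using that(1) null_ideal_inj_imp_nid_inj[OF that(2)] by unfold_locales
    show ?thesis by (rule mean_ergodic_if_extension[OF that(3)])
  qed
  have b: "?a" if "?h \<and> ?e"
  proof (rule bwd)
    show "inj_on null_ideal (ex_inv_prob \<S>)"
      using homeomorphic_imp_injective_map[of "ex_inv_prob_topology \<S>"] that topspace_ex_inv_prob by auto
  qed (use that H in auto)
  have c: "?a" if "?H \<and> ?u \<and> ?e"
    using that uniquely_ergodic_imp_null_ideal_inj by (intro bwd) auto
  show ?thesis using fwd H b c by blast
qed

end
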